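(* Let $\Lambda=\Lambda(f)$ be a Fréchet max-stable envelope class whose envelope $f$ is ultimately non-increasing, let $(m_n)_{n\ge 1}$ be its exact threshold sequence, and let $Q_n$ be the coding probability of the ETAC-code on sequences of length $n$. Then there exists a constant $\kappa_\Lambda>0$ (possibly depending on $\Lambda$) such that, as $n\to\infty$, $$(\kappa_\Lambda+o_\Lambda(1))\, m_n \le R^+(\Lambda_n)\le R^+(Q_n,\Lambda_n)\le (5/2+o_\Lambda(1))\, m_n\log n .$$ In particular $$R^+(Q_n,\Lambda_n)\le \Big(\tfrac{5}{2\kappa_\Lambda}+o_\Lambda(1)\Big)\log n\; R^+(\Lambda_n).$$
   Context: All logarithms $\log$ are base 2; $o_\Lambda(1)$ denotes a quantity depending only on $\Lambda$ and $n$ that tends to $0$ as $n\to\infty$. Envelope classes: let $f:\mathbb N_+\to(0,1]$ with $1<\sum_{j\ge1}f(j)<\infty$. $\Lambda(f)$ is the set of stationary memoryless (i.i.d.) sources $\mathbb P$ on $\mathbb N_+^{\mathbb N}$ whose marginal satisfies $\mathbb P_1\{j\}\le f(j)$ for all $j\in\mathbb N_+$; $\Lambda_n$ denotes the set of their restrictions $\mathbb P_n$ to the first $n$ symbols. The envelope distribution is $F(k)=1-\sum_{j>k}f(j)$ when $\sum_{j>k}f(j)<1$ and $F(k)=0$ otherwise. A smoothed envelope distribution is a c.d.f. on $\mathbb R_+$ (still denoted $F$) coinciding with $F$ on $\mathbb N$, with continuous derivative that is positive at every $x$ with $F(\lfloor x\rfloor)\in(0,1)$. Let $\overline F=1-F$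 and $U(t)=\overline F^{-1}(1/t)$. $F$ belongs to $\mathrm{MDA}(\gamma)$ if there are $A_n>0$ with $F^n(A_nx+U(n))\to \exp(-(1+\gamma x)^{-1/\gamma})$ for all $x$ with $1+\gamma x>0$. $\Lambda(f)$ is a Fréchet max-stable envelope class if its smoothed envelope distribution is in $\mathrm{MDA}(\gamma)$ for some $\gamma>0$ (equivalently, $\overline F$ is regularly varying with index $-1/\gamma$). The exact threshold is $m(t)$, the solution $x$ of $\overline F(x)=x/t$ (equivalently $U(t/x)=x$), and $m_n=m(n)$. Redundancy: for a coding probability $Q_n$ on $\mathbb N_+^n$, $R^+(Q_n,\Lambda_n)=\sup_{\mathbb P\in\Lambda}D(\mathbb P_n,Q_n)$ with $D$ the Kullback–Leibler divergence (base 2), and $R^+(\Lambda_n)=\inf_{Q_n}R^+(Q_n,\Lambda_n)$ (minimax redundancy). ETAC-code: for $x_{1:n}\in\mathbb N_+^n$ and $i\le n$, let $x_{1,i}\ge\dots\ge x_{i,i}$ be the non-increasing rearrangement of $x_{1:i}$ and $M_i=\min(i,\min\{k: x_{k,i}\le k\})$. The first symbol is not censored; for $i\ge2$, symbol $x_i$ is censored if $x_i>M_{i-1}$. The censored sequence $\tilde x_{1:n}$ replaces censored symbols by $0$; $\tilde x_{1:n}0$ (a terminating $0$ appended) is arithmetic-coded with predictive probabilities $\tilde Q_{i+1}(j\mid x_{1:i})=\frac{n_i^j+1/2}{i+(M_i+1)/2}$, $j\in\{0,\dots,M_i\}$, where $n_i^j$ is the number of occurrences of $j$ in $x_{1:i}$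 and $n_i^0=0$; each censored symbol $x_i$ is additionally encoded by the Elias penultimate (delta) code of $x_i-M_{i-1}+1$, and these codewords are interleaved with the arithmetic codewords. This yields a uniquely decodable code of length $\ell(x_{1:n})$, and $Q_n$ is the corresponding coding probability $Q_n(x_{1:n})\propto 2^{-\ell(x_{1:n})}$.
   Formalization: The first symbol is treated as censored (M_0 = 0) and sent by the Elias code of x_1+1, since leaving it uncensored gives it no codeword under the predictive law on {0} and makes the sum of 2^{-ℓ} diverge, so that Q_n would be undefined. *)

theory Defs
  imports "HOL-Analysis.Analysis"
begin

text \<open>Envelope function f : N+ -> (0,1]; the value f 0 is irrelevant.\<close>
definition envelope :: "(nat \<Rightarrow> real) \<Rightarrow> bool" where
  "envelope f \<longleftrightarrow> (\<forall>j\<ge>1. 0 < f j \<and> f j \<le> 1) \<and> f summable_on {1..} \<and> 1 < (\<Sum>\<^sub>\<infinity>j\<in>{1..}. f j)"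

text \<open>Marginals of the memoryless sources in Lambda(f) (probability mass functions on N+,
  represented as functions on nat vanishing at 0).\<close>
definition env_class :: "(nat \<Rightarrow> real) \<Rightarrow> (nat \<Rightarrow> real) set" where
  "env_class f = {p. (\<forall>j. 0 \<le> p j) \<and> p 0 = 0 \<and> (p has_sum 1) {1..} \<and> (\<forall>j\<ge>1. p j \<le> f j)}"

definition seqs :: "nat \<Rightarrow> nat list set" where
  "seqs n = {xs. length xs = n \<and> (\<forall>x\<in>set xs. 1 \<le> x)}"

definition src_n :: "(nat \<Rightarrow> real) \<Rightarrow> nat list \<Rightarrow> real" where
  "src_n p xs = prod_list (map p xs)"

definition env_F :: "(nat \<Rightarrow> real) \<Rightarrow> nat \<Rightarrow> real" where
  "env_F f k = (let r = (\<Sum>\<^sub>\<infinity>j\<in>{k<..}. f j) in if r < 1 then 1 - r else 0)"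

definition smoothed_env :: "(nat \<Rightarrow> real) \<Rightarrow> (real \<Rightarrow> real) \<Rightarrow> bool" where
  "smoothed_env f G \<longleftrightarrow>
     mono G \<and> (\<forall>x<0. G x = 0) \<and> (G \<longlongrightarrow> 1) at_top \<and>
     (\<forall>k::nat. G (real k) = env_F f k) \<and>
     (\<exists>G'. continuous_on {0..} G' \<and>
        (\<forall>x\<ge>0. (G has_real_derivative G' x) (at x within {0..})) \<and>
        (\<forall>x\<ge>0. 0 < env_F f (nat \<lfloor>x\<rfloor>) \<and> env_F f (nat \<lfloor>x\<rfloor>) < 1 \<longrightarrow> 0 < G' x))"

definition U_of :: "(real \<Rightarrow> real) \<Rightarrow> real \<Rightarrow> real" where
  "U_of G t = Inf {x. 1 - 1 / t \<le> G x}"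

text \<open>Maximum domain of attraction MDA(gamma), for gamma > 0.\<close>
definition in_MDA :: "(real \<Rightarrow> real) \<Rightarrow> real \<Rightarrow> bool" where
  "in_MDA G \<gamma> \<longleftrightarrow> (\<exists>A :: nat \<Rightarrow> real. (\<forall>n. 0 < A n) \<and>
     (\<forall>x. 0 < 1 + \<gamma> * x \<longrightarrow>
        ((\<lambda>n. (G (A n * x + U_of G (real n))) ^ n) \<longlongrightarrow> exp (- ((1 + \<gamma> * x) powr (- 1 / \<gamma>)))) sequentially))"

definition threshold :: "(real \<Rightarrow> real) \<Rightarrow> real \<Rightarrow> real" where
  "threshold G t = (THE x. 1 - G x = x / t)"

text \<open>Kullback-Leibler divergence (base 2) of probability mass functions on a countable set A,
  with value +infinity when P is not absolutely continuous w.r.t. Q or the series diverges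
  (its negative part always converges for probability mass functions).\<close>
definition KL :: "('a \<Rightarrow> real) \<Rightarrow> ('a \<Rightarrow> real) \<Rightarrow> 'a set \<Rightarrow> ereal" where
  "KL P Q A = (let S = {x\<in>A. 0 < P x} in
     if (\<exists>x\<in>S. Q x \<le> 0) then \<infinity>
     else if (\<lambda>x. P x * log 2 (P x / Q x)) summable_on S
          then ereal (\<Sum>\<^sub>\<infinity>x\<in>S. P x * log 2 (P x / Q x))
          else \<infinity>)"

definition coding_probs :: "nat \<Rightarrow> (nat list \<Rightarrow> real) set" where
  "coding_probs n = {Q. (\<forall>xs\<in>seqs n. 0 \<le> Q xs) \<and> (Q has_sum 1) (seqs n)}"

definition redundancy :: "(nat \<Rightarrow> real) \<Rightarrow> nat \<Rightarrow> (nat list \<Rightarrow> real) \<Rightarrow> ereal" where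
  "redundancy f n Q = (SUP p\<in>env_class f. KL (src_n p) Q (seqs n))"

definition minimax_redundancy :: "(nat \<Rightarrow> real) \<Rightarrow> nat \<Rightarrow> ereal" where
  "minimax_redundancy f n = (INF Q\<in>coding_probs n. redundancy f n Q)"

text \<open>M_i for the prefix ys = x_{1:i} (i = length ys); M_0 = 0.
  rev (sort ys) ! (k-1) is the k-th largest element x_{k,i}.\<close>
definition etac_M :: "nat list \<Rightarrow> nat" where
  "etac_M ys = (let i = length ys; s = rev (sort ys) in
     if (\<exists>k\<in>{1..i}. s ! (k - 1) \<le> k) then (LEAST k. k \<in> {1..i} \<and> s ! (k - 1) \<le> k) else i)"

definition etac_cnt :: "nat list \<Rightarrow> nat \<Rightarrow> nat" where
  "etac_cnt ys j = (if j = 0 then 0 else count_list ys j)"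

definition etac_pred :: "nat list \<Rightarrow> nat \<Rightarrow> real" where
  "etac_pred ys j = (real (etac_cnt ys j) + 1/2) / (real (length ys) + (real (etac_M ys) + 1) / 2)"

text \<open>Position i (0-based, i.e. symbol x_{i+1}) is censored iff x_{i+1} > M_i.\<close>
definition etac_censored :: "nat list \<Rightarrow> nat \<Rightarrow> bool" where
  "etac_censored xs i \<longleftrightarrow> etac_M (take i xs) < xs ! i"

definition etac_tilde :: "nat list \<Rightarrow> nat \<Rightarrow> nat" where
  "etac_tilde xs i = (if etac_censored xs i then 0 else xs ! i)"

text \<open>Probability assigned to tilde x_{1:n} 0 by the predictive distributions.\<close>
definition etac_arith_prob :: "nat list \<Rightarrow> real" where
  "etac_arith_prob xs = (\<Prod>i<length xs. etac_pred (take i xs) (etac_tilde xs i)) * etac_pred xs 0"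

text \<open>Length of the Elias penultimate (delta) codeword of k >= 1.\<close>
definition elias_len :: "nat \<Rightarrow> nat" where
  "elias_len k = nat \<lfloor>log 2 (real k)\<rfloor> + 2 * nat \<lfloor>log 2 (real (nat \<lfloor>log 2 (real k)\<rfloor>) + 1)\<rfloor> + 1"

definition etac_len :: "nat list \<Rightarrow> nat" where
  "etac_len xs = nat \<lceil>- log 2 (etac_arith_prob xs)\<rceil> + 1 +
     (\<Sum>i\<in>{i. i < length xs \<and> etac_censored xs i}. elias_len (xs ! i - etac_M (take i xs) + 1))"

definition etac_Q :: "nat \<Rightarrow> nat list \<Rightarrow> real" where
  "etac_Q n xs = (if xs \<in> seqs n
     then 2 powr (- real (etac_len xs)) / (\<Sum>\<^sub>\<infinity>ys\<in>seqs n. 2 powr (- real (etac_len ys)))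
     else 0)"

end

theory Submission
  imports Defs "HOL-Real_Asymp.Real_Asymp"
begin

text \<open>
  Membership in \<open>MDA(\<gamma>)\<close> makes the tail \<open>1 - F\<close> regularly varying with index \<open>-\<alpha> = -1/\<gamma>\<close>. Hence
  \<open>m\<^sub>n\<close> grows like \<open>n\<close> to the power \<open>1/(1+\<alpha>)\<close>, \<open>\<Sum>\<^sub>i\<^sub><\<^sub>n m\<^sub>i / i\<close> is at most about \<open>(1+\<alpha>) m\<^sub>n\<close>, and, \<open>f\<close> being ultimately
  non-increasing, \<open>f(x)\<close> decays like \<open>x\<close> to the power \<open>-(1+\<alpha>)\<close>.

  Upper bound. Comparing the KT product with the maximum likelihood, the code length exceeds \<open>-log P\<close> by at
  most \<open>O(\<Sum> M\<^sub>i / i)\<close> plus a cost \<open>log n + log f(x) + Elias(x)\<close> for each censored symbol \<open>x\<close>. By an exponential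
  Markov bound, the \<open>i\<close>-th symbol is censored with probability at most about \<open>2 m\<^sub>i / i\<close>, and censored symbols below
  \<open>m\<^sub>n / log\<^sup>2 n\<close> are negligible. Above that level \<open>f(x) \<approx> x\<^sup>-\<^sup>1\<^sup>-\<^sup>\<alpha>\<close> reduces the cost to about \<open>log n / (1+\<alpha>)\<close>,
  so the total is at most about \<open>2 m\<^sub>n log n\<close>; the slack up to \<open>5/2\<close> absorbs all approximations. Expectations
  are finite sums over words in a finite alphabet, on which the source is a sub-probability.

  Lower bound. A hypercube of sources, each placing mass of order \<open>1/n\<close> on one symbol out of every pair of
  consecutive symbols among about \<open>m\<^sub>n\<close> pairs just beyond \<open>m\<^sub>n\<close>, reveals a constant fraction of its bits in \<open>n\<close> samples,
  and the mutual information is a lower bound for the minimax redundancy.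
\<close>

section \<open>Regular variation from the maximum domain of attraction\<close>

text \<open>The final constant does not depend on \<open>\<alpha>\<close> because two factors
  cancel: the sum of \<open>m i / i\<close> brings \<open>1 + \<alpha>\<close>, while a censored
  symbol costs about \<open>log n / (1 + \<alpha>)\<close>. The remaining 2 comes from the deviation
  estimate for \<open>etac_M\<close>: at a level k where n times the tail is
  \<open>u > 2 * k\<close>, the moment bound \<open>exp (- u / 2)\<close> must beat the factor
  \<open>2 ^ k\<close>. The approximations are budgeted as
  \<open>2 * (23/20) * (102/100) + 1/10 < 5/2\<close>. The cutoff \<open>m n / (log n)^2\<close>
  balances two demands. Below it a symbol may cost as much as log n bits, but the expected number of
  such censored symbols is of order \<open>m n / log n\<close>, hence their total is of order
  \<open>m n\<close>. Above it, log x is still at least about \<open>log (m n)\<close>, which drives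
  the cost per symbol down. No representation theorem for regularly varying functions is invoked;
  dyadic power bounds suffice. The norming sequence A of the MDA condition is arbitrary, so its
  growth and the limit of \<open>U n / A n\<close> have to be derived first.\<close>

lemma limsup_halving_recursion:
  fixes b c t :: "nat \<Rightarrow> real"
  assumes b0: "\<And>n. 0 \<le> b n"
    and rec: "\<forall>\<^sub>F n in sequentially. b n \<le> c n + t n * b (n div 2)"
    and c: "c \<longlonglongrightarrow> c0" and t: "t \<longlonglongrightarrow> t0" and t0: "0 < t0" "t0 < 1"
    and L: "c0 / (1 - t0) < L"
  shows "\<forall>\<^sub>F n in sequentially. b n < L"
proof -
  \<comment> \<open>The affine recursion has fixed point \<open>c0 / (1 - t0)\<close>. Raising
    \<open>t0\<close> to s and \<open>c0\<close> to \<open>c1\<close> moves the fixed point to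
    \<open>L1\<close>, still below L, and each halving of n then shrinks the excess over
    \<open>L1\<close> by the factor s.\<close>
  obtain L1 where L1: "c0 / (1 - t0) < L1" "L1 < L" using dense[OF L] by blast
  have "((\<lambda>s. s * L1 + c0) \<longlongrightarrow> t0 * L1 + c0) (at_right t0)"
    by (intro tendsto_intros)
  moreover have "t0 * L1 + c0 < L1"
    using L1(1) t0 by (simp add: field_simps)
  ultimately have "\<forall>\<^sub>F s in at_right t0. s * L1 + c0 < L1"
    by (rule order_tendstoD)
  moreover have "\<forall>\<^sub>F s in at_right t0. s < 1" using t0
    by (meson eventually_at_right_less eventually_at_rightI greaterThanLessThan_iff)
  moreover have "\<forall>\<^sub>F s in at_right t0. t0 < s" by (simp add: eventually_at_right_less)
  ultimately have "\<forall>\<^sub>F s in at_right t0. s * L1 + c0 < L1 \<and> s < 1 \<and> t0 < s"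
    by eventually_elim auto
  from eventually_happens'[OF trivial_limit_at_right_real this]
  obtain s where s: "s * L1 + c0 < L1" "s < 1" "t0 < s" by blast
  define c1 where "c1 = L1 - s * L1"
  have c1: "c0 < c1" using s by (simp add: c1_def)
  have "\<forall>\<^sub>F n in sequentially. c n < c1" "\<forall>\<^sub>F n in sequentially. t n < s"
    using order_tendstoD(2)[OF c c1] order_tendstoD(2)[OF t s(3)] by auto
  with rec have "\<forall>\<^sub>F n in sequentially. b n \<le> c1 + s * b (n div 2)"
  proof eventually_elim
    case (elim n)
    have "t n * b (n div 2) \<le> s * b (n div 2)" using elim b0 by (intro mult_right_mono) auto
    with elim show ?case by linarith
  qed
  then obtain n0 where n0: "\<And>n. n \<ge> n0 \<Longrightarrow> b n \<le> c1 + s * b (n div 2)"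
    by (auto simp: eventually_sequentially)
  define n1 where "n1 = max n0 1"
  have n1: "n \<ge> n1 \<Longrightarrow> b n - L1 \<le> s * (b (n div 2) - L1)" for n
    using n0[of n] by (simp add: n1_def c1_def algebra_simps)
  define K where "K = (\<Sum>n<n1. b n) + \<bar>L1\<bar>"
  have K0: "0 \<le> K" using b0 by (auto simp: K_def intro!: add_nonneg_nonneg sum_nonneg)
  have s0: "0 < s" using s t0 by auto
  have bd: "b n - L1 \<le> K" for n
  proof (induction n rule: less_induct)
    case (less n)
    show ?case
    proof (cases "n < n1")
      case True
      have "b n \<le> (\<Sum>n<n1. b n)" using True b0 by (intro member_le_sum) auto
      then show ?thesis by (simp add: K_def)
    next
      case False
      then have "n div 2 < n" by (auto simp: n1_def)
      with less.IH have "b (n div 2) - L1 \<le> K" by blast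
      then have "s * (b (n div 2) - L1) \<le> s * K" using s0 by auto
      also have "\<dots> \<le> 1 * K" using s K0 by (intro mult_right_mono) auto
      finally show ?thesis using n1[of n] False by auto
    qed
  qed
  have dec: "n \<ge> 2 ^ j * n1 \<Longrightarrow> b n - L1 \<le> s ^ j * K" for j n
  proof (induction j arbitrary: n)
    case 0 then show ?case using bd by simp
  next
    case (Suc j)
    have "n div 2 \<ge> 2 ^ j * n1" using Suc.prems by auto
    then have "b (n div 2) - L1 \<le> s ^ j * K" by (rule Suc.IH)
    then have "s * (b (n div 2) - L1) \<le> s * (s ^ j * K)" using s0 by auto
    moreover have "n \<ge> n1"
    proof -
      have "n1 \<le> 2 ^ Suc j * n1" by simp
      with Suc.prems show ?thesis by linarith
    qed
    ultimately show ?case using n1[of n] by (simp add: mult.assoc)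
  qed
  have "(\<lambda>j. s ^ j * K) \<longlonglongrightarrow> 0 * K" using s s0 by (intro tendsto_intros LIMSEQ_realpow_zero) auto
  then have "\<forall>\<^sub>F j in sequentially. s ^ j * K < L - L1"
    using L1 by (intro order_tendstoD) auto
  then obtain j where "s ^ j * K < L - L1" by (auto simp: eventually_sequentially)
  then have "b n < L" if "n \<ge> 2 ^ j * n1" for n using dec[OF that] by linarith
  then show ?thesis by (auto simp: eventually_sequentially)
qed

text \<open>Monotonicity traps \<open>H n (x n)\<close> between the values at fixed points on either
  side of \<open>x0\<close>, where pointwise convergence applies; continuity of the limit closes the
  gap without any uniformity.\<close>

lemma tendsto_antimono_compose:
  fixes H :: "nat \<Rightarrow> real \<Rightarrow> real" and ph :: "real \<Rightarrow> real"
  assumes anti: "\<And>n. antimono (H n)"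
    and conv: "\<And>x. a < x \<Longrightarrow> (\<lambda>n. H n x) \<longlonglongrightarrow> ph x"
    and cont: "isCont ph x0" and x0: "a < x0" and x: "x \<longlonglongrightarrow> x0"
  shows "(\<lambda>n. H n (x n)) \<longlonglongrightarrow> ph x0"
proof (rule order_tendstoI)
  fix l assume l: "l < ph x0"
  have "\<forall>\<^sub>F y in at x0. l < ph y" using cont l unfolding isCont_def by (rule order_tendstoD)
  then have "\<forall>\<^sub>F y in at_right x0. l < ph y" by (simp add: eventually_at_split)
  moreover have "\<forall>\<^sub>F y in at_right x0. x0 < y" by (simp add: eventually_at_right_less)
  ultimately have "\<forall>\<^sub>F y in at_right x0. l < ph y \<and> x0 < y" by eventually_elim auto
  from eventually_happens'[OF trivial_limit_at_right_real this]
  obtain y where y: "l < ph y" "x0 < y" by blast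
  have "\<forall>\<^sub>F n in sequentially. l < H n y" using conv[of y] y x0 by (intro order_tendstoD(1)) auto
  moreover have "\<forall>\<^sub>F n in sequentially. x n < y" using x y by (intro order_tendstoD(2)) auto
  ultimately show "\<forall>\<^sub>F n in sequentially. l < H n (x n)"
  proof eventually_elim
    case (elim n)
    have "H n y \<le> H n (x n)" using anti[of n] elim by (auto simp: antimono_def)
    with elim show ?case by linarith
  qed
next
  fix l assume l: "ph x0 < l"
  have "\<forall>\<^sub>F y in at x0. ph y < l" using cont l unfolding isCont_def by (rule order_tendstoD)
  then have "\<forall>\<^sub>F y in at_left x0. ph y < l" by (simp add: eventually_at_split)
  moreover have "\<forall>\<^sub>F y in at_left x0. a < y"
    using x0 by (meson eventually_at_leftI greaterThanLessThan_iff)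
  moreover have "\<forall>\<^sub>F y in at_left x0. y < x0" by (auto simp: eventually_at_filter)
  ultimately have "\<forall>\<^sub>F y in at_left x0. ph y < l \<and> a < y \<and> y < x0" by eventually_elim auto
  from eventually_happens'[OF trivial_limit_at_left_real this]
  obtain y where y: "ph y < l" "y < x0" "a < y" by blast
  have "\<forall>\<^sub>F n in sequentially. H n y < l" using conv[of y] y x0 by (intro order_tendstoD(2)) auto
  moreover have "\<forall>\<^sub>F n in sequentially. y < x n" using x y by (intro order_tendstoD(1)) auto
  ultimately show "\<forall>\<^sub>F n in sequentially. H n (x n) < l"
  proof eventually_elim
    case (elim n)
    have "H n (x n) \<le> H n y" using anti[of n] elim by (auto simp: antimono_def)
    with elim show ?case by linarith
  qed
qed

text \<open>Taking logarithms, \<open>n * (- ln z)\<close> tends to c, which forces z to 1. Then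
  \<open>1 - z\<close> lies between \<open>z * (- ln z)\<close> and \<open>- ln z\<close>, whose
  ratio tends to 1.\<close>

lemma LIMSEQ_power_exp_imp:
  fixes z :: "nat \<Rightarrow> real"
  assumes z: "\<And>n. 0 \<le> z n" "\<And>n. z n \<le> 1"
    and lim: "(\<lambda>n. z n ^ n) \<longlonglongrightarrow> exp (- c)"
  shows "(\<lambda>n. real n * (1 - z n)) \<longlonglongrightarrow> c"
proof -
  have "\<forall>\<^sub>F n in sequentially. 0 < z n ^ n" using lim by (rule order_tendstoD) auto
  then have pos: "\<forall>\<^sub>F n in sequentially. 0 < z n"
    using eventually_gt_at_top[of 0]
  proof eventually_elim
    case (elim n) then show ?case using z(1)[of n] by (cases "z n = 0") (auto simp: power_0_left)
  qed
  have "(\<lambda>n. ln (z n ^ n)) \<longlonglongrightarrow> ln (exp (- c))" using lim by (intro tendsto_ln) auto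
  then have l1: "(\<lambda>n. - ln (z n ^ n)) \<longlonglongrightarrow> c" using tendsto_minus by fastforce
  have l1: "(\<lambda>n. real n * (- ln (z n))) \<longlonglongrightarrow> c"
    by (rule Lim_transform_eventually[OF l1]) (use pos in eventually_elim, simp add: ln_realpow)
  have "(\<lambda>n. real n * (- ln (z n)) * (1 / real n)) \<longlonglongrightarrow> c * 0"
    using l1 lim_1_over_n by (intro tendsto_mult)
  then have "(\<lambda>n. - (real n * (- ln (z n)) * (1 / real n))) \<longlonglongrightarrow> 0" using tendsto_minus by fastforce
  then have "(\<lambda>n. exp (- (real n * (- ln (z n)) * (1 / real n)))) \<longlonglongrightarrow> exp 0" by (rule tendsto_exp)
  moreover have "\<forall>\<^sub>F n in sequentially. exp (- (real n * (- ln (z n)) * (1 / real n))) = z n"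
    using pos eventually_gt_at_top[of 0] by eventually_elim auto
  ultimately have z1: "z \<longlonglongrightarrow> 1"
    using Lim_transform_eventually by fastforce
  have lo: "\<forall>\<^sub>F n in sequentially. z n * (real n * (- ln (z n))) \<le> real n * (1 - z n)"
    using pos
  proof eventually_elim
    case (elim n)
    have "ln (inverse (z n)) \<le> inverse (z n) - 1" using elim by (intro ln_le_minus_one) auto
    then have "- ln (z n) \<le> (1 - z n) / z n"
      unfolding ln_inverse using elim by (simp add: inverse_eq_divide diff_divide_distrib)
    then have "z n * (- ln (z n)) \<le> 1 - z n" using elim by (simp add: field_simps)
    then have "real n * (z n * (- ln (z n))) \<le> real n * (1 - z n)" by (intro mult_left_mono) auto
    then show ?case by (simp add: mult_ac)
  qed
  have up: "\<forall>\<^sub>F n in sequentially. real n * (1 - z n) \<le> real n * (- ln (z n))"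
    using pos
  proof eventually_elim
    case (elim n)
    have "ln (z n) \<le> z n - 1" using elim by (intro ln_le_minus_one) auto
    then show ?case by (intro mult_left_mono) auto
  qed
  have "(\<lambda>n. z n * (real n * (- ln (z n)))) \<longlonglongrightarrow> 1 * c" using z1 l1 by (intro tendsto_mult)
  then show ?thesis using tendsto_sandwich[OF lo up _ l1] by simp
qed

section \<open>Distribution functions with infinite right endpoint and their quantiles\<close>

locale heavy_cdf =
  fixes G :: "real \<Rightarrow> real"
  assumes mono: "mono G" and G0: "\<And>x. x \<le> 0 \<Longrightarrow> G x = 0" and lim1: "(G \<longlongrightarrow> 1) at_top"
    and cont: "continuous_on UNIV G" and lt1: "\<And>x. G x < 1"
begin

definition Tb :: "real \<Rightarrow> real" where "Tb x = 1 - G x"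

lemma Tb_pos: "0 < Tb x" using lt1[of x] by (simp add: Tb_def)
lemma G_nonneg: "0 \<le> G x"
  using mono G0[of "min 0 x"] by (metis min.cobounded2 min.cobounded1 monoD)
lemma Tb_le1: "Tb x \<le> 1" using G_nonneg[of x] by (simp add: Tb_def)
lemma Tb_nonpos: "x \<le> 0 \<Longrightarrow> Tb x = 1" by (simp add: Tb_def G0)
lemma Tb_anti: "x \<le> y \<Longrightarrow> Tb y \<le> Tb x" using mono by (auto simp: Tb_def mono_def)
lemma Tb_tendsto_0: "(Tb \<longlongrightarrow> 0) at_top"
  using tendsto_diff[OF tendsto_const lim1, of 1] by (simp add: Tb_def[abs_def])

abbreviation U :: "nat \<Rightarrow> real" where "U n \<equiv> U_of G (real n)"

text \<open>Continuity makes the superlevel set closed, so it contains its infimum. For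
  \<open>n = 1\<close> the set is the whole line and for \<open>n = 0\<close> it is empty, so the
  quantile is meaningful only from 2 on.\<close>

lemma U_le_iff:
  assumes "2 \<le> n" shows "U n \<le> x \<longleftrightarrow> Tb x \<le> 1 / real n"
proof -
  define S where "S = {x. 1 - 1 / real n \<le> G x}"
  have c: "0 < 1 - 1 / real n" using assms by (simp add: field_simps)
  have bdd: "bdd_below S"
    using c G0 by (intro bdd_belowI[of _ 0]) (fastforce simp: S_def not_le intro: leI)
  have "\<forall>\<^sub>F x in at_top. 1 - 1 / real n < G x" using lim1 assms by (intro order_tendstoD) auto
  then have ne: "S \<noteq> {}" unfolding S_def by (auto simp: eventually_at_top_linorder intro: less_imp_le)
  have "closed S" unfolding S_def using cont
    by (intro closed_Collect_le continuous_on_const)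
  then have mem: "U n \<in> S" unfolding U_of_def S_def[symmetric]
    using ne bdd by (intro closed_contains_Inf)
  show ?thesis
  proof
    assume "U n \<le> x"
    then have "G (U n) \<le> G x" using mono by (auto simp: mono_def)
    with mem show "Tb x \<le> 1 / real n" by (auto simp: S_def Tb_def)
  next
    assume "Tb x \<le> 1 / real n"
    then have "x \<in> S" by (auto simp: S_def Tb_def)
    then show "U n \<le> x" unfolding U_of_def S_def[symmetric] using bdd by (intro cInf_lower)
  qed
qed

lemma U_pos: "2 \<le> n \<Longrightarrow> 0 < U n"
  using U_le_iff[of n 0] Tb_nonpos[of 0] by (auto simp: field_simps not_le[symmetric])

end

section \<open>Norming constants and tail of a distribution in the domain of attraction\<close>

locale mda_cdf = heavy_cdf +
  fixes \<gamma> :: real and A :: "nat \<Rightarrow> real"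
  assumes gam: "0 < \<gamma>" and A_pos: "\<And>n. 0 < A n"
    and mda: "\<And>x. 0 < 1 + \<gamma> * x \<Longrightarrow>
        (\<lambda>n. (G (A n * x + U_of G (real n))) ^ n) \<longlonglongrightarrow> exp (- ((1 + \<gamma> * x) powr (- 1 / \<gamma>)))"
begin

text \<open>Minus the logarithm of the limiting extreme value distribution.\<close>

definition ph :: "real \<Rightarrow> real" where "ph x = (1 + \<gamma> * x) powr (- 1 / \<gamma>)"

lemma lim_ph: "-1/\<gamma> < x \<Longrightarrow> (\<lambda>n. real n * Tb (A n * x + U n)) \<longlonglongrightarrow> ph x"
  unfolding Tb_def ph_def
  by (rule LIMSEQ_power_exp_imp)
    (use mda[of x] gam G_nonneg lt1 in \<open>auto intro: less_imp_le simp: field_simps\<close>)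

lemma ph_gt: "-1/\<gamma> < x \<Longrightarrow> 0 < r \<Longrightarrow> x < (r powr \<gamma> - 1) / \<gamma> \<Longrightarrow> 1 / r < ph x"
proof -
  assume a: "-1/\<gamma> < x" "0 < r" "x < (r powr \<gamma> - 1) / \<gamma>"
  have p: "0 < 1 + \<gamma> * x" using a gam by (simp add: field_simps)
  have "1 + \<gamma> * x < r powr \<gamma>" using a gam by (simp add: field_simps)
  then have "(r powr \<gamma>) powr (- 1 / \<gamma>) < (1 + \<gamma> * x) powr (- 1 / \<gamma>)"
    using gam p by (intro powr_less_mono2_neg) auto
  then show ?thesis using gam a by (simp add: ph_def powr_powr powr_minus field_simps)
qed

lemma ph_lt: "0 < r \<Longrightarrow> (r powr \<gamma> - 1) / \<gamma> < x \<Longrightarrow> ph x < 1 / r"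
proof -
  assume a: "0 < r" "x > (r powr \<gamma> - 1) / \<gamma>"
  have "1 + \<gamma> * x > r powr \<gamma>" using a gam by (simp add: field_simps)
  then have "(r powr \<gamma>) powr (- 1 / \<gamma>) > (1 + \<gamma> * x) powr (- 1 / \<gamma>)"
    using gam a by (intro powr_less_mono2_neg) auto
  then show ?thesis using gam a by (simp add: ph_def powr_powr powr_minus field_simps)
qed

text \<open>\<open>lim_ph\<close> inverted: \<open>ph\<close> takes the value \<open>1 / r\<close>
  exactly at \<open>(r powr \<gamma> - 1) / \<gamma>\<close>, and comparing n times the tail with 1
  locates the quantile. Two free index sequences allow halving and doubling.\<close>

lemma U_increment:
  assumes k: "filterlim k at_top sequentially"
    and lk: "(\<lambda>n. real (l n) / real (k n)) \<longlonglongrightarrow> r" and r: "0 < r"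
  shows "(\<lambda>n. (U (l n) - U (k n)) / A (k n)) \<longlonglongrightarrow> (r powr \<gamma> - 1) / \<gamma>"
proof -
  have k0: "\<forall>\<^sub>F n in sequentially. k n > 0"
    by (rule eventually_compose_filterlim[OF eventually_gt_at_top k])
  have "filterlim (\<lambda>n. real (l n) / real (k n) * real (k n)) at_top sequentially"
    by (rule filterlim_tendsto_pos_mult_at_top[OF lk r filterlim_compose[OF filterlim_real_sequentially k]])
  then have "filterlim (\<lambda>n. real (l n)) at_top sequentially"
    by (rule filterlim_mono_eventually[OF _ order_refl order_refl]) (use k0 in eventually_elim, auto)
  then have l2: "\<forall>\<^sub>F n in sequentially. 2 \<le> l n"
    by (auto simp: filterlim_at_top dest!: spec[of _ 2] elim: eventually_mono)
  have lim: "(\<lambda>n. real (l n) * Tb (A (k n) * x + U (k n))) \<longlonglongrightarrow> r * ph x" if "-1/\<gamma> < x" for x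
  proof -
    have "(\<lambda>n. real (k n) * Tb (A (k n) * x + U (k n))) \<longlonglongrightarrow> ph x"
      by (rule filterlim_compose[OF lim_ph[OF that] k])
    from tendsto_mult[OF lk this] show ?thesis
      by (rule Lim_transform_eventually) (use k0 in eventually_elim, auto)
  qed
  have xr: "-1/\<gamma> < (r powr \<gamma> - 1) / \<gamma>"
    using gam r by (simp add: field_simps)
  show ?thesis
  proof (rule order_tendstoI)
    fix a assume "a < (r powr \<gamma> - 1) / \<gamma>"
    then obtain a' where a': "max a (-1/\<gamma>) < a'" "a' < (r powr \<gamma> - 1) / \<gamma>"
      using dense[of "max a (-1/\<gamma>)"] xr by auto
    have "1 / r < ph a'" using a' r by (intro ph_gt) auto
    then have "1 < r * ph a'" using r by (simp add: field_simps)
    then have "\<forall>\<^sub>F n in sequentially. 1 < real (l n) * Tb (A (k n) * a' + U (k n))"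
      using lim[of a'] a' by (intro order_tendstoD(1)) auto
    then show "\<forall>\<^sub>F n in sequentially. a < (U (l n) - U (k n)) / A (k n)"
      using l2
    proof eventually_elim
      case (elim n)
      then have "1 / real (l n) < Tb (A (k n) * a' + U (k n))" by (simp add: field_simps)
      then have "A (k n) * a' + U (k n) < U (l n)" using U_le_iff[OF elim(2)] by (meson not_le)
      then have "a' < (U (l n) - U (k n)) / A (k n)" using A_pos[of "k n"] by (simp add: field_simps)
      then show ?case using a' by auto
    qed
  next
    fix a assume "(r powr \<gamma> - 1) / \<gamma> < a"
    then obtain a' where a': "(r powr \<gamma> - 1) / \<gamma> < a'" "a' < a"
      using dense by blast
    have "ph a' < 1 / r" using a' r by (intro ph_lt) auto
    then have "r * ph a' < 1" using r by (simp add: field_simps)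
    then have "\<forall>\<^sub>F n in sequentially. real (l n) * Tb (A (k n) * a' + U (k n)) < 1"
      using lim[of a'] a' xr by (intro order_tendstoD(2)) auto
    then show "\<forall>\<^sub>F n in sequentially. (U (l n) - U (k n)) / A (k n) < a"
      using l2
    proof eventually_elim
      case (elim n)
      then have "Tb (A (k n) * a' + U (k n)) \<le> 1 / real (l n)" by (simp add: field_simps)
      then have "U (l n) \<le> A (k n) * a' + U (k n)" using U_le_iff[OF elim(2)] by blast
      then have "(U (l n) - U (k n)) / A (k n) \<le> a'" using A_pos[of "k n"] by (simp add: field_simps)
      then show ?case using a' by auto
    qed
  qed
qed

lemma half_at_top: "filterlim (\<lambda>n::nat. n div 2) at_top sequentially"
  unfolding filterlim_at_top
proof
  fix Z :: nat
  show "\<forall>\<^sub>F n in sequentially. Z \<le> n div 2"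
    using eventually_ge_at_top[of "2 * Z"] by eventually_elim auto
qed

lemma half_ratio: "(\<lambda>n. real (c * n) / real (n div 2)) \<longlonglongrightarrow> 2 * real c"
proof -
  have "(\<lambda>n. real (n div 2)  / real n) \<longlonglongrightarrow> 1/2"
  proof (rule tendsto_sandwich)
    show "\<forall>\<^sub>F n in sequentially. (real n / 2 - 1) / real n \<le> real (n div 2) / real n"
      by (intro always_eventually allI divide_right_mono) linarith+
    show "\<forall>\<^sub>F n in sequentially. real (n div 2) / real n \<le> (real n / 2) / real n"
      by (intro always_eventually allI divide_right_mono) linarith+
  qed real_asymp+
  then have "(\<lambda>n. real c / (real (n div 2)  / real n)) \<longlonglongrightarrow> real c / (1/2)"
    by (rule tendsto_divide[OF tendsto_const]) auto
  then show ?thesis by (simp add: mult_ac)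
qed

text \<open>\<open>U (2 * n) - U n\<close> is measured at two scales: directly by
  \<open>A n\<close>, and by \<open>A (n div 2)\<close> as a difference of two increments from
  \<open>n div 2\<close>. The quotient isolates the ratio of norming constants, since
  \<open>4 powr \<gamma> - 2 powr \<gamma>\<close> is \<open>2 powr \<gamma>\<close> times
  \<open>2 powr \<gamma> - 1\<close>.\<close>

lemma A_ratio: "(\<lambda>n. A n / A (n div 2)) \<longlonglongrightarrow> 2 powr \<gamma>"
proof -
  let ?x2 = "(2 powr \<gamma> - 1) / \<gamma>" and ?x4 = "(4 powr \<gamma> - 1) / \<gamma>"
  have 1: "(\<lambda>n. (U n - U (n div 2)) / A (n div 2)) \<longlonglongrightarrow> ?x2"
    using half_ratio[of 1] by (intro U_increment half_at_top) auto
  have 2: "(\<lambda>n. (U (2 * n) - U (n div 2)) / A (n div 2)) \<longlonglongrightarrow> ?x4"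
    using half_ratio[of 2] by (intro U_increment half_at_top) auto
  have "(\<lambda>n. real (2 * n) / real n) \<longlonglongrightarrow> 2" by real_asymp
  then have 3: "(\<lambda>n. (U (2 * n) - U n) / A n) \<longlonglongrightarrow> ?x2"
    by (intro U_increment filterlim_ident) auto
  have x2: "0 < ?x2" using gam by (simp add: ge_one_powr_ge_zero)
  have "(\<lambda>n. ((U (2 * n) - U (n div 2)) / A (n div 2) - (U n - U (n div 2)) / A (n div 2)) / ((U (2 * n) - U n) / A n))
     \<longlonglongrightarrow> (?x4 - ?x2) / ?x2"
    by (rule tendsto_divide[OF tendsto_diff[OF 2 1] 3]) (use x2 in auto)
  moreover have "(?x4 - ?x2) / ?x2 = 2 powr \<gamma>"
  proof -
    have "4 powr \<gamma> = 2 powr \<gamma> * 2 powr \<gamma>" using powr_mult[of 2 2 \<gamma>] by simp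
    then have "?x4 - ?x2 = 2 powr \<gamma> * ?x2" by (simp add: diff_divide_distrib right_diff_distrib)
    then show ?thesis using x2 gam by simp
  qed
  moreover have "\<forall>\<^sub>F n in sequentially. 0 < (U (2 * n) - U n) / A n"
    using order_tendstoD(1)[OF 3 x2] .
  then have "\<forall>\<^sub>F n in sequentially.
      ((U (2 * n) - U (n div 2)) / A (n div 2) - (U n - U (n div 2)) / A (n div 2)) / ((U (2 * n) - U n) / A n)
      = A n / A (n div 2)"
  proof eventually_elim
    case (elim n)
    have "((U (2 * n) - U (n div 2)) / A (n div 2) - (U n - U (n div 2)) / A (n div 2))
      = (U (2 * n) - U n) / A (n div 2)" by (simp add: diff_divide_distrib)
    with elim A_pos[of n] A_pos[of "n div 2"] show ?case by (auto simp: field_simps)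
  qed
  ultimately show ?thesis using Lim_transform_eventually by fastforce
qed

text \<open>If \<open>U n / A n\<close> were at most y, the point \<open>U n - y * A n\<close> would
  be nonpositive, where the tail is 1; then n times the tail would be n, against its finite limit
  \<open>ph (- y)\<close>.\<close>

lemma U_over_A_lower: "y < 1 / \<gamma> \<Longrightarrow> \<forall>\<^sub>F n in sequentially. y < U n / A n"
proof -
  assume y: "y < 1 / \<gamma>"
  have "(\<lambda>n. real n * Tb (A n * (- y) + U n)) \<longlonglongrightarrow> ph (-y)" using y by (intro lim_ph) auto
  then have "\<forall>\<^sub>F n in sequentially. real n * Tb (A n * (- y) + U n) < ph (-y) + 1"
    by (rule order_tendstoD) auto
  moreover have "\<forall>\<^sub>F n in sequentially. ph (-y) + 1 < real n" by real_asymp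
  ultimately show ?thesis
  proof eventually_elim
    case (elim n)
    then have "\<not> A n * (- y) + U n \<le> 0" using Tb_nonpos[of "A n * (- y) + U n"] by (auto simp del: mult_minus_right)
    then show ?case using A_pos[of n] by (simp add: field_simps)
  qed
qed

text \<open>Splitting \<open>U n\<close> at \<open>U (n div 2)\<close> gives an affine recursion for
  the ratio, with contraction factor \<open>2 powr (- \<gamma>)\<close> in the limit and fixed point
  \<open>1 / \<gamma>\<close>.\<close>

lemma U_over_A: "(\<lambda>n. U n / A n) \<longlonglongrightarrow> 1 / \<gamma>"
proof (rule order_tendstoI)
  fix y assume "y < 1 / \<gamma>" then show "\<forall>\<^sub>F n in sequentially. y < U n / A n" by (rule U_over_A_lower)
next
  fix L assume L: "1 / \<gamma> < L"
  let ?x2 = "(2 powr \<gamma> - 1) / \<gamma>"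
  have p1: "1 < 2 powr \<gamma>" using gam by simp
  have 1: "(\<lambda>n. (U n - U (n div 2)) / A (n div 2)) \<longlonglongrightarrow> ?x2"
    using half_ratio[of 1] by (intro U_increment half_at_top) auto
  have 2: "(\<lambda>n. A (n div 2) / A n) \<longlonglongrightarrow> 1 / 2 powr \<gamma>"
    using tendsto_divide[OF tendsto_const[of 1] A_ratio] by simp
  have 3: "(\<lambda>n. (U n - U (n div 2)) / A (n div 2) * (A (n div 2) / A n)) \<longlonglongrightarrow> ?x2 * (1 / 2 powr \<gamma>)"
    by (rule tendsto_mult[OF 1 2])
  \<comment> \<open>Below 2 the quantile is a default value of unknown sign, while the recursion
    lemma requires nonnegative terms.\<close>
  define b where "b n = (if n < 2 then 0 else U n / A n)" for n
  have "\<forall>\<^sub>F n in sequentially. b n < L"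
  proof (rule limsup_halving_recursion[OF _ _ 3 2])
    show "0 \<le> b n" for n using A_pos[of n] U_pos[of n] by (auto simp: b_def less_imp_le)
    show "\<forall>\<^sub>F n in sequentially. b n \<le> (U n - U (n div 2)) / A (n div 2) * (A (n div 2) / A n)
        + A (n div 2) / A n * b (n div 2)"
      using eventually_ge_at_top[of 4]
    proof eventually_elim
      case (elim n)
      then have "2 \<le> n div 2" "2 \<le> n" by auto
      then have "b n = U n / A n" "b (n div 2) = U (n div 2) / A (n div 2)" by (auto simp: b_def)
      then show ?case using A_pos[of n] A_pos[of "n div 2"] by (simp add: field_simps)
    qed
    show "1 / 2 powr \<gamma> < 1" using p1 by simp
    have "?x2 * (1 / 2 powr \<gamma>) / (1 - 1 / 2 powr \<gamma>) = 1 / \<gamma>"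
      using p1 gam by (simp add: divide_simps)
    then show "?x2 * (1 / 2 powr \<gamma>) / (1 - 1 / 2 powr \<gamma>) < L" using L by simp
  qed simp
  then show "\<forall>\<^sub>F n in sequentially. U n / A n < L"
    using eventually_ge_at_top[of 2] by eventually_elim (auto simp: b_def)
qed

text \<open>\<open>l * U n\<close> equals \<open>A n * x n + U n\<close> with
  \<open>x n = (l - 1) * U n / A n\<close>, which tends to \<open>(l - 1) / \<gamma>\<close>, where
  \<open>1 + \<gamma> * x\<close> is l.\<close>

lemma Tb_at_U:
  assumes l: "0 < l"
  shows "(\<lambda>n. real n * Tb (l * U n)) \<longlonglongrightarrow> l powr (- 1 / \<gamma>)"
proof -
  define x where "x n = (l - 1) * (U n / A n)" for n
  have x: "x \<longlonglongrightarrow> (l - 1) * (1 / \<gamma>)" unfolding x_def by (intro tendsto_mult tendsto_const U_over_A)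
  have "(\<lambda>n. real n * Tb (A n * x n + U n)) \<longlonglongrightarrow> ph ((l - 1) * (1 / \<gamma>))"
  proof (rule tendsto_antimono_compose[where H = "\<lambda>n x. real n * Tb (A n * x + U n)", OF _ lim_ph _ _ x])
    show "antimono (\<lambda>x. real n * Tb (A n * x + U n))" for n
      using A_pos[of n] by (intro antimonoI mult_left_mono Tb_anti) (auto intro: mult_left_mono)
    show "isCont ph ((l - 1) * (1 / \<gamma>))" unfolding ph_def
      using l gam by (intro continuous_intros) auto
    show "- 1 / \<gamma> < (l - 1) * (1 / \<gamma>)" using l gam by (simp add: field_simps)
  qed
  moreover have "A n * x n + U n = l * U n" for n using A_pos[of n] by (simp add: x_def field_simps)
  moreover have "ph ((l - 1) * (1 / \<gamma>)) = l powr (- 1 / \<gamma>)" using gam by (simp add: ph_def)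
  ultimately show ?thesis by simp
qed

text \<open>The integer \<open>N y\<close> with \<open>N y \<le> 1 / Tb y < N y + 1\<close> brackets
  y by consecutive quantiles, so the limit along U extends to all y at the price of a factor
  \<open>(N + 1) / N\<close>.\<close>

theorem regularly_varying:
  assumes l: "0 < l"
  shows "((\<lambda>y. Tb (l * y) / Tb y) \<longlongrightarrow> l powr (- 1 / \<gamma>)) at_top"
proof -
  define N where "N y = nat \<lfloor>1 / Tb y\<rfloor>" for y
  have "filterlim (\<lambda>y. inverse (Tb y)) at_top at_top"
    using Tb_tendsto_0 Tb_pos by (intro filterlim_inverse_at_top) auto
  then have inv: "filterlim (\<lambda>y. 1 / Tb y) at_top at_top" by (simp add: inverse_eq_divide)
  have "filterlim (\<lambda>y. \<lfloor>1 / Tb y\<rfloor>) at_top at_top"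
    by (rule filterlim_compose[OF filterlim_floor_sequentially inv])
  then have N: "filterlim N at_top at_top" unfolding N_def
    by (rule filterlim_compose[OF filterlim_nat_sequentially])
  have N2: "\<forall>\<^sub>F y in at_top. 2 \<le> N y" by (rule eventually_compose_filterlim[OF eventually_ge_at_top N])
  have lim1: "(\<lambda>n. (real n + 1) / real n * (real n * Tb (l * U n))) \<longlonglongrightarrow> 1 * l powr (- 1 / \<gamma>)"
    by (intro tendsto_mult Tb_at_U l) real_asymp
  have S: "(\<lambda>n. real (Suc n) * Tb (l * U (Suc n))) \<longlonglongrightarrow> l powr (- 1 / \<gamma>)"
    using LIMSEQ_Suc[OF Tb_at_U[OF l]] .
  have lim2: "(\<lambda>n. real n / (real n + 1) * (real (Suc n) * Tb (l * U (Suc n)))) \<longlonglongrightarrow> 1 * l powr (- 1 / \<gamma>)"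
    by (intro tendsto_mult S) real_asymp
  have bnd: "\<forall>\<^sub>F y in at_top. real (N y) / (real (N y) + 1) * (real (Suc (N y)) * Tb (l * U (Suc (N y)))) \<le> Tb (l * y) / Tb y
     \<and> Tb (l * y) / Tb y \<le> (real (N y) + 1) / real (N y) * (real (N y) * Tb (l * U (N y)))"
    using N2
  proof eventually_elim
    case (elim y)
    have p: "0 < Tb y" by (rule Tb_pos)
    have "real (N y) = of_int \<lfloor>1 / Tb y\<rfloor>" using p by (simp add: N_def)
    then have a: "real (N y) \<le> 1 / Tb y" "1 / Tb y < real (Suc (N y))" by linarith+
    have a1: "Tb y \<le> 1 / real (N y)" using a(1) p elim by (simp add: field_simps)
    have a2: "1 / real (Suc (N y)) < Tb y" using a(2) p by (simp add: field_simps)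
    have u1: "U (N y) \<le> y" using U_le_iff[OF elim] a1 by blast
    have u2: "y < U (Suc (N y))" using U_le_iff[of "Suc (N y)" y] a2 elim by (auto simp: not_le[symmetric])
    have t1: "Tb (l * y) \<le> Tb (l * U (N y))" using u1 l by (intro Tb_anti) auto
    have t2: "Tb (l * U (Suc (N y))) \<le> Tb (l * y)" using u2 l by (intro Tb_anti) auto
    have "Tb (l * y) / Tb y \<le> Tb (l * U (N y)) / Tb y" using t1 p by (simp add: divide_right_mono)
    also have "\<dots> \<le> Tb (l * U (N y)) * (real (N y) + 1)"
      using mult_left_mono[of "1 / Tb y" "real (N y) + 1" "Tb (l * U (N y))"] a(2) Tb_pos[of "l * U (N y)"] by simp
    finally have c1: "Tb (l * y) / Tb y \<le> Tb (l * U (N y)) * (real (N y) + 1)" .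
    have "Tb (l * U (Suc (N y))) * real (N y) \<le> Tb (l * U (Suc (N y))) * (1 / Tb y)"
      using a(1) Tb_pos[of "l * U (Suc (N y))"] by (intro mult_left_mono) auto
    also have "\<dots> \<le> Tb (l * y) / Tb y" using t2 p by (simp add: divide_right_mono)
    finally have c2: "Tb (l * U (Suc (N y))) * real (N y) \<le> Tb (l * y) / Tb y" .
    have "real (N y) / (real (N y) + 1) * (real (Suc (N y)) * Tb (l * U (Suc (N y)))) = Tb (l * U (Suc (N y))) * real (N y)"
      by (simp add: divide_simps)
    moreover have "(real (N y) + 1) / real (N y) * (real (N y) * Tb (l * U (N y))) = Tb (l * U (N y)) * (real (N y) + 1)"
      using elim by (simp add: divide_simps)
    ultimately show ?case using c1 c2 by argo
  qed
  show ?thesis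
  proof (rule tendsto_sandwich)
    show "((\<lambda>y. real (N y) / (real (N y) + 1) * (real (Suc (N y)) * Tb (l * U (Suc (N y))))) \<longlongrightarrow> l powr (- 1 / \<gamma>)) at_top"
      using filterlim_compose[OF lim2 N] by simp
    show "((\<lambda>y. (real (N y) + 1) / real (N y) * (real (N y) * Tb (l * U (N y)))) \<longlongrightarrow> l powr (- 1 / \<gamma>)) at_top"
      using filterlim_compose[OF lim1 N] by simp
  qed (use bnd in \<open>auto elim: eventually_mono\<close>)
qed

end

section \<open>The exact threshold\<close>

text \<open>Induction over octaves, which turns a bound on \<open>Tb (2 * y) / Tb y\<close> into a
  power bound for all large arguments.\<close>

lemma doubling_induct:
  fixes P :: "real \<Rightarrow> bool"
  assumes X: "0 < X" and base: "\<And>x. X \<le> x \<Longrightarrow> x \<le> 2 * X \<Longrightarrow> P x"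
    and step: "\<And>x. X \<le> x \<Longrightarrow> P x \<Longrightarrow> P (2 * x)" and x: "X \<le> x"
  shows "P x"
proof -
  have "P x" if "X \<le> x" "x \<le> 2 ^ k * X" for k x
    using that
  proof (induction k arbitrary: x)
    case 0 then show ?case using base X by simp
  next
    case (Suc k)
    show ?case
    proof (cases "x \<le> 2 * X")
      case True then show ?thesis using base Suc.prems by simp
    next
      case False
      then have "P (x / 2)" using Suc.prems by (intro Suc.IH) auto
      then show ?thesis using step[of "x / 2"] False by simp
    qed
  qed
  moreover obtain k where "x / X < 2 ^ k" using real_arch_pow[of 2 "x / X"] by auto
  then have "x \<le> 2 ^ k * X" using X by (simp add: field_simps)
  ultimately show ?thesis using x by blast
qed

lemma sum_inverse_le_ln:
  assumes "1 \<le> a" "a \<le> n"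
  shows "(\<Sum>i\<in>{a..<n}. 1 / real i) \<le> 1 / real a + ln (real n / real a)"
proof -
  have *: "(\<Sum>i\<in>{a..n}. 1 / real i) \<le> 1 / real a + ln (real n / real a)"
    using assms(2)
  proof (induction n rule: dec_induct)
    case base then show ?case using assms(1) by simp
  next
    case (step k)
    have k: "0 < k" using step assms by auto
    have "ln (real k / real (Suc k)) \<le> real k / real (Suc k) - 1" using k by (intro ln_le_minus_one) auto
    also have "\<dots> = - (1 / real (Suc k))" by (simp add: field_simps)
    finally have "1 / real (Suc k) \<le> ln (real (Suc k)) - ln (real k)" using k by (simp add: ln_div)
    moreover have "ln (real k / real a) = ln (real k) - ln (real a)"
      "ln (real (Suc k) / real a) = ln (real (Suc k)) - ln (real a)"
      using k assms by (simp_all add: ln_div)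
    moreover have "(\<Sum>i\<in>{a..Suc k}. 1 / real i) = (\<Sum>i\<in>{a..k}. 1 / real i) + 1 / real (Suc k)"
      using step by simp
    ultimately show ?case using step.IH by linarith
  qed
  have "(\<Sum>i\<in>{a..<n}. 1 / real i) \<le> (\<Sum>i\<in>{a..n}. 1 / real i)"
    by (intro sum_mono2) auto
  with * show ?thesis by linarith
qed

lemma sum_inverse_le: "1 \<le> n \<Longrightarrow> (\<Sum>i\<in>{1..<n}. 1 / real i) \<le> 1 + ln (real n)"
  using sum_inverse_le_ln[of 1 n] by simp

lemma powr_absorb_const:
  fixes C :: real assumes "b < b'"
  shows "\<forall>\<^sub>F x in at_top. C * x powr (- b') \<le> x powr (- b)"
proof -
  have "\<forall>\<^sub>F x::real in at_top. C \<le> x powr (b' - b)"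
    using real_powr_at_top[of "b' - b"] assms by (auto simp: filterlim_at_top)
  then show ?thesis
    using eventually_gt_at_top[of 0]
  proof eventually_elim
    case (elim x)
    have "C * x powr (- b') \<le> x powr (b' - b) * x powr (- b')" using elim by (intro mult_right_mono) auto
    also have "\<dots> = x powr (- b)" by (simp add: powr_add[symmetric])
    finally show ?case .
  qed
qed

section \<open>Potter-type bounds for the tail and growth of the threshold\<close>

locale regvar_cdf = heavy_cdf +
  fixes \<alpha> :: real
  assumes alpha: "0 < \<alpha>"
    and regvar: "\<And>l. 0 < l \<Longrightarrow> ((\<lambda>y. Tb (l * y) / Tb y) \<longlongrightarrow> l powr (- \<alpha>)) at_top"
begin

text \<open>The gap between b and \<open>\<alpha>\<close> is spent twice: \<open>b'\<close> gives a
  strict bound on the doubling ratio, and the distance from \<open>b'\<close> to b absorbs the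
  constant C of the first octave. \<open>Tb_lower\<close> mirrors this.\<close>

lemma Tb_upper:
  assumes b: "b < \<alpha>" shows "\<forall>\<^sub>F x in at_top. Tb x \<le> x powr (- b)"
proof -
  obtain b' where b': "max b 0 < b'" "b' < \<alpha>" using dense[of "max b 0" \<alpha>] b alpha by auto
  have "2 powr (- \<alpha>) < (2::real) powr (- b')" using b' by simp
  then have "\<forall>\<^sub>F y in at_top. Tb (2 * y) / Tb y < 2 powr (- b')"
    using regvar[of 2] by (intro order_tendstoD(2)) auto
  then obtain X where X: "\<And>y. X \<le> y \<Longrightarrow> Tb (2 * y) / Tb y < 2 powr (- b')"
    by (auto simp: eventually_at_top_linorder)
  define X0 where "X0 = max X 1"
  define C where "C = (2 * X0) powr b'"
  have X0: "0 < X0" "X \<le> X0" by (auto simp: X0_def)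
  have "Tb x \<le> C * x powr (- b')" if "X0 \<le> x" for x
    using X0(1) _ _ that
  proof (rule doubling_induct)
    fix x assume x: "X0 \<le> x" "x \<le> 2 * X0"
    have "Tb x \<le> x powr b' * x powr (- b')" using Tb_le1[of x] x X0 by (simp add: powr_add[symmetric])
    also have "\<dots> \<le> C * x powr (- b')" unfolding C_def using x X0 b'
      by (intro mult_right_mono powr_mono2) auto
    finally show "Tb x \<le> C * x powr (- b')" .
  next
    fix x assume x: "X0 \<le> x" "Tb x \<le> C * x powr (- b')"
    have "Tb (2 * x) / Tb x < 2 powr (- b')" using X[of x] x X0 by auto
    then have "Tb (2 * x) \<le> 2 powr (- b') * Tb x" using Tb_pos[of x] by (simp add: pos_divide_less_eq)
    also have "\<dots> \<le> 2 powr (- b') * (C * x powr (- b'))" using x by (intro mult_left_mono) auto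
    also have "\<dots> = C * (2 * x) powr (- b')" using x X0 by (simp add: powr_mult)
    finally show "Tb (2 * x) \<le> C * (2 * x) powr (- b')" .
  qed
  then have "\<forall>\<^sub>F x in at_top. Tb x \<le> C * x powr (- b')"
    by (auto simp: eventually_at_top_linorder)
  moreover have "\<forall>\<^sub>F x in at_top. C * x powr (- b') \<le> x powr (- b)"
    using b' by (intro powr_absorb_const) auto
  ultimately show ?thesis by eventually_elim auto
qed

lemma Tb_lower:
  assumes b: "\<alpha> < b" shows "\<forall>\<^sub>F x in at_top. x powr (- b) \<le> Tb x"
proof -
  obtain b' where b': "\<alpha> < b'" "b' < b" using dense[OF b] by auto
  have "2 powr (- b') < (2::real) powr (- \<alpha>)" using b' by simp
  then have "\<forall>\<^sub>F y in at_top. 2 powr (- b') < Tb (2 * y) / Tb y"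
    using regvar[of 2] by (intro order_tendstoD(1)) auto
  then obtain X where X: "\<And>y. X \<le> y \<Longrightarrow> 2 powr (- b') < Tb (2 * y) / Tb y"
    by (auto simp: eventually_at_top_linorder)
  define X0 where "X0 = max X 1"
  define C where "C = Tb (2 * X0) * X0 powr b'"
  have X0: "0 < X0" "X \<le> X0" by (auto simp: X0_def)
  have C: "0 < C" using X0 Tb_pos by (auto simp: C_def)
  have "C * x powr (- b') \<le> Tb x" if "X0 \<le> x" for x
    using X0(1) _ _ that
  proof (rule doubling_induct)
    fix x assume x: "X0 \<le> x" "x \<le> 2 * X0"
    have "C * x powr (- b') \<le> C * X0 powr (- b')"
      using x X0 b' C alpha by (intro mult_left_mono powr_mono2') auto
    also have "\<dots> = Tb (2 * X0)" using X0 by (simp add: C_def powr_minus field_simps)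
    also have "\<dots> \<le> Tb x" using x by (intro Tb_anti)
    finally show "C * x powr (- b') \<le> Tb x" .
  next
    fix x assume x: "X0 \<le> x" "C * x powr (- b') \<le> Tb x"
    have "C * (2 * x) powr (- b') = 2 powr (- b') * (C * x powr (- b'))" using x X0 by (simp add: powr_mult)
    also have "\<dots> \<le> 2 powr (- b') * Tb x" using x by (intro mult_left_mono) auto
    also have "\<dots> \<le> Tb (2 * x)"
      using X[of x] x X0 Tb_pos[of x] by (simp add: pos_less_divide_eq)
    finally show "C * (2 * x) powr (- b') \<le> Tb (2 * x)" .
  qed
  then have 1: "\<forall>\<^sub>F x in at_top. C * x powr (- b') \<le> Tb x"
    by (auto simp: eventually_at_top_linorder)
  have "\<forall>\<^sub>F x in at_top. (1 / C) * x powr (- b) \<le> x powr (- b')"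
    using b' by (intro powr_absorb_const) auto
  with 1 show ?thesis
  proof eventually_elim
    case (elim x)
    from elim(2) have "x powr (- b) \<le> C * x powr (- b')" using C by (simp add: field_simps)
    with elim show ?case by linarith
  qed
qed

definition thr :: "real \<Rightarrow> real" where "thr t = threshold G t"

text \<open>On \<open>[0, t]\<close> the non-increasing tail meets the line \<open>x / t\<close>;
  the line increases strictly, so the crossing is unique and the definite description in
  \<open>threshold\<close> denotes.\<close>

lemma thr:
  assumes t: "0 < t" shows "0 < thr t" "Tb (thr t) = thr t / t"
proof -
  have ex: "\<exists>x. 0 < x \<and> Tb x = x / t"
  proof -
    define g where "g x = Tb x - x / t" for x
    have "\<exists>x\<ge>0. x \<le> t \<and> g x = 0"
    proof (rule IVT2)
      show "g t \<le> 0" using t Tb_le1[of t] by (simp add: g_def)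
      show "0 \<le> g 0" using Tb_nonpos[of 0] by (simp add: g_def)
      show "0 \<le> t" using t by simp
      have "continuous_on UNIV g" unfolding g_def Tb_def using cont t by (intro continuous_intros) auto
      then show "\<forall>x. 0 \<le> x \<and> x \<le> t \<longrightarrow> isCont g x" by (simp add: continuous_on_eq_continuous_at)
    qed
    then obtain x where x: "0 \<le> x" "g x = 0" by blast
    have "x \<noteq> 0" using x(2) Tb_nonpos[of 0] by (auto simp: g_def)
    with x show ?thesis by (intro exI[of _ x]) (auto simp: g_def)
  qed
  then obtain x where x: "0 < x" "Tb x = x / t" by blast
  have "thr t = x" unfolding thr_def threshold_def
  proof (rule the_equality)
    show "1 - G x = x / t" using x by (simp add: Tb_def)
  next
    fix y assume "1 - G y = y / t"
    then have y: "Tb y = y / t" by (simp add: Tb_def)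
    show "y = x"
    proof (rule ccontr)
      assume "y \<noteq> x"
      then consider "y < x" | "x < y" by linarith
      then show False
      proof cases
        case 1
        then have "Tb x \<le> Tb y" "y / t < x / t" using t by (auto intro: Tb_anti simp: divide_strict_right_mono)
        then show False using x y by simp
      next
        case 2
        then have "Tb y \<le> Tb x" "x / t < y / t" using t by (auto intro: Tb_anti simp: divide_strict_right_mono)
        then show False using x y by simp
      qed
    qed
  qed
  with x show "0 < thr t" "Tb (thr t) = thr t / t" by auto
qed

text \<open>\<open>x - t * Tb x\<close> is strictly increasing and vanishes at \<open>thr t\<close>.
  Bounds on the threshold thus reduce to testing one point.\<close>

lemma le_thr_iff:
  assumes t: "0 < t" shows "x \<le> thr t \<longleftrightarrow> x \<le> t * Tb x"
proof
  assume "x \<le> thr t"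
  then have "thr t / t \<le> Tb x" using thr(2)[OF t] Tb_anti[of x "thr t"] by simp
  then have "thr t \<le> t * Tb x" using t by (simp add: field_simps)
  with \<open>x \<le> thr t\<close> show "x \<le> t * Tb x" by simp
next
  assume a: "x \<le> t * Tb x"
  show "x \<le> thr t"
  proof (rule ccontr)
    assume n: "\<not> x \<le> thr t"
    then have "Tb x \<le> thr t / t" using thr(2)[OF t] Tb_anti[of "thr t" x] by simp
    then have "t * Tb x \<le> thr t" using t by (simp add: field_simps)
    with a n show False by simp
  qed
qed

lemma thr_mono:
  assumes "0 < s" "s \<le> t" shows "thr s \<le> thr t"
proof -
  have "thr s \<le> s * Tb (thr s)" using le_thr_iff[OF assms(1), of "thr s"] by simp
  also have "\<dots> \<le> t * Tb (thr s)" using assms Tb_pos[of "thr s"] by (intro mult_right_mono) auto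
  finally show ?thesis using le_thr_iff[of t "thr s"] assms by simp
qed

lemma thr_powr_lower:
  assumes r: "0 < r" "r < 1 / (1 + \<alpha>)" shows "\<forall>\<^sub>F t in at_top. t powr r \<le> thr t"
proof -
  \<comment> \<open>The solution of \<open>1 - r * b = r\<close>, so that
    \<open>x = t powr r\<close> satisfies \<open>t * x powr (- b) = x\<close>; the bound on r makes
    b exceed \<open>\<alpha>\<close>.\<close>
  define b where "b = 1 / r - 1"
  have b: "\<alpha> < b" using r alpha by (simp add: b_def field_simps)
  have "\<forall>\<^sub>F t in at_top. (t powr r) powr (- b) \<le> Tb (t powr r)"
    by (rule eventually_compose_filterlim[OF Tb_lower[OF b] real_powr_at_top[OF r(1)]])
  then show ?thesis using eventually_gt_at_top[of 0]
  proof eventually_elim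
    case (elim t)
    have e: "- (r * b) + 1 = r" using r by (simp add: b_def field_simps)
    have "t powr r = t powr (- (r * b) + 1)" by (simp only: e)
    also have "\<dots> = t powr (- (r * b)) * t powr 1" by (rule powr_add)
    also have "\<dots> = t * (t powr r) powr (- b)" using elim by (simp add: powr_powr)
    also have "\<dots> \<le> t * Tb (t powr r)" using elim by (intro mult_left_mono) auto
    finally show ?case using le_thr_iff[OF elim(2)] by simp
  qed
qed

lemma thr_at_top: "filterlim thr at_top at_top"
proof -
  define r where "r = 1 / (2 + \<alpha>)"
  have r: "0 < r" "r < 1 / (1 + \<alpha>)" using alpha by (auto simp: r_def field_simps)
  show ?thesis
    by (rule filterlim_at_top_mono[OF real_powr_at_top[OF r(1)] thr_powr_lower[OF r]])
qed

text \<open>Stretching the threshold by l lowers the tail there by about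
  \<open>l powr (- \<alpha>)\<close>; t must grow by \<open>l powr (1 + \<alpha>)\<close> to
  compensate, and d absorbs the error in the tail ratio.\<close>

lemma thr_scale:
  assumes l: "1 < l" and d: "0 < d"
  shows "\<forall>\<^sub>F t in at_top. l * thr t \<le> thr (l powr (1 + \<alpha> + d) * t)"
proof -
  have "l powr (- (\<alpha> + d)) < l powr (- \<alpha>)" using l d by simp
  then have "\<forall>\<^sub>F y in at_top. l powr (- (\<alpha> + d)) < Tb (l * y) / Tb y"
    using regvar[of l] l by (intro order_tendstoD(1)) auto
  then have "\<forall>\<^sub>F t in at_top. l powr (- (\<alpha> + d)) < Tb (l * thr t) / Tb (thr t)"
    by (rule eventually_compose_filterlim[OF _ thr_at_top])
  then show ?thesis using eventually_gt_at_top[of 0]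
  proof eventually_elim
    case (elim t)
    let ?q = "l powr (1 + \<alpha> + d)"
    have "l powr (- (\<alpha> + d)) * Tb (thr t) \<le> Tb (l * thr t)"
      using elim Tb_pos[of "thr t"] by (simp add: pos_less_divide_eq)
    then have "?q * t * (l powr (- (\<alpha> + d)) * Tb (thr t)) \<le> ?q * t * Tb (l * thr t)"
      using elim by (intro mult_left_mono) auto
    moreover have "?q * l powr (- (\<alpha> + d)) = l" using l by (simp add: powr_add[symmetric])
    then have "?q * t * (l powr (- (\<alpha> + d)) * Tb (thr t)) = l * thr t"
      using thr(2)[OF elim(2)] elim
      by (metis (no_types, lifting) mult.assoc mult.left_commute nonzero_mult_div_cancel_left not_less_iff_gr_or_eq times_divide_eq_right)
    ultimately have "l * thr t \<le> ?q * t * Tb (l * thr t)" by linarith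
    then show ?case using le_thr_iff[of "?q * t" "l * thr t"] elim l by simp
  qed
qed

definition m :: "nat \<Rightarrow> real" where "m n = thr (real n)"

lemma m_mono: "1 \<le> i \<Longrightarrow> i \<le> n \<Longrightarrow> m i \<le> m n"
  unfolding m_def by (intro thr_mono) auto

lemma m_pos: "1 \<le> n \<Longrightarrow> 0 < m n" using thr(1)[of "real n"] by (simp add: m_def)

lemma m_at_top: "filterlim m at_top sequentially"
  unfolding m_def by (rule filterlim_compose[OF thr_at_top filterlim_real_sequentially])

text \<open>Cutting \<open>{1..<n}\<close> at the points \<open>n / q\<^sup>k\<close> with \<open>q\<close> slightly larger than \<open>l\<^sup>1\<^sup>+\<^sup>\<alpha>\<close> makes \<open>m\<close> drop by the
  factor \<open>l\<close> per block, and each block contributes at most \<open>ln q\<close>; \<open>l = 11/10\<close> is close enough to \<open>1\<close>.\<close>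
lemma sum_m_over_i:
  obtains D where "0 \<le> D" "\<And>n. 1 \<le> n \<Longrightarrow> (\<Sum>i\<in>{1..<n}. m i / real i) \<le> 23/20 * (1 + \<alpha>) * m n + D"
proof -
  define S where "S n = (\<Sum>i\<in>{1..<n}. m i / real i)" for n
  define c where "c = 23/20 * (1 + \<alpha>)"
  \<comment> \<open>The constants fit because \<open>104/100 * 1/10\<close>, from
    \<open>ln (11/10) \<le> 1/10\<close>, stays below \<open>23/20 * 1/11\<close>, where
    \<open>1/11 = 1 - 10/11\<close> is the share of \<open>c * m n\<close> that one block may
    use.\<close>
  define q where "q = (11/10) powr (1 + \<alpha> + 4/100 * (1 + \<alpha>))"
  have "(11/10 :: real) powr 0 < q" unfolding q_def using alpha by (intro powr_less_mono add_pos_pos) auto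
  then have q1: "1 < q" by simp
  have lnq: "ln q < c * (1 - 10/11)"
  proof -
    have "ln (11/10 :: real) \<le> 11/10 - 1" by (intro ln_le_minus_one) auto
    then have "(1 + \<alpha> + 4/100 * (1 + \<alpha>)) * ln (11/10) \<le> (1 + \<alpha> + 4/100 * (1 + \<alpha>)) * (1/10)"
      using alpha by (intro mult_left_mono) auto
    also have "\<dots> = (1 + \<alpha>) * (104/1000)" by (simp add: field_simps)
    also have "\<dots> < (1 + \<alpha>) * (23/220)" using alpha by (intro mult_strict_left_mono) auto
    also have "\<dots> = c * (1 - 10/11)" by (simp add: c_def field_simps)
    finally show ?thesis by (simp add: q_def ln_powr)
  qed
  have "\<forall>\<^sub>F t in at_top. 11/10 * thr t \<le> thr (q * t)" unfolding q_def
    using alpha by (intro thr_scale) auto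
  then obtain t0 where t0: "\<And>t. t0 \<le> t \<Longrightarrow> 11/10 * thr t \<le> thr (q * t)"
    by (auto simp: eventually_at_top_linorder)
  define n' where "n' n = nat \<lfloor>real n / q\<rfloor>" for n :: nat
  have n'l: "(\<lambda>n. 1 / real (n' n) + ln (real n / real (n' n))) \<longlonglongrightarrow> 0 + ln q"
  proof (intro tendsto_add tendsto_ln)
    have q0: "0 < q" using q1 by simp
    have top: "filterlim (\<lambda>n. real (n' n)) at_top sequentially"
    proof (rule filterlim_at_top_mono)
      show "filterlim (\<lambda>n. real n / q - 1) at_top sequentially" using q0 by real_asymp
      show "\<forall>\<^sub>F n in sequentially. real n / q - 1 \<le> real (n' n)"
        unfolding n'_def by (intro always_eventually allI) linarith
    qed
    show "(\<lambda>n. 1 / real (n' n)) \<longlonglongrightarrow> 0" using top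
      by (intro tendsto_divide_0[OF tendsto_const] filterlim_at_top_imp_at_infinity)
    have "(\<lambda>n. real (n' n) / real n) \<longlonglongrightarrow> 1 / q"
    proof (rule tendsto_sandwich)
      show "\<forall>\<^sub>F n in sequentially. (real n / q - 1) / real n \<le> real (n' n) / real n"
        unfolding n'_def by (intro always_eventually allI divide_right_mono) linarith+
      show "\<forall>\<^sub>F n in sequentially. real (n' n) / real n \<le> (real n / q) / real n"
        unfolding n'_def using q0 by (intro always_eventually allI divide_right_mono) auto
      show "(\<lambda>n. (real n / q - 1) / real n) \<longlonglongrightarrow> 1 / q" using q0 by real_asymp (simp add: field_simps)
      show "(\<lambda>n. (real n / q) / real n) \<longlonglongrightarrow> 1 / q" using q0 by real_asymp (simp add: field_simps)
    qed
    from tendsto_inverse[OF this] show "(\<lambda>n. real n / real (n' n)) \<longlonglongrightarrow> q"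
      using q0 by simp
    show "q \<noteq> 0" using q0 by simp
  qed
  have "\<forall>\<^sub>F n in sequentially. 1 / real (n' n) + ln (real n / real (n' n)) < c * (1 - 10/11)"
    using n'l lnq by (intro order_tendstoD(2)[OF n'l]) auto
  moreover have "\<forall>\<^sub>F n in sequentially. q * (max t0 1 + 1) \<le> real n" by real_asymp
  ultimately have "\<forall>\<^sub>F n in sequentially. 1 / real (n' n) + ln (real n / real (n' n)) < c * (1 - 10/11)
      \<and> q * (max t0 1 + 1) \<le> real n" by eventually_elim auto
  then obtain n0 where n0: "\<And>n. n0 \<le> n \<Longrightarrow> 1 / real (n' n) + ln (real n / real (n' n)) < c * (1 - 10/11)
      \<and> q * (max t0 1 + 1) \<le> real n" by (auto simp: eventually_sequentially)
  define D where "D = S (max n0 1)"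
  have mnn: "0 \<le> m i / real i" if "1 \<le> i" for i using m_pos[OF that] by simp
  have Smono: "S a \<le> S b" if "a \<le> b" for a b unfolding S_def
    using that mnn by (intro sum_mono2) auto
  have "S n \<le> c * m n + D" if "1 \<le> n" for n
    using that
  proof (induction n rule: less_induct)
    case (less n)
    have c0: "0 < c" using alpha by (simp add: c_def)
    have mn: "0 < m n" using less.prems by (rule m_pos)
    show ?case
    proof (cases "n < max n0 1")
      case True
      then have "S n \<le> D" unfolding D_def by (intro Smono) auto
      with c0 mn show ?thesis by (smt (verit) mult_pos_pos)
    next
      case False
      then have n: "n0 \<le> n" by simp
      let ?k = "n' n"
      have b: "1 / real ?k + ln (real n / real ?k) < c * (1 - 10/11)" "q * (max t0 1 + 1) \<le> real n"
        using n0[OF n] by auto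
      have "max t0 1 + 1 \<le> real n / q" using b(2) q1 by (simp add: field_simps)
      then have k: "max t0 1 \<le> real ?k" "real ?k \<le> real n / q" unfolding n'_def by linarith+
      have "real n / q < real n" using q1 less.prems by (simp add: field_simps)
      then have kn: "?k < n" "1 \<le> ?k" using k by linarith+
      have "S n = S ?k + (\<Sum>i\<in>{?k..<n}. m i / real i)"
        unfolding S_def using kn by (simp add: sum.atLeastLessThan_concat)
      also have "(\<Sum>i\<in>{?k..<n}. m i / real i) \<le> (\<Sum>i\<in>{?k..<n}. m n * (1 / real i))"
      proof (rule sum_mono)
        fix i assume "i \<in> {?k..<n}"
        then have "m i \<le> m n" using kn by (intro m_mono) auto
        then show "m i / real i \<le> m n * (1 / real i)" by (simp add: divide_right_mono)
      qed
      also have "\<dots> = m n * (\<Sum>i\<in>{?k..<n}. 1 / real i)" by (simp add: sum_distrib_left)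
      also have "\<dots> \<le> m n * (1 / real ?k + ln (real n / real ?k))"
        using mn kn by (intro mult_left_mono sum_inverse_le_ln) auto
      also have "\<dots> \<le> m n * (c * (1 - 10/11))" using b mn by (intro mult_left_mono) auto
      finally have 1: "S n \<le> S ?k + m n * (c * (1 - 10/11))" by simp
      have 2: "S ?k \<le> c * m ?k + D" using kn by (intro less.IH) auto
      have "11/10 * m ?k \<le> thr (q * real ?k)" unfolding m_def using k by (intro t0) auto
      also have "\<dots> \<le> m n" unfolding m_def using k q1 kn by (intro thr_mono) (auto simp: field_simps)
      finally have "m ?k \<le> 10/11 * m n" by simp
      then have "c * m ?k \<le> c * (10/11 * m n)" using c0 by (intro mult_left_mono) auto
      with 1 2 show ?thesis by (simp add: algebra_simps)
    qed
  qed
  moreover have "0 \<le> D" unfolding D_def S_def using mnn by (intro sum_nonneg) auto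
  ultimately show ?thesis using that[of D] by (simp add: S_def c_def)
qed

end

section \<open>Pointwise bounds on the envelope from its tail\<close>

locale regvar_envelope = regvar_cdf +
  fixes f :: "nat \<Rightarrow> real" and k0 :: nat
  assumes f_pos: "\<And>j. 1 \<le> j \<Longrightarrow> 0 < f j"
    and f_noninc: "\<And>i j. k0 \<le> i \<Longrightarrow> i \<le> j \<Longrightarrow> f j \<le> f i"
    and f_incr: "\<And>k j. k0 \<le> k \<Longrightarrow> k \<le> j \<Longrightarrow> (\<Sum>i\<in>{k<..j}. f i) = Tb (real k) - Tb (real j)"
begin

text \<open>Monotone density argument: \<open>f j\<close> is at most its average over
  \<open>(j div 2, j]\<close>, and the sum over that block is a tail increment, bounded by the tail
  at \<open>j / 3\<close>.\<close>

lemma f_upper: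
  assumes b: "b < 1 + \<alpha>" shows "\<forall>\<^sub>F j in sequentially. f j \<le> real j powr (- b)"
proof -
  obtain b' where b': "max (b - 1) 0 < b'" "b' < \<alpha>" using dense[of "max (b - 1) 0" \<alpha>] b alpha by auto
  have "filterlim (\<lambda>j::nat. real j / 3) at_top sequentially" by real_asymp
  then have 1: "\<forall>\<^sub>F j in sequentially. Tb (real j / 3) \<le> (real j / 3) powr (- b')"
    by (rule eventually_compose_filterlim[OF Tb_upper[OF b'(2)]])
  have 2: "\<forall>\<^sub>F j in sequentially. 2 * 3 powr b' * real j powr (- (1 + b')) \<le> real j powr (- b)"
    by (rule eventually_compose_filterlim[OF powr_absorb_const filterlim_real_sequentially]) (use b' in auto)
  show ?thesis
    using 1 2 eventually_ge_at_top[of "2 * k0 + 2"]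
  proof eventually_elim
    case (elim j)
    let ?k = "j div 2"
    have "2 \<le> j" using elim(3) by simp
    then have "j \<le> 3 * ?k" by presburger
    then have k: "k0 \<le> ?k" "?k \<le> j" "real j / 3 \<le> real ?k" "real j / 2 \<le> real (j - ?k)"
      using elim(3) by auto
    have "f j * (real j / 2) \<le> f j * real (j - ?k)"
      using k f_pos[of j] elim by (intro mult_left_mono) auto
    also have "\<dots> = (\<Sum>i\<in>{?k<..j}. f j)" by (simp add: mult.commute)
    also have "\<dots> \<le> (\<Sum>i\<in>{?k<..j}. f i)" using k by (intro sum_mono f_noninc) auto
    also have "\<dots> = Tb (real ?k) - Tb (real j)" using k by (intro f_incr)
    also have "\<dots> \<le> Tb (real j / 3)" using Tb_pos[of "real j"] Tb_anti[OF k(3)] by linarith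
    also have "\<dots> \<le> (real j / 3) powr (- b')" by (rule elim)
    also have "\<dots> = 3 powr b' * real j powr (- b')" using elim by (simp add: powr_divide powr_minus_divide)
    finally have "f j \<le> 2 * 3 powr b' * (real j powr (- b') / real j)"
      using elim by (simp add: field_simps)
    also have "real j powr (- b') / real j = real j powr (- (1 + b'))"
      using elim by (simp add: powr_diff powr_minus_divide field_simps powr_add)
    finally show ?case using elim by linarith
  qed
qed

text \<open>Here the average over \<open>(J, 2 * J]\<close> bounds \<open>f J\<close> from below;
  regular variation makes the increment a fixed share of \<open>Tb J\<close>, which is comparable
  with \<open>Tb (m n) = m n / n\<close>. The range up to \<open>5 * m n\<close> leaves room for the
  pairs of the hypercube.\<close>

lemma f_lower:
  obtains c where "0 < c" "\<forall>\<^sub>F n in sequentially. \<forall>j. k0 \<le> j \<and> real j \<le> 5 * m n \<longrightarrow> c / real n \<le> f j"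
proof -
  have "2 powr (- \<alpha>) < (2::real) powr 0" using alpha by (intro powr_less_mono) auto
  then have two: "2 powr (- \<alpha>) < (1::real)" by simp
  define d where "d = (1 - 2 powr (- \<alpha>)) / 2"
  have d: "0 < d" "2 powr (- \<alpha>) < 1 - d" using two by (auto simp: d_def field_simps)
  define e where "e = 5 powr (- \<alpha>) / 2"
  have e: "0 < e" "e < 5 powr (- \<alpha>)" by (auto simp: e_def)
  have "\<forall>\<^sub>F y in at_top. Tb (2 * y) / Tb y < 1 - d" using regvar[of 2] d by (intro order_tendstoD(2)) auto
  then obtain X where X: "\<And>y. X \<le> y \<Longrightarrow> Tb (2 * y) / Tb y < 1 - d"
    by (auto simp: eventually_at_top_linorder)
  have "\<forall>\<^sub>F y in at_top. e < Tb (5 * y) / Tb y" using regvar[of 5] e by (intro order_tendstoD(1)) auto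
  then have 1: "\<forall>\<^sub>F n in sequentially. e < Tb (5 * m n) / Tb (m n)"
    by (rule eventually_compose_filterlim[OF _ m_at_top])
  have 2: "\<forall>\<^sub>F n in sequentially. max (max X 0) (real k0) + 1 \<le> m n"
    using m_at_top by (auto simp: filterlim_at_top)
  have "\<forall>\<^sub>F n in sequentially. \<forall>j. k0 \<le> j \<and> real j \<le> 5 * m n \<longrightarrow> (d * e / 5) / real n \<le> f j"
    using 1 2 eventually_gt_at_top[of 0]
  proof eventually_elim
    case (elim n)
    let ?J = "nat \<lfloor>5 * m n\<rfloor>"
    have J: "real ?J \<le> 5 * m n" "m n \<le> real ?J" "1 \<le> real ?J" "k0 \<le> ?J" "X \<le> real ?J" using elim(2) by linarith+
    have "Tb (2 * real ?J) / Tb (real ?J) < 1 - d" using J by (intro X)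
    then have "Tb (2 * real ?J) \<le> (1 - d) * Tb (real ?J)" using Tb_pos[of "real ?J"] by (simp add: pos_divide_less_eq)
    then have "d * Tb (real ?J) \<le> Tb (real ?J) - Tb (real (2 * ?J))" by (simp add: algebra_simps)
    also have "\<dots> = (\<Sum>i\<in>{?J<..2 * ?J}. f i)" using J by (intro f_incr[symmetric]) auto
    also have "\<dots> \<le> (\<Sum>i\<in>{?J<..2 * ?J}. f ?J)" using J by (intro sum_mono f_noninc) auto
    also have "\<dots> = real ?J * f ?J" by simp
    finally have a: "d * Tb (real ?J) \<le> real ?J * f ?J" .
    have fJ: "0 < f ?J" using J by (intro f_pos) linarith
    have "e * Tb (m n) \<le> Tb (5 * m n)" using elim(1) Tb_pos[of "m n"] by (simp add: pos_less_divide_eq)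
    also have "\<dots> \<le> Tb (real ?J)" using J by (intro Tb_anti)
    finally have "d * (e * Tb (m n)) \<le> d * Tb (real ?J)" using d by (intro mult_left_mono) auto
    also note a
    also have "real ?J * f ?J \<le> 5 * m n * f ?J" using J fJ by (intro mult_right_mono) auto
    finally have "d * (e * (m n / real n)) \<le> 5 * m n * f ?J" using thr(2)[of "real n"] elim by (simp add: m_def)
    moreover have "0 < m n" using elim by (intro m_pos) auto
    moreover have "m n * ((d * e / 5) / real n) = d * (e * (m n / real n)) / 5" by (simp add: field_simps)
    ultimately have "m n * ((d * e / 5) / real n) \<le> m n * f ?J" "0 < m n" by argo+
    then have fin: "(d * e / 5) / real n \<le> f ?J" by (rule mult_left_le_imp_le)
    show ?case
    proof (intro allI impI)
      fix j assume "k0 \<le> j \<and> real j \<le> 5 * m n"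
      then have "f ?J \<le> f j" by (intro f_noninc) (auto simp: le_nat_floor)
      with fin show "(d * e / 5) / real n \<le> f j" by linarith
    qed
  qed
  then show ?thesis using that[of "d * e / 5"] d e by simp
qed

end

section \<open>Combinatorics of the ETAC code\<close>

definition num_gt :: "nat \<Rightarrow> nat list \<Rightarrow> nat" where "num_gt k ys = length (filter (\<lambda>x. k < x) ys)"

text \<open>Replaces the order statistics in \<open>etac_M\<close> by counts, whose means and
  exponential moments can be computed symbol by symbol.\<close>

lemma sorted_nth_le_iff:
  assumes "1 \<le> k" "k \<le> length ys"
  shows "rev (sort ys) ! (k - 1) \<le> k \<longleftrightarrow> num_gt k ys < k"
proof -
  define s where "s = rev (sort ys)"
  have len: "length s = length ys" by (simp add: s_def)
  have srt: "\<And>i j. i \<le> j \<Longrightarrow> j < length s \<Longrightarrow> s ! j \<le> s ! i"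
    by (rule sorted_rev_nth_mono) (auto simp: s_def)
  have cnt: "num_gt k ys = card {i. i < length s \<and> k < s ! i}"
  proof -
    have "num_gt k ys = length (filter (\<lambda>x. k < x) s)"
      unfolding num_gt_def s_def by (metis mset_filter mset_rev mset_sort size_mset)
    then show ?thesis by (simp add: length_filter_conv_card)
  qed
  show ?thesis unfolding s_def[symmetric] cnt
  proof
    assume a: "s ! (k - 1) \<le> k"
    have "{i. i < length s \<and> k < s ! i} \<subseteq> {..<k - 1}"
    proof
      fix i assume i: "i \<in> {i. i < length s \<and> k < s ! i}"
      show "i \<in> {..<k - 1}"
      proof (rule ccontr)
        assume "i \<notin> {..<k - 1}"
        then have "s ! i \<le> s ! (k - 1)" using i by (intro srt) auto
        with a i show False by auto
      qed
    qed
    then have "card {i. i < length s \<and> k < s ! i} \<le> card {..<k - 1}" by (intro card_mono) auto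
    then show "card {i. i < length s \<and> k < s ! i} < k" using assms by simp
  next
    assume a: "card {i. i < length s \<and> k < s ! i} < k"
    show "s ! (k - 1) \<le> k"
    proof (rule ccontr)
      assume n: "\<not> s ! (k - 1) \<le> k"
      have "{..<k} \<subseteq> {i. i < length s \<and> k < s ! i}"
      proof
        fix i assume "i \<in> {..<k}"
        then have "s ! (k - 1) \<le> s ! i" "i < length s" using assms len by (auto intro!: srt)
        with n show "i \<in> {i. i < length s \<and> k < s ! i}" by auto
      qed
      then have "card {..<k} \<le> card {i. i < length s \<and> k < s ! i}" by (intro card_mono) auto
      with a show False by simp
    qed
  qed
qed

lemma etac_M_alt:
  "etac_M ys = (if \<exists>k\<in>{1..length ys}. num_gt k ys < k
     then LEAST k. k \<in> {1..length ys} \<and> num_gt k ys < k else length ys)"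
proof -
  have "(k \<in> {1..length ys} \<and> rev (sort ys) ! (k - 1) \<le> k) \<longleftrightarrow> (k \<in> {1..length ys} \<and> num_gt k ys < k)" for k
    using sorted_nth_le_iff[of k ys] by auto
  then have "(\<lambda>k. k \<in> {1..length ys} \<and> rev (sort ys) ! (k - 1) \<le> k) = (\<lambda>k. k \<in> {1..length ys} \<and> num_gt k ys < k)"
    by (rule ext)
  then show ?thesis unfolding etac_M_def Let_def Bex_def by (simp only:)
qed

lemma etac_M_le_length: "etac_M ys \<le> length ys"
proof (cases "\<exists>k. k \<in> {1..length ys} \<and> num_gt k ys < k")
  case True
  from LeastI_ex[OF this] True show ?thesis unfolding etac_M_alt by auto
qed (auto simp: etac_M_alt)

lemma etac_M_ge_1: "ys \<noteq> [] \<Longrightarrow> 1 \<le> etac_M ys"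
proof (cases "\<exists>k. k \<in> {1..length ys} \<and> num_gt k ys < k")
  case True
  from LeastI_ex[OF this] True show ?thesis unfolding etac_M_alt by auto
next
  case False
  moreover assume "ys \<noteq> []"
  ultimately show ?thesis by (cases ys) (auto simp: etac_M_alt)
qed

lemma etac_M_le:
  assumes "num_gt k ys < k" shows "etac_M ys \<le> k"
proof (cases "k \<le> length ys")
  case True
  then have k: "k \<in> {1..length ys} \<and> num_gt k ys < k" using assms by auto
  then have "etac_M ys = (LEAST k. k \<in> {1..length ys} \<and> num_gt k ys < k)" unfolding etac_M_alt by auto
  with Least_le[of "\<lambda>k. k \<in> {1..length ys} \<and> num_gt k ys < k", OF k] show ?thesis by simp
next
  case False then show ?thesis using etac_M_le_length[of ys] by simp
qed

lemma num_gt_etac_M: "etac_M ys < length ys \<Longrightarrow> num_gt (etac_M ys) ys < etac_M ys"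
proof (cases "\<exists>k. k \<in> {1..length ys} \<and> num_gt k ys < k")
  case True
  assume "etac_M ys < length ys"
  from LeastI_ex[OF True] True show ?thesis unfolding etac_M_alt by (auto split: if_splits)
qed (auto simp: etac_M_alt)

lemma num_gt_antimono: "j \<le> k \<Longrightarrow> num_gt k ys \<le> num_gt j ys"
  unfolding num_gt_def by (induction ys) auto

text \<open>Counts decrease in the level, so the level \<open>y + num_gt y ys + 1\<close> exceeds
  its own count. The mean of \<open>etac_M\<close> is thereby controlled by that of a count at a
  deterministic level.\<close>

lemma etac_M_le_num_gt: "etac_M ys \<le> y + num_gt y ys + 1"
  using num_gt_antimono[of y "y + num_gt y ys + 1" ys] by (intro etac_M_le) auto

section \<open>The Elias code and its Kraft inequality\<close>

lemma floor_log2_eqI: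
  assumes "2 ^ a \<le> k" "k < 2 ^ Suc a" shows "nat \<lfloor>log 2 (real k)\<rfloor> = a"
  using floor_log_nat_eq_if[of 2 a k] assms by simp

lemma sum_floor_log_blocks:
  fixes h :: "nat \<Rightarrow> real"
  shows "(\<Sum>k\<in>{1..<2 ^ d}. h (nat \<lfloor>log 2 (real k)\<rfloor>)) = (\<Sum>a<d. 2 ^ a * h a)"
proof (induction d)
  case (Suc d)
  have "(\<Sum>k\<in>{1..<2 ^ Suc d}. h (nat \<lfloor>log 2 (real k)\<rfloor>))
     = (\<Sum>k\<in>{1..<2 ^ d}. h (nat \<lfloor>log 2 (real k)\<rfloor>)) + (\<Sum>k\<in>{2 ^ d..<2 ^ Suc d}. h (nat \<lfloor>log 2 (real k)\<rfloor>))"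
    by (rule sum.atLeastLessThan_concat[symmetric]) auto
  also have "(\<Sum>k\<in>{2 ^ d..<2 ^ Suc d}. h (nat \<lfloor>log 2 (real k)\<rfloor>)) = (\<Sum>k\<in>{(2::nat) ^ d..<2 ^ Suc d}. h d)"
    by (intro sum.cong refl arg_cong[of _ _ h] floor_log2_eqI) auto
  also have "\<dots> = 2 ^ d * h d" by simp
  finally show ?case using Suc by simp
qed simp

text \<open>The delta code describes k by its binary length, and this length again by its own.
  Accordingly the sum collapses twice over dyadic blocks and ends in a geometric series.\<close>

lemma elias_kraft:
  assumes F: "finite F" "\<And>k. k \<in> F \<Longrightarrow> 1 \<le> k"
  shows "(\<Sum>k\<in>F. 2 powr (- real (elias_len k))) \<le> 1"
proof -
  obtain N where N: "F \<subseteq> {..<N}" using F(1) finite_nat_iff_bounded by blast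
  obtain b :: nat where b: "N < 2 ^ b" using less_exp by blast
  \<comment> \<open>The form \<open>2 ^ b - 1\<close> makes \<open>a + 1\<close> run through exactly
    \<open>{1..<2 ^ b}\<close> for the second collapse.\<close>
  define d where "d = (2::nat) ^ b - 1"
  have "N \<le> 2 ^ d"
  proof -
    have "N \<le> d" using b by (simp add: d_def)
    also have "d < 2 ^ d" by (rule less_exp)
    finally show ?thesis by simp
  qed
  then have "F \<subseteq> {1..<2 ^ d}" using N F(2) by fastforce
  then have "(\<Sum>k\<in>F. 2 powr (- real (elias_len k))) \<le> (\<Sum>k\<in>{1..<2 ^ d}. 2 powr (- real (elias_len k)))"
    by (intro sum_mono2) auto
  also have "\<dots> = (\<Sum>k\<in>{1..<2 ^ d}. (\<lambda>a. 2 powr (- real (a + 2 * nat \<lfloor>log 2 (real a + 1)\<rfloor> + 1))) (nat \<lfloor>log 2 (real k)\<rfloor>))"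
    by (simp add: elias_len_def)
  also have "\<dots> = (\<Sum>a<d. 2 ^ a * 2 powr (- real (a + 2 * nat \<lfloor>log 2 (real a + 1)\<rfloor> + 1)))"
    by (rule sum_floor_log_blocks)
  also have "\<dots> = (\<Sum>a<d. 2 powr (- real (2 * nat \<lfloor>log 2 (real a + 1)\<rfloor> + 1)))"
    by (intro sum.cong refl) (simp add: powr_realpow[symmetric] powr_add[symmetric] algebra_simps)
  also have "\<dots> = (\<Sum>k\<in>{1..<2 ^ b}. (\<lambda>a. 2 powr (- real (2 * a + 1))) (nat \<lfloor>log 2 (real k)\<rfloor>))"
    by (rule sum.reindex_bij_witness[of _ "\<lambda>k. k - 1" Suc]) (auto simp: d_def add.commute)
  also have "\<dots> = (\<Sum>a<b. 2 ^ a * 2 powr (- real (2 * a + 1)))"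
    by (rule sum_floor_log_blocks)
  also have "\<dots> = (\<Sum>a<b. (1/2) ^ Suc a)"
  proof (intro sum.cong refl)
    fix a
    have "(2::real) ^ a * 2 powr (- real (2 * a + 1)) = 2 powr (- real (Suc a))"
      by (simp add: powr_realpow[symmetric] powr_add[symmetric] algebra_simps)
    also have "\<dots> = (1/2) ^ Suc a" unfolding powr_minus powr_realpow[OF zero_less_numeral] by (simp add: field_simps)
    finally show "(2::real) ^ a * 2 powr (- real (2 * a + 1)) = (1/2) ^ Suc a" .
  qed
  also have "\<dots> = 1 - (1/2) ^ b" by (induction b) auto
  also have "\<dots> \<le> 1" by simp
  finally show ?thesis .
qed

lemma elias_len_mono: "1 \<le> j \<Longrightarrow> j \<le> k \<Longrightarrow> elias_len j \<le> elias_len k"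
proof -
  assume a: "1 \<le> j" "j \<le> k"
  have 1: "nat \<lfloor>log 2 (real j)\<rfloor> \<le> nat \<lfloor>log 2 (real k)\<rfloor>" using a by (intro nat_mono floor_mono) auto
  then have "nat \<lfloor>log 2 (real (nat \<lfloor>log 2 (real j)\<rfloor>) + 1)\<rfloor> \<le> nat \<lfloor>log 2 (real (nat \<lfloor>log 2 (real k)\<rfloor>) + 1)\<rfloor>"
    by (intro nat_mono floor_mono) auto
  with 1 show ?thesis unfolding elias_len_def by simp
qed

lemma elias_len_le:
  assumes "1 \<le> k" shows "real (elias_len k) \<le> log 2 (real k) + 2 * log 2 (log 2 (real k) + 1) + 1"
proof -
  have l: "0 \<le> log 2 (real k)" using assms by simp
  have 1: "real (nat \<lfloor>log 2 (real k)\<rfloor>) \<le> log 2 (real k)" using l by simp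
  have 2: "0 < real (nat \<lfloor>log 2 (real k)\<rfloor>) + 1" by (simp del: of_nat_nat)
  have "real (nat \<lfloor>log 2 (real (nat \<lfloor>log 2 (real k)\<rfloor>) + 1)\<rfloor>) \<le> log 2 (real (nat \<lfloor>log 2 (real k)\<rfloor>) + 1)"
    by (simp del: of_nat_nat)
  also have "\<dots> \<le> log 2 (log 2 (real k) + 1)"     by (rule log_mono) (use 1 2 in \<open>auto simp del: of_nat_nat\<close>)
  finally show ?thesis using 1 unfolding elias_len_def by simp
qed

section \<open>Predictive probabilities and one step of the code\<close>

lemma etac_pred_pos: "0 < etac_pred ys j"
  unfolding etac_pred_def by (intro divide_pos_pos) (auto intro: add_nonneg_pos)

lemma sum_count_list_le: "finite J \<Longrightarrow> (\<Sum>j\<in>J. count_list ys j) \<le> length ys"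
proof (induction ys)
  case (Cons y ys)
  have "(\<Sum>j\<in>J. count_list (y # ys) j) = (\<Sum>j\<in>J. count_list ys j + (if j = y then 1 else 0))"
    by (intro sum.cong) auto
  also have "\<dots> \<le> length ys + 1" using Cons by (simp add: sum.distrib)
  finally show ?case by simp
qed simp

lemma etac_pred_le_1: "etac_pred ys j \<le> 1"
proof -
  have "real (etac_cnt ys j) \<le> real (length ys)" by (auto simp: etac_cnt_def count_le_length)
  moreover have "0 \<le> real (etac_M ys)" by simp
  ultimately have "real (etac_cnt ys j) + 1/2 \<le> real (length ys) + (real (etac_M ys) + 1) / 2"
    by (simp add: field_simps)
  then show ?thesis unfolding etac_pred_def by (simp add: divide_le_eq_1)
qed

text \<open>Not an equality in general: past symbols above the current \<open>etac_M\<close> remain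
  in the denominator but have no place among the summands.\<close>

lemma etac_pred_sum: "(\<Sum>j\<in>{0..etac_M ys}. etac_pred ys j) \<le> 1"
proof -
  have "(\<Sum>j\<in>{0..etac_M ys}. real (etac_cnt ys j)) = (\<Sum>j\<in>{1..etac_M ys}. real (count_list ys j))"
    by (rule sum.mono_neutral_cong_right) (auto simp: etac_cnt_def)
  also have "\<dots> \<le> real (length ys)"
    using sum_count_list_le[of "{1..etac_M ys}" ys] by (metis finite_atLeastAtMost of_nat_le_iff of_nat_sum)
  finally have "(\<Sum>j\<in>{0..etac_M ys}. real (etac_cnt ys j) + 1/2) \<le> real (length ys) + (real (etac_M ys) + 1) / 2"
    unfolding sum.distrib by (simp add: field_simps)
  moreover have "0 < real (length ys) + (real (etac_M ys) + 1) / 2" by (auto intro: add_nonneg_pos)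
  ultimately show ?thesis unfolding etac_pred_def by (simp add: sum_divide_distrib[symmetric] divide_le_eq_1)
qed

text \<open>The conditional weight of the next symbol under the whole code, arithmetic factor and
  Elias codeword together. The Kraft inequality for \<open>etac_len\<close> thus reduces to a
  sub-probability at each step.\<close>

definition etac_step :: "nat list \<Rightarrow> nat \<Rightarrow> real" where
  "etac_step ys x = (if etac_M ys < x then etac_pred ys 0 * 2 powr (- real (elias_len (x - etac_M ys + 1)))
     else etac_pred ys x)"

lemma etac_step_sum:
  assumes "finite A" "\<And>x. x \<in> A \<Longrightarrow> 1 \<le> x"
  shows "(\<Sum>x\<in>A. etac_step ys x) \<le> 1"
proof -
  let ?M = "etac_M ys"
  have "(\<Sum>x\<in>A. etac_step ys x) = (\<Sum>x\<in>{x\<in>A. ?M < x}. etac_step ys x) + (\<Sum>x\<in>{x\<in>A. \<not> ?M < x}. etac_step ys x)"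
    using assms(1) by (subst sum.union_disjoint[symmetric]) (auto intro!: sum.cong)
  also have "(\<Sum>x\<in>{x\<in>A. ?M < x}. etac_step ys x) = etac_pred ys 0 * (\<Sum>x\<in>{x\<in>A. ?M < x}. 2 powr (- real (elias_len (x - ?M + 1))))"
    unfolding sum_distrib_left by (intro sum.cong refl) (simp add: etac_step_def)
  also have "(\<Sum>x\<in>{x\<in>A. ?M < x}. 2 powr (- real (elias_len (x - ?M + 1))))
      = (\<Sum>k\<in>(\<lambda>x. x - ?M + 1) ` {x\<in>A. ?M < x}. 2 powr (- real (elias_len k)))"
    by (subst sum.reindex) (auto simp: inj_on_def)
  also have "\<dots> \<le> 1" using assms by (intro elias_kraft) auto
  also have "(\<Sum>x\<in>{x\<in>A. \<not> ?M < x}. etac_step ys x) = (\<Sum>x\<in>{x\<in>A. \<not> ?M < x}. etac_pred ys x)"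
    by (intro sum.cong refl) (simp add: etac_step_def)
  also have "\<dots> \<le> (\<Sum>x\<in>{1..?M}. etac_pred ys x)"
    using assms etac_pred_pos by (intro sum_mono2) (auto intro: less_imp_le)
  finally have "(\<Sum>x\<in>A. etac_step ys x) \<le> etac_pred ys 0 * 1 + (\<Sum>x\<in>{1..?M}. etac_pred ys x)"
    using etac_pred_pos[of ys 0] by (simp add: mult_left_mono)
  also have "\<dots> = (\<Sum>j\<in>{0..?M}. etac_pred ys j)"
    by (subst sum.atLeast_Suc_atMost) auto
  also note etac_pred_sum
  finally show ?thesis .
qed

lemma etac_arith_prob_bounds: "0 < etac_arith_prob xs" "etac_arith_prob xs \<le> 1"
proof -
  have "(\<Prod>i<length xs. etac_pred (take i xs) (etac_tilde xs i)) \<le> 1"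
    using etac_pred_pos etac_pred_le_1 by (intro prod_le_1) (auto intro: less_imp_le)
  moreover have p: "0 < (\<Prod>i<length xs. etac_pred (take i xs) (etac_tilde xs i))"
    using etac_pred_pos by (intro prod_pos) auto
  ultimately show "etac_arith_prob xs \<le> 1" unfolding etac_arith_prob_def
    using etac_pred_pos[of xs 0] etac_pred_le_1[of xs 0] by (intro mult_le_one) auto
  show "0 < etac_arith_prob xs" unfolding etac_arith_prob_def
    using p etac_pred_pos[of xs 0] by simp
qed

lemma two_powr_etac_len_le:
  "2 powr (- real (etac_len xs)) \<le> (\<Prod>i<length xs. etac_step (take i xs) (xs ! i))"
proof -
  let ?C = "{i. i < length xs \<and> etac_censored xs i}"
  let ?e = "\<lambda>i. elias_len (xs ! i - etac_M (take i xs) + 1)"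
  have p: "0 < etac_arith_prob xs" by (rule etac_arith_prob_bounds)
  have "- log 2 (etac_arith_prob xs) \<le> real (nat \<lceil>- log 2 (etac_arith_prob xs)\<rceil>)"
    by (rule real_nat_ceiling_ge)
  then have "- real (etac_len xs) \<le> log 2 (etac_arith_prob xs) - (\<Sum>i\<in>?C. real (?e i))"
    unfolding etac_len_def by simp
  then have "2 powr (- real (etac_len xs)) \<le> 2 powr (log 2 (etac_arith_prob xs) - (\<Sum>i\<in>?C. real (?e i)))"
    by (intro powr_mono) auto
  also have "\<dots> = etac_arith_prob xs * (\<Prod>i\<in>?C. 2 powr (- real (?e i)))"
    using p by (simp add: powr_diff powr_minus_divide powr_sum prod_dividef)
  also have "(\<Prod>i\<in>?C. 2 powr (- real (?e i))) = (\<Prod>i<length xs. if etac_censored xs i then 2 powr (- real (?e i)) else 1)"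
    by (rule prod.mono_neutral_cong_left) auto
  also have "etac_arith_prob xs * \<dots> \<le> (\<Prod>i<length xs. etac_pred (take i xs) (etac_tilde xs i)) * \<dots>"
  proof (rule mult_right_mono)
    have "0 \<le> (\<Prod>i<length xs. etac_pred (take i xs) (etac_tilde xs i))"
      using etac_pred_pos by (intro prod_nonneg) (auto intro: less_imp_le)
    then show "etac_arith_prob xs \<le> (\<Prod>i<length xs. etac_pred (take i xs) (etac_tilde xs i))"
      unfolding etac_arith_prob_def using etac_pred_le_1[of xs 0] by (intro mult_left_le) auto
  qed (auto intro: prod_nonneg)
  also have "\<dots> = (\<Prod>i<length xs. etac_step (take i xs) (xs ! i))"
    unfolding prod.distrib[symmetric]
    by (intro prod.cong refl) (auto simp: etac_step_def etac_tilde_def etac_censored_def)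
  finally show ?thesis .
qed

section \<open>Pointwise bound on the arithmetic code\<close>

text \<open>The left side is the integral of ln over \<open>[c, c + 1]\<close>, at most the value at
  the midpoint because ln is concave; this is what the \<open>1/2\<close> in the predictive counts
  matches. The proof compares ln with its tangent at s, whose quadratic primitive part takes equal
  values at both ends.\<close>

lemma mult_ln_increment:
  "real (Suc c) * ln (real (Suc c)) - real (Suc c) - (real c * ln (real c) - real c) \<le> ln (real c + 1/2)"
proof (cases "c = 0")
  case True
  have "ln (2::real) \<le> 1" using ln_le_minus_one[of "2::real"] by simp
  then show ?thesis using True by (simp add: ln_div)
next
  case False
  define s where "s = real c + 1/2"
  have s: "0 < s" by (simp add: s_def)
  define F where "F t = t * ln t - t - (t * ln s + (t - s)\<^sup>2 / (2 * s))" for t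
  have "F (real c + 1) \<le> F (real c)"
  proof (rule DERIV_nonpos_imp_nonincreasing[where f = F and a = "real c" and b = "real c + 1"])
    fix t assume t: "real c \<le> t" "t \<le> real c + 1"
    then have t0: "0 < t" using False by linarith
    have "(F has_real_derivative (ln t - ln s - (t - s) / s)) (at t)"
      unfolding F_def using t0 s
      by (auto intro!: derivative_eq_intros simp: field_simps)
    moreover have "ln t - ln s - (t - s) / s \<le> 0"
      using ln_le_minus_one[of "t / s"] t0 s by (simp add: ln_div diff_divide_distrib)
    ultimately show "\<exists>y. (F has_real_derivative y) (at t) \<and> y \<le> 0" by blast
  qed simp
  moreover have "real c + 1 - s = 1/2" "real c - s = - (1/2)" by (simp_all add: s_def)
  ultimately have "(real c + 1) * ln (real c + 1) - (real c + 1) - (real c + 1) * ln s \<le> real c * ln (real c) - real c - real c * ln s"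
    unfolding F_def by simp
  moreover have "(real c + 1) * ln s = real c * ln s + ln s" by (simp add: algebra_simps)
  ultimately show ?thesis unfolding s_def[symmetric] by (simp add: add.commute)
qed

text \<open>Telescopes the increments of \<open>c * ln c - c\<close> symbol by symbol. I selects the
  uncensored positions, and only occurrences there are counted.\<close>

lemma KT_sum_lower:
  fixes x :: "nat \<Rightarrow> nat"
  assumes J: "finite J" "x ` {..<n} \<subseteq> J"
  shows "(\<Sum>j\<in>J. (\<lambda>c. real c * ln (real c) - real c) (card {l. l < n \<and> I l \<and> x l = j}))
    \<le> (\<Sum>i<n. if I i then ln (real (card {l. l < i \<and> I l \<and> x l = x i}) + 1/2) else 0)"
  using J(2)
proof (induction n)
  case (Suc n)
  define g where "g c = real c * ln (real c) - real c" for c :: nat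
  let ?c = "\<lambda>n j. card {l. l < n \<and> I l \<and> x l = j}"
  have IH: "(\<Sum>j\<in>J. g (?c n j)) \<le> (\<Sum>i<n. if I i then ln (real (?c i (x i)) + 1/2) else 0)"
    unfolding g_def using Suc.prems by (intro Suc.IH) auto
  have set: "{l. l < Suc n \<and> I l \<and> x l = j} =
      (if I n \<and> x n = j then insert n {l. l < n \<and> I l \<and> x l = j} else {l. l < n \<and> I l \<and> x l = j})" for j
    by (auto simp: less_Suc_eq)
  have c: "?c (Suc n) j = (if I n \<and> x n = j then Suc (?c n j) else ?c n j)" for j
    unfolding set by auto
  have "(\<Sum>j\<in>J. g (?c (Suc n) j)) = (\<Sum>j\<in>J. g (?c n j) + (if x n = j then (if I n then g (Suc (?c n (x n))) - g (?c n (x n)) else 0) else 0))"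
    unfolding c by (intro sum.cong) auto
  also have "\<dots> = (\<Sum>j\<in>J. g (?c n j)) + (if I n then g (Suc (?c n (x n))) - g (?c n (x n)) else 0)"
    using Suc.prems J(1) by (auto simp: sum.distrib)
  also have "\<dots> \<le> (\<Sum>i<n. if I i then ln (real (?c i (x i)) + 1/2) else 0) + (if I n then ln (real (?c n (x n)) + 1/2) else 0)"
    using IH mult_ln_increment[of "?c n (x n)"] unfolding g_def by (intro add_mono) auto
  finally show ?case unfolding g_def by simp
qed simp

text \<open>\<open>ln z \<le> z - 1\<close> at \<open>z = q * N / c\<close>. Summed over symbols
  with total weight at most 1 and counts adding up to N, it is Gibbs' inequality: no p beats the
  empirical frequencies.\<close>

lemma gibbs_term:
  fixes c N q :: real
  assumes "0 \<le> c" "c \<le> N" "0 < q"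
  shows "c * ln q - (c * ln c - c) \<le> N * q - c * ln N"
proof (cases "c = 0")
  case True then show ?thesis using assms by simp
next
  case False
  then have c: "0 < c" "0 < N" using assms by auto
  have "ln (q * N / c) \<le> q * N / c - 1" using c assms by (intro ln_le_minus_one) auto
  moreover have "ln (q * N / c) = ln q + ln N - ln c" using c assms by (simp add: ln_div ln_mult)
  ultimately have "c * (ln q + ln N - ln c) \<le> c * (q * N / c - 1)"
    using c by (intro mult_left_mono) auto
  also have "\<dots> = N * q - c" using c by (simp add: right_diff_distrib)
  finally show ?thesis by (simp add: algebra_simps)
qed

lemma sum_ln_pred_le:
  fixes x :: "nat \<Rightarrow> nat" and p :: "nat \<Rightarrow> real" and I :: "nat \<Rightarrow> bool"
  assumes p: "\<And>j. 0 \<le> p j" "(\<Sum>j\<in>x ` {..<n}. p j) \<le> 1" "\<And>i. i < n \<Longrightarrow> 0 < p (x i)"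
  defines "N \<equiv> real (card {l. l < n \<and> I l})"
  shows "(\<Sum>i<n. if I i then ln (p (x i)) - ln (real (card {l. l < i \<and> I l \<and> x l = x i}) + 1/2) else 0)
    \<le> N - N * ln N"
proof -
  let ?J = "x ` {..<n}"
  let ?c = "\<lambda>j. real (card {l. l < n \<and> I l \<and> x l = j})"
  let ?R = "{l. l < n \<and> I l}"
  have N: "N = (\<Sum>j\<in>?J. ?c j)"
  proof -
    have "(\<Sum>j\<in>?J. card {l. l \<in> ?R \<and> x l = j}) = card ?R"
      using sum.group[of ?R ?J x "\<lambda>_. 1::nat"] by auto
    moreover have "{l. l \<in> ?R \<and> x l = j} = {l. l < n \<and> I l \<and> x l = j}" for j by auto
    ultimately show ?thesis unfolding N_def by (metis (no_types, lifting) of_nat_sum sum.cong)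
  qed
  have lnp: "(\<Sum>i<n. if I i then ln (p (x i)) else 0) = (\<Sum>j\<in>?J. ?c j * ln (p j))"
  proof -
    have "(\<Sum>i<n. if I i then ln (p (x i)) else 0) = (\<Sum>i\<in>?R. ln (p (x i)))"
      by (rule sum.mono_neutral_cong_right) auto
    also have "\<dots> = (\<Sum>j\<in>?J. \<Sum>i\<in>{i. i \<in> ?R \<and> x i = j}. ln (p (x i)))"
      by (rule sum.group[symmetric]) auto
    also have "\<dots> = (\<Sum>j\<in>?J. ?c j * ln (p j))"
    proof (intro sum.cong refl)
      fix j
      have "(\<Sum>i\<in>{i. i \<in> ?R \<and> x i = j}. ln (p (x i))) = (\<Sum>i\<in>{l. l < n \<and> I l \<and> x l = j}. ln (p j))"
        by (intro sum.cong) auto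
      then show "(\<Sum>i\<in>{i. i \<in> ?R \<and> x i = j}. ln (p (x i))) = ?c j * ln (p j)" by simp
    qed
    finally show ?thesis .
  qed
  have N0: "0 \<le> N" by (simp add: N_def)
  have trm: "?c j * ln (p j) - (?c j * ln (?c j) - ?c j) \<le> N * p j - ?c j * ln N" if j: "j \<in> ?J" for j
  proof (rule gibbs_term)
    show "?c j \<le> N" unfolding N_def by (intro of_nat_mono card_mono) auto
    show "0 < p j" using p(3) j by auto
  qed simp
  have "(\<Sum>i<n. if I i then ln (p (x i)) - ln (real (card {l. l < i \<and> I l \<and> x l = x i}) + 1/2) else 0)
     = (\<Sum>i<n. if I i then ln (p (x i)) else 0) - (\<Sum>i<n. if I i then ln (real (card {l. l < i \<and> I l \<and> x l = x i}) + 1/2) else 0)"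
    unfolding sum_subtractf[symmetric] by (intro sum.cong) auto
  also have "\<dots> \<le> (\<Sum>j\<in>?J. ?c j * ln (p j)) - (\<Sum>j\<in>?J. ?c j * ln (?c j) - ?c j)"
    unfolding lnp using KT_sum_lower[of ?J x n I] by simp
  also have "\<dots> = (\<Sum>j\<in>?J. ?c j * ln (p j) - (?c j * ln (?c j) - ?c j))" by (simp add: sum_subtractf)
  also have "\<dots> \<le> (\<Sum>j\<in>?J. N * p j - ?c j * ln N)" by (intro sum_mono trm)
  also have "\<dots> = N * (\<Sum>j\<in>?J. p j) - N * ln N" unfolding sum_subtractf N by (simp add: sum_distrib_left sum_distrib_right)
  also have "\<dots> \<le> N * 1 - N * ln N" using p N0 by (intro diff_right_mono mult_left_mono) auto
  finally show ?thesis by simp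
qed

text \<open>A crude Stirling bound for \<open>(n - 1)!\<close>, the product of the leading terms of
  the predictive denominators.\<close>

lemma sum_ln_le: "1 \<le> n \<Longrightarrow> (\<Sum>i\<in>{1..<n}. ln (real i)) \<le> real n * ln (real n) - real n + 1"
proof (induction n rule: dec_induct)
  case (step n)
  have n: "0 < real n" using step by simp
  have "ln (real n / (real n + 1)) \<le> real n / (real n + 1) - 1" using n by (intro ln_le_minus_one) auto
  then have "ln (real n) - ln (real n + 1) \<le> - (1 / (real n + 1))" using n by (simp add: ln_div field_simps)
  then have "(real n + 1) * (ln (real n) - ln (real n + 1)) \<le> (real n + 1) * (- (1 / (real n + 1)))"
    by (intro mult_left_mono) auto
  then have "(real n + 1) * (ln (real n) - ln (real n + 1)) \<le> - 1" by (simp del: mult_minus_right)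
  with step show ?case by (simp add: algebra_simps)
qed simp

text \<open>The KT factors of the uncensored symbols lose nothing beyond the maximum-likelihood code, and the
  growing alphabet costs only \<open>M\<^sub>i / i\<close> per step; every other loss is charged to a censored symbol.\<close>
lemma etac_arith_prob_bound:
  fixes p :: "nat \<Rightarrow> real"
  assumes n: "n = length xs" "1 \<le> n" and xs: "\<And>x. x \<in> set xs \<Longrightarrow> 1 \<le> x"
    and p: "\<And>j. 0 \<le> p j" "(\<Sum>j\<in>set xs. p j) \<le> 1" "\<And>x. x \<in> set xs \<Longrightarrow> 0 < p x"
  shows "ln (src_n p xs) - ln (etac_arith_prob xs) \<le> 1 + ln 2 + ln (2 * real n + 1)
    + (\<Sum>i<n. real (etac_M (take i xs)) / real i)
    + (\<Sum>i<n. if etac_censored xs i then ln (real n) + ln 2 + ln (p (xs ! i)) else 0)"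
proof -
  define I where "I i = (\<not> etac_censored xs i)" for i
  let ?M = "\<lambda>i. real (etac_M (take i xs))"
  define N where "N = real (card {l. l < n \<and> I l})"
  define C where "C = real (card {l. l < n \<and> \<not> I l})"
  have NC: "N + C = real n"
  proof -
    have "card ({l. l < n \<and> I l} \<union> {l. l < n \<and> \<not> I l}) = card {l. l < n \<and> I l} + card {l. l < n \<and> \<not> I l}"
      by (rule card_Un_disjoint) auto
    moreover have "{l. l < n \<and> I l} \<union> {l. l < n \<and> \<not> I l} = {..<n}" by auto
    ultimately show ?thesis unfolding N_def C_def by (simp flip: of_nat_add)
  qed
  have pos: "0 < p (xs ! i)" if "i < n" for i using that n p by simp
  have lsrc: "ln (src_n p xs) = (\<Sum>i<n. ln (p (xs ! i)))"
  proof -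
    have "src_n p xs = (\<Prod>i<n. p (xs ! i))"
      unfolding src_n_def prod.list_conv_set_nth using n by (simp add: atLeast0LessThan)
    then show ?thesis using ln_prod[of "{..<n}" "\<lambda>i. p (xs ! i)"] pos by fastforce
  qed
  have larith: "ln (etac_arith_prob xs) = (\<Sum>i<n. ln (etac_pred (take i xs) (etac_tilde xs i))) + ln (etac_pred xs 0)"
    unfolding etac_arith_prob_def n(1)[symmetric]
  proof -
    have nz: "etac_pred ys j \<noteq> 0" for ys j using etac_pred_pos[of ys j] by linarith
    have "ln (\<Prod>i<n. etac_pred (take i xs) (etac_tilde xs i)) = (\<Sum>i<n. ln (etac_pred (take i xs) (etac_tilde xs i)))"
      using nz by (subst ln_prod) auto
    moreover have "0 < (\<Prod>i<n. etac_pred (take i xs) (etac_tilde xs i))" using etac_pred_pos by (intro prod_pos) auto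
    ultimately show "ln ((\<Prod>i<n. etac_pred (take i xs) (etac_tilde xs i)) * etac_pred xs 0)
      = (\<Sum>i<n. ln (etac_pred (take i xs) (etac_tilde xs i))) + ln (etac_pred xs 0)"
      using etac_pred_pos[of xs 0] by (simp only: ln_mult_pos)
  qed
  have last: "- ln (etac_pred xs 0) \<le> ln 2 + ln (2 * real n + 1)"
  proof -
    have "etac_pred xs 0 = 1 / (2 * real n + ?M n + 1)"
      unfolding etac_pred_def etac_cnt_def n(1) by (simp add: field_simps)
    then have "- ln (etac_pred xs 0) = ln (2 * real n + ?M n + 1)" by (simp add: ln_div)
    also have "\<dots> \<le> ln (2 * (2 * real n + 1))"
      using etac_M_le_length[of xs] n by (simp)
    also have "\<dots> = ln 2 + ln (2 * real n + 1)" by (subst ln_mult) auto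
    finally show ?thesis .
  qed
  have step: "ln (p (xs ! i)) - ln (etac_pred (take i xs) (etac_tilde xs i))
     \<le> (if i = 0 then 0 else ln (real i)) + ?M i / real i
       + (if I i then ln (p (xs ! i)) - ln (real (card {l. l < i \<and> I l \<and> xs ! l = xs ! i}) + 1/2) else 0)
       + (if etac_censored xs i then ln 2 + ln (p (xs ! i)) else 0)" if i: "i < n" for i
  proof -
    have il: "length (take i xs) = i" using i n by simp
    have D: "0 < real i + (?M i + 1) / 2" by (auto intro: add_nonneg_pos)
    have lp: "ln (etac_pred (take i xs) j) = ln (real (etac_cnt (take i xs) j) + 1/2) - ln (real i + (?M i + 1) / 2)" for j
      unfolding etac_pred_def il using D by (subst ln_div) (auto intro: add_nonneg_pos)
    \<comment> \<open>For positive i, \<open>1 \<le> etac_M\<close> makes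
      \<open>i + (M + 1) / 2\<close> at most \<open>i * (1 + M / i)\<close>. At \<open>i = 0\<close>
      the denominator is \<open>1/2\<close>, with negative logarithm, while \<open>M / 0\<close> is
      0.\<close>
    have den: "ln (real i + (?M i + 1) / 2) \<le> (if i = 0 then 0 else ln (real i)) + ?M i / real i"
    proof (cases "i = 0")
      case True
      then have "?M i = 0" using etac_M_le_length[of "take i xs"] by simp
      then show ?thesis using True by (simp add: ln_div)
    next
      case False
      then have "take i xs \<noteq> []" using i n by auto
      then have "1 \<le> ?M i" using etac_M_ge_1 by fastforce
      then have "real i + (?M i + 1) / 2 \<le> real i * (1 + ?M i / real i)" using False by (simp add: field_simps)
      then have "ln (real i + (?M i + 1) / 2) \<le> ln (real i * (1 + ?M i / real i))" using D by (subst ln_le_cancel_iff) auto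
      also have "\<dots> = ln (real i) + ln (1 + ?M i / real i)" using False by (subst ln_mult_pos) (auto intro: add_pos_nonneg)
      also have "ln (1 + ?M i / real i) \<le> ?M i / real i" by (rule ln_add_one_self_le_self) simp
      finally show ?thesis using False by simp
    qed
    show ?thesis
    proof (cases "etac_censored xs i")
      case True
      then show ?thesis using lp[of 0] den by (simp add: etac_tilde_def etac_cnt_def I_def ln_div)
    next
      case False
      have x0: "xs ! i \<noteq> 0" using xs[of "xs ! i"] i n by fastforce
      \<comment> \<open>\<open>etac_cnt\<close> also counts earlier occurrences that were censored;
        leaving them out can only lower the count.\<close>
      have "card {l. l < i \<and> I l \<and> xs ! l = xs ! i} \<le> card {l. l < i \<and> xs ! l = xs ! i}"
        by (intro card_mono) auto
      also have "\<dots> = count_list (take i xs) (xs ! i)"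
        unfolding count_list_eq_length_filter length_filter_conv_card il
        by (intro arg_cong[of _ _ card]) (auto simp: i n)
      finally have lnle: "ln (real (card {l. l < i \<and> I l \<and> xs ! l = xs ! i}) + 1/2) \<le> ln (real (etac_cnt (take i xs) (xs ! i)) + 1/2)"
        using x0 by (subst ln_le_cancel_iff) (auto simp: etac_cnt_def intro: add_nonneg_pos)
      have t: "etac_tilde xs i = xs ! i" "I i = True" "etac_censored xs i = False"
        using False by (simp_all add: etac_tilde_def I_def)
      show ?thesis unfolding t if_True if_False using lnle lp[of "xs ! i"] den by linarith
    qed
  qed
  have im: "(!) xs ` {..<n} = set xs" unfolding n(1) by (auto simp: set_conv_nth)
  have A: "(\<Sum>i<n. if I i then ln (p (xs ! i)) - ln (real (card {l. l < i \<and> I l \<and> xs ! l = xs ! i}) + 1/2) else 0) \<le> N - N * ln N"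
    unfolding N_def using p pos im by (intro sum_ln_pred_le) auto
  have B: "(\<Sum>i<n. if i = 0 then 0 else ln (real i)) \<le> real n * ln (real n) - real n + 1"
  proof -
    have "(\<Sum>i<n. if i = 0 then 0 else ln (real i)) = (\<Sum>i\<in>{1..<n}. ln (real i))"
      by (rule sum.mono_neutral_cong_right) auto
    then show ?thesis using sum_ln_le[OF n(2)] by simp
  qed
  \<comment> \<open>The denominators run over all n positions but the counts only over the N
    uncensored ones; the mismatch is at most \<open>ln n\<close> for each of the C censored
    symbols.\<close>
  have E: "real n * ln (real n) - real n - (N * ln N - N) \<le> C * ln (real n)"
  proof (cases "N = 0")
    case True then show ?thesis using NC by simp
  next
    case False
    moreover have "0 \<le> N" by (simp add: N_def)
    ultimately have N0: "0 < N" by linarith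
    have rn: "0 < real n" using n(2) by linarith
    have "ln (real n / N) \<le> real n / N - 1" using N0 rn by (intro ln_le_minus_one divide_pos_pos)
    then have "ln (real n) - ln N \<le> real n / N - 1" using N0 rn by (simp add: ln_div)
    then have "N * (ln (real n) - ln N) \<le> N * (real n / N - 1)" using N0 by (intro mult_left_mono) auto
    also have "\<dots> = real n - N" using N0 by (simp add: right_diff_distrib)
    finally have "N * ln (real n) - N * ln N \<le> real n - N" by (simp add: right_diff_distrib)
    moreover have "C * ln (real n) = real n * ln (real n) - N * ln (real n)" unfolding NC[symmetric] by (simp add: algebra_simps)
    ultimately show ?thesis by linarith
  qed
  have F: "(\<Sum>i<n. if etac_censored xs i then ln (real n) + ln 2 + ln (p (xs ! i)) else 0)
     = C * ln (real n) + (\<Sum>i<n. if etac_censored xs i then ln 2 + ln (p (xs ! i)) else 0)"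
  proof -
    have "C * ln (real n) = (\<Sum>i\<in>{l. l < n \<and> \<not> I l}. ln (real n))" by (simp add: C_def)
    also have "\<dots> = (\<Sum>i<n. if etac_censored xs i then ln (real n) else 0)"
      by (rule sum.mono_neutral_cong_left) (auto simp: I_def)
    finally show ?thesis by (simp add: sum.distrib[symmetric] if_distrib cong: if_cong) (intro sum.cong; simp)
  qed
  have eq: "ln (src_n p xs) - ln (etac_arith_prob xs)
     = (\<Sum>i<n. ln (p (xs ! i)) - ln (etac_pred (take i xs) (etac_tilde xs i))) + (- ln (etac_pred xs 0))"
    unfolding lsrc larith by (simp add: sum_subtractf)
  have "(\<Sum>i<n. ln (p (xs ! i)) - ln (etac_pred (take i xs) (etac_tilde xs i)))
     \<le> (\<Sum>i<n. (if i = 0 then 0 else ln (real i)) + ?M i / real i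
       + (if I i then ln (p (xs ! i)) - ln (real (card {l. l < i \<and> I l \<and> xs ! l = xs ! i}) + 1/2) else 0)
       + (if etac_censored xs i then ln 2 + ln (p (xs ! i)) else 0))"
    by (rule sum_mono, rule step) simp
  then show ?thesis using last A B E unfolding eq F sum.distrib by linarith
qed

section \<open>Finite expectations over words\<close>

definition words :: "nat set \<Rightarrow> nat \<Rightarrow> nat list set" where
  "words A n = {xs. set xs \<subseteq> A \<and> length xs = n}"

definition wsum :: "(nat \<Rightarrow> real) \<Rightarrow> nat set \<Rightarrow> nat \<Rightarrow> (nat list \<Rightarrow> real) \<Rightarrow> real" where
  "wsum p A n g = (\<Sum>xs\<in>words A n. src_n p xs * g xs)"

lemma finite_words: "finite A \<Longrightarrow> finite (words A n)"
  unfolding words_def by (rule finite_lists_length_eq)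

lemma src_n_snoc: "src_n p (ys @ [x]) = src_n p ys * p x"
  by (simp add: src_n_def)

lemma src_n_zero: "x \<in> set xs \<Longrightarrow> p x = 0 \<Longrightarrow> src_n p xs = 0"
  by (induction xs) (auto simp: src_n_def)

lemma sum_words_Suc:
  assumes "finite A"
  shows "(\<Sum>xs\<in>words A (Suc n). h xs) = (\<Sum>ys\<in>words A n. \<Sum>x\<in>A. h (ys @ [x]))"
proof -
  have "(\<Sum>ys\<in>words A n. \<Sum>x\<in>A. h (ys @ [x])) = (\<Sum>(ys, x)\<in>words A n \<times> A. h (ys @ [x]))"
    by (rule sum.cartesian_product)
  also have "\<dots> = (\<Sum>xs\<in>words A (Suc n). h xs)"
  proof (rule sum.reindex_bij_witness[of _ "\<lambda>xs. (butlast xs, last xs)" "\<lambda>(ys, x). ys @ [x]"])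
    fix xs assume xs: "xs \<in> words A (Suc n)"
    then have ne: "xs \<noteq> []" by (auto simp: words_def)
    then show "(case (butlast xs, last xs) of (ys, x) \<Rightarrow> ys @ [x]) = xs" by simp
    have "set (butlast xs) \<subseteq> set xs" by (auto dest: in_set_butlastD)
    then show "(butlast xs, last xs) \<in> words A n \<times> A" using xs ne by (auto simp: words_def)
  qed (auto simp: words_def)
  finally show ?thesis by simp
qed

lemma wsum_0 [simp]: "wsum p A 0 g = g []"
proof -
  have "words A 0 = {[]}" by (auto simp: words_def)
  then show ?thesis by (simp add: wsum_def src_n_def)
qed

lemma wsum_Suc:
  "finite A \<Longrightarrow> wsum p A (Suc n) g = wsum p A n (\<lambda>ys. \<Sum>x\<in>A. p x * g (ys @ [x]))"
  unfolding wsum_def by (simp add: sum_words_Suc src_n_snoc sum_distrib_left mult_ac)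

lemma wsum_add: "wsum p A n (\<lambda>xs. g xs + h xs) = wsum p A n g + wsum p A n h"
  by (simp add: wsum_def distrib_left sum.distrib)

lemma wsum_cmult: "wsum p A n (\<lambda>xs. c * g xs) = c * wsum p A n g"
  by (simp add: wsum_def sum_distrib_left mult_ac)

lemma wsum_prod:
  "finite A \<Longrightarrow> wsum p A n (\<lambda>xs. prod_list (map h xs)) = (\<Sum>x\<in>A. p x * h x) ^ n"
proof (induction n)
  case (Suc n)
  have "wsum p A (Suc n) (\<lambda>xs. prod_list (map h xs)) = wsum p A n (\<lambda>ys. prod_list (map h ys) * (\<Sum>x\<in>A. p x * h x))"
    using Suc.prems by (simp add: wsum_Suc sum_distrib_left mult_ac)
  also have "\<dots> = wsum p A n (\<lambda>ys. prod_list (map h ys)) * (\<Sum>x\<in>A. p x * h x)"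
    by (simp only: mult.commute[of _ "\<Sum>x\<in>A. p x * h x"] wsum_cmult)
  finally show ?case using Suc by (simp add: mult.commute)
qed simp

lemma wsum_sum: "wsum p A n (\<lambda>xs. \<Sum>k\<in>K. g k xs) = (\<Sum>k\<in>K. wsum p A n (g k))"
proof -
  have "wsum p A n (\<lambda>xs. \<Sum>k\<in>K. g k xs) = (\<Sum>xs\<in>words A n. \<Sum>k\<in>K. src_n p xs * g k xs)"
    by (simp add: wsum_def sum_distrib_left)
  also have "\<dots> = (\<Sum>k\<in>K. \<Sum>xs\<in>words A n. src_n p xs * g k xs)" by (rule sum.swap)
  finally show ?thesis by (simp add: wsum_def)
qed

text \<open>Infinite sums over \<open>seqs n\<close> are controlled by finite subsets, and each of
  these lives over a finite alphabet; this is the passage from word sums to \<open>KL\<close> and to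
  the Kraft sum.\<close>

lemma finite_subset_seqs_words:
  assumes "finite F" "F \<subseteq> seqs n"
  obtains A where "finite A" "\<And>x. x \<in> A \<Longrightarrow> 1 \<le> x" "F \<subseteq> words A n"
proof (rule that)
  show "finite (\<Union> (set ` F))" using assms(1) by blast
  show "\<And>x. x \<in> \<Union> (set ` F) \<Longrightarrow> 1 \<le> x" using assms(2) unfolding seqs_def by blast
  show "F \<subseteq> words (\<Union> (set ` F)) n"
  proof
    fix xs assume "xs \<in> F"
    with assms(2) show "xs \<in> words (\<Union> (set ` F)) n" unfolding words_def seqs_def by blast
  qed
qed

lemma words_subset_seqs: "(\<And>x. x \<in> A \<Longrightarrow> 1 \<le> x) \<Longrightarrow> words A n \<subseteq> seqs n"
  by (auto simp: words_def seqs_def)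

section \<open>Sub-probabilities: expected counts and expected censoring mass\<close>

locale subpmf =
  fixes p :: "nat \<Rightarrow> real" and A :: "nat set"
  assumes fin: "finite A" and nonneg: "\<And>x. 0 \<le> p x" and mass: "(\<Sum>x\<in>A. p x) \<le> 1"
begin

definition tail :: "nat \<Rightarrow> real" where "tail k = (\<Sum>x\<in>{x\<in>A. k < x}. p x)"

lemma src_nonneg: "0 \<le> src_n p xs"
  unfolding src_n_def by (induction xs) (simp_all add: nonneg)

lemma tail_nonneg: "0 \<le> tail k" unfolding tail_def using nonneg by (intro sum_nonneg) auto

lemma tail_antimono: "j \<le> k \<Longrightarrow> tail k \<le> tail j"
  unfolding tail_def using nonneg fin by (intro sum_mono2) auto

lemma tail_le_1: "tail k \<le> 1"
proof -
  have "tail k \<le> (\<Sum>x\<in>A. p x)" unfolding tail_def using nonneg fin by (intro sum_mono2) auto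
  with mass show ?thesis by linarith
qed

lemma tail_if: "(\<Sum>x\<in>A. p x * (if k < x then c else 0)) = c * tail k"
proof -
  have "(\<Sum>x\<in>A. p x * (if k < x then c else 0)) = (\<Sum>x\<in>{x\<in>A. k < x}. p x * c)"
    using fin by (intro sum.mono_neutral_cong_right) auto
  then show ?thesis by (simp add: tail_def sum_distrib_left mult.commute)
qed

lemma wsum_mono:
  assumes "\<And>xs. xs \<in> words A n \<Longrightarrow> g xs \<le> h xs" shows "wsum p A n g \<le> wsum p A n h"
  unfolding wsum_def using assms src_nonneg by (intro sum_mono mult_left_mono)

lemma wsum_const: "0 \<le> c \<Longrightarrow> wsum p A n (\<lambda>_. c) \<le> c"
proof -
  assume c: "0 \<le> c"
  have "wsum p A n (\<lambda>_. c * 1) = c * (\<Sum>x\<in>A. p x) ^ n"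
    using wsum_prod[OF fin, of p n "\<lambda>_. 1"] unfolding wsum_cmult by (simp add: map_replicate_const)
  also have "\<dots> \<le> c * 1" using c mass nonneg by (intro mult_left_mono power_le_one sum_nonneg) auto
  finally show ?thesis by simp
qed

text \<open>Symbols after position i sum out to at most 1, so each term reduces to an expectation
  over its own prefix. As the mass may be below 1, nonnegativity of b keeps this an upper
  bound.\<close>

lemma wsum_prefix_sum:
  assumes b: "\<And>ys x. 0 \<le> b ys x"
  shows "wsum p A n (\<lambda>xs. \<Sum>i<n. b (take i xs) (xs ! i)) \<le> (\<Sum>i<n. wsum p A i (\<lambda>ys. \<Sum>x\<in>A. p x * b ys x))"
proof (induction n)
  case (Suc n)
  let ?S = "\<lambda>xs. \<Sum>i<n. b (take i xs) (xs ! i)"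
  have "wsum p A (Suc n) (\<lambda>xs. \<Sum>i<Suc n. b (take i xs) (xs ! i))
      = wsum p A n (\<lambda>ys. \<Sum>x\<in>A. p x * (\<Sum>i<Suc n. b (take i (ys @ [x])) ((ys @ [x]) ! i)))"
    using fin by (rule wsum_Suc)
  also have "\<dots> \<le> wsum p A n (\<lambda>ys. ?S ys + (\<Sum>x\<in>A. p x * b ys x))"
  proof (rule wsum_mono)
    fix ys assume "ys \<in> words A n"
    then have l: "length ys = n" by (simp add: words_def)
    have "(\<Sum>x\<in>A. p x * (\<Sum>i<Suc n. b (take i (ys @ [x])) ((ys @ [x]) ! i)))
       = (\<Sum>x\<in>A. p x * (?S ys + b ys x))"
    proof (intro sum.cong refl arg_cong2[of _ _ _ _ "(*)"])
      fix x
      have "(\<Sum>i<n. b (take i (ys @ [x])) ((ys @ [x]) ! i)) = ?S ys"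
        by (intro sum.cong refl) (simp add: nth_append l)
      then show "(\<Sum>i<Suc n. b (take i (ys @ [x])) ((ys @ [x]) ! i)) = ?S ys + b ys x" by (simp add: l nth_append)
    qed
    also have "\<dots> = (\<Sum>x\<in>A. p x) * ?S ys + (\<Sum>x\<in>A. p x * b ys x)"
      by (simp add: distrib_left sum.distrib sum_distrib_right)
    also have "\<dots> \<le> 1 * ?S ys + (\<Sum>x\<in>A. p x * b ys x)"
      using mass b by (intro add_right_mono mult_right_mono sum_nonneg) auto
    finally show "(\<Sum>x\<in>A. p x * (\<Sum>i<Suc n. b (take i (ys @ [x])) ((ys @ [x]) ! i))) \<le> ?S ys + (\<Sum>x\<in>A. p x * b ys x)"
      by simp
  qed
  also have "\<dots> = wsum p A n ?S + wsum p A n (\<lambda>ys. \<Sum>x\<in>A. p x * b ys x)" by (rule wsum_add)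
  also have "\<dots> \<le> (\<Sum>i<Suc n. wsum p A i (\<lambda>ys. \<Sum>x\<in>A. p x * b ys x))" using Suc by simp
  finally show ?case .
qed simp

lemma num_gt_sum: "real (num_gt y xs) = (\<Sum>i<length xs. if y < xs ! i then 1 else 0)"
proof -
  have "num_gt y xs = card {i. i < length xs \<and> y < xs ! i}"
    unfolding num_gt_def by (rule length_filter_conv_card)
  also have "real \<dots> = (\<Sum>i\<in>{i. i < length xs \<and> y < xs ! i}. 1)" by simp
  also have "\<dots> = (\<Sum>i<length xs. if y < xs ! i then 1 else 0)"
    by (rule sum.mono_neutral_cong_left) auto
  finally show ?thesis .
qed

lemma wsum_num_gt: "wsum p A n (\<lambda>xs. real (num_gt y xs)) \<le> real n * tail y"
proof -
  have "wsum p A n (\<lambda>xs. real (num_gt y xs)) \<le> wsum p A n (\<lambda>xs. \<Sum>i<n. (\<lambda>ys x. if y < x then 1 else 0) (take i xs) (xs ! i))"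
    by (rule wsum_mono) (simp add: num_gt_sum words_def)
  also have "\<dots> \<le> (\<Sum>i<n. wsum p A i (\<lambda>ys. \<Sum>x\<in>A. p x * (if y < x then 1 else 0)))"
    by (rule wsum_prefix_sum) simp
  also have "\<dots> \<le> (\<Sum>i<n. tail y)"   proof (rule sum_mono)
    fix i
    show "wsum p A i (\<lambda>ys. \<Sum>x\<in>A. p x * (if y < x then 1 else 0)) \<le> tail y"
      unfolding tail_if mult_1 by (rule wsum_const[OF tail_nonneg])
  qed
  finally show ?thesis by simp
qed

lemma wsum_etac_M:
  assumes "real n * tail y \<le> Y"
  shows "wsum p A n (\<lambda>xs. real (etac_M xs)) \<le> real y + Y + 1"
proof -
  have "wsum p A n (\<lambda>xs. real (etac_M xs)) \<le> wsum p A n (\<lambda>xs. (real y + 1) + real (num_gt y xs))"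
  proof (rule wsum_mono)
    fix xs
    have "real (etac_M xs) \<le> real (y + num_gt y xs + 1)" using etac_M_le_num_gt[of xs y] by (simp only: of_nat_le_iff)
    then show "real (etac_M xs) \<le> (real y + 1) + real (num_gt y xs)" by simp
  qed
  also have "\<dots> = wsum p A n (\<lambda>xs. real y + 1) + wsum p A n (\<lambda>xs. real (num_gt y xs))" by (rule wsum_add)
  also have "\<dots> \<le> real y + 1 + Y" using wsum_const[of "real y + 1" n] wsum_num_gt[of n y] assms by linarith
  finally show ?thesis by simp
qed

lemma wsum_half_power: "wsum p A n (\<lambda>xs. (1/2) ^ num_gt k xs) \<le> exp (- (real n * tail k / 2))"
proof -
  have e: "(1/2::real) ^ num_gt k xs = prod_list (map (\<lambda>x. if k < x then 1/2 else 1) xs)" for xs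
    unfolding num_gt_def by (induction xs) auto
  have "(\<Sum>x\<in>A. p x * (if k < x then 1/2 else 1)) = (\<Sum>x\<in>A. p x - p x * (if k < x then 1/2 else 0))"
    by (intro sum.cong) auto
  also have "\<dots> = (\<Sum>x\<in>A. p x) - tail k / 2" by (simp add: sum_subtractf tail_if)
  also have "\<dots> \<le> 1 + (- (tail k / 2))" using mass by simp
  also have "\<dots> \<le> exp (- (tail k / 2))" by (rule exp_ge_add_one_self)
  finally have "(\<Sum>x\<in>A. p x * (if k < x then 1/2 else 1)) ^ n \<le> exp (- (tail k / 2)) ^ n"
    using nonneg by (intro power_mono sum_nonneg) auto
  then show ?thesis unfolding e wsum_prod[OF fin] by (simp add: exp_of_nat_mult[symmetric])
qed

definition bad :: "nat \<Rightarrow> nat \<Rightarrow> bool" where "bad n k \<longleftrightarrow> 2 * real k < real n * tail k"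

definition bad_sum :: "nat \<Rightarrow> nat list \<Rightarrow> real" where
  "bad_sum n ys = (\<Sum>k\<in>{k\<in>{1..<n}. bad n k}. tail k * 2 ^ k * (1/2) ^ num_gt k ys)"

lemma bad_sum_nonneg: "0 \<le> bad_sum n ys"
  unfolding bad_sum_def using tail_nonneg by (intro sum_nonneg) auto

text \<open>If \<open>M = k\<close> although \<open>n\<close> times the tail at \<open>k\<close> exceeds \<open>2 k\<close>, then fewer than \<open>k\<close> samples exceed \<open>k\<close>:
  a large deviation, controlled by the exponential moment in \<open>bad_sum\<close>.\<close>
lemma tail_etac_M_le:
  assumes n: "length ys = n" "1 \<le> n"
  shows "tail (etac_M ys) \<le> 2 * real (etac_M ys) / real n + bad_sum n ys"
proof (cases "bad n (etac_M ys)")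
  case False
  then have "tail (etac_M ys) \<le> 2 * real (etac_M ys) / real n" using n by (simp add: bad_def field_simps)
  then show ?thesis using bad_sum_nonneg[of n ys] by linarith
next
  case True
  let ?M = "etac_M ys"
  have M1: "1 \<le> ?M" using n by (intro etac_M_ge_1) auto
  \<comment> \<open>A bad level satisfies \<open>2 * k < n\<close>, so the fallback value n of
    \<open>etac_M\<close> is excluded and \<open>num_gt_etac_M\<close> applies.\<close>
  have Mn: "?M < n"
  proof (rule ccontr)
    assume "\<not> ?M < n"
    then have "real n \<le> real ?M" by simp
    moreover have "real n * tail ?M \<le> real n * 1" using tail_le_1 by (intro mult_left_mono) auto
    ultimately show False using True unfolding bad_def by linarith
  qed
  then have "num_gt ?M ys < ?M" using n by (intro num_gt_etac_M) auto
  then have "(2::real) ^ num_gt ?M ys \<le> 2 ^ ?M" by (intro power_increasing) auto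
  then have "1 \<le> (2::real) ^ ?M * (1/2) ^ num_gt ?M ys" by (simp add: power_divide field_simps)
  then have "tail ?M * 1 \<le> tail ?M * (2 ^ ?M * (1/2) ^ num_gt ?M ys)" using tail_nonneg by (intro mult_left_mono) auto
  also have "\<dots> = tail ?M * 2 ^ ?M * (1/2) ^ num_gt ?M ys" by simp
  also have "\<dots> \<le> bad_sum n ys" unfolding bad_sum_def
    using M1 Mn True tail_nonneg by (intro member_le_sum) auto
  finally show ?thesis by (simp add: add_increasing)
qed

end

text \<open>Of the exponent \<open>u / 2\<close> with \<open>u = n * tail k\<close>, the part
  \<open>u / 8\<close> absorbs the prefactor u through \<open>u * exp (- u / 8) \<le> 8\<close>; the
  remaining \<open>3 * u / 8\<close> exceeds \<open>3/4 * k\<close> at a bad level and must beat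
  \<open>2 ^ k\<close>. The 8 and the geometric series reappear in
  \<open>etac_const\<close>.\<close>

definition dev_ratio :: real where "dev_ratio = 2 * exp (- 3/4)"

lemma dev_ratio: "0 < dev_ratio" "dev_ratio < 1"
proof -
  have "ln 2 < (3/4 :: real)" using ln2_le_25_over_36 by simp
  then have "exp (ln 2) < exp (3/4 :: real)" by (subst exp_less_cancel_iff)
  then show "dev_ratio < 1" by (simp add: dev_ratio_def exp_minus field_simps)
qed (simp add: dev_ratio_def)

definition etac_const :: real where "etac_const = 8 / (1 - dev_ratio)"

lemma etac_const_pos: "0 < etac_const" using dev_ratio by (simp add: etac_const_def)

context subpmf
begin

lemma wsum_bad_sum:
  assumes n: "1 \<le> n" shows "wsum p A n (bad_sum n) \<le> etac_const / real n"
proof -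
  have "wsum p A n (bad_sum n) = (\<Sum>k\<in>{k\<in>{1..<n}. bad n k}. tail k * 2 ^ k * wsum p A n (\<lambda>ys. (1/2) ^ num_gt k ys))"
    unfolding bad_sum_def[abs_def] wsum_sum wsum_cmult ..
  also have "\<dots> \<le> (\<Sum>k\<in>{k\<in>{1..<n}. bad n k}. 8 / real n * dev_ratio ^ k)"
  proof (rule sum_mono)
    fix k assume "k \<in> {k\<in>{1..<n}. bad n k}"
    then have u: "2 * real k < real n * tail k" by (simp add: bad_def)
    define u where "u = real n * tail k"
    have "tail k * 2 ^ k * wsum p A n (\<lambda>ys. (1/2) ^ num_gt k ys) \<le> tail k * 2 ^ k * exp (- (u / 2))"
      unfolding u_def using wsum_half_power tail_nonneg by (intro mult_left_mono) auto
    also have "tail k * 2 ^ k * exp (- (u / 2)) = (u * exp (- (u / 8))) * exp (- (3 * u / 8)) * 2 ^ k / real n"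
    proof -
      have "tail k = u / real n" using n by (simp add: u_def)
      moreover
      have "exp (- (u / 2)) = exp (- (u / 8)) * exp (- (3 * u / 8))" unfolding exp_add[symmetric] by (simp add: field_simps)
      ultimately show ?thesis by simp
    qed
    also have "\<dots> \<le> 8 * exp (- (3/4)) ^ k * 2 ^ k / real n"
    proof (intro divide_right_mono mult_right_mono mult_mono)
      have "1 + u / 8 \<le> exp (u / 8)" by (rule exp_ge_add_one_self)
      then have "u \<le> 8 * exp (u / 8)" by linarith
      then show "u * exp (- (u / 8)) \<le> 8" by (simp add: exp_minus field_simps)
      have "exp (- (3 * u / 8)) \<le> exp (real k * (- (3/4)))" using u by (simp add: u_def)
      then show "exp (- (3 * u / 8)) \<le> exp (- (3/4)) ^ k" by (simp only: exp_of_nat_mult)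
    qed auto
    also have "\<dots> = 8 / real n * dev_ratio ^ k" by (simp add: dev_ratio_def power_mult_distrib)
    finally show "tail k * 2 ^ k * wsum p A n (\<lambda>ys. (1/2) ^ num_gt k ys) \<le> 8 / real n * dev_ratio ^ k" .
  qed
  also have "\<dots> = 8 / real n * (\<Sum>k\<in>{k\<in>{1..<n}. bad n k}. dev_ratio ^ k)" by (simp add: sum_distrib_left)
  also have "\<dots> \<le> 8 / real n * (\<Sum>k<n. dev_ratio ^ k)" using dev_ratio by (intro mult_left_mono sum_mono2) auto
  also have "\<dots> \<le> 8 / real n * (1 / (1 - dev_ratio))"
  proof (rule mult_left_mono)
    have "(\<Sum>k<n. dev_ratio ^ k) \<le> (\<Sum>k. dev_ratio ^ k)" using dev_ratio by (intro sum_le_suminf summable_geometric) auto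
    also have "\<dots> = 1 / (1 - dev_ratio)" using dev_ratio by (intro suminf_geometric) auto
    finally show "(\<Sum>k<n. dev_ratio ^ k) \<le> 1 / (1 - dev_ratio)" .
  qed simp
  finally show ?thesis by (simp add: etac_const_def mult.commute)
qed

text \<open>\<open>tail (etac_M ys)\<close> is the mass of the next symbols that would be censored.
  The cutoff y is unrelated to n here, since one cutoff serves all prefix lengths.\<close>

lemma wsum_tail_small_M:
  assumes n: "1 \<le> n"
  shows "wsum p A n (\<lambda>ys. if etac_M ys < y then tail (etac_M ys) else 0) \<le> (2 * real y + etac_const) / real n"
proof -
  have "wsum p A n (\<lambda>ys. if etac_M ys < y then tail (etac_M ys) else 0) \<le> wsum p A n (\<lambda>ys. 2 * real y / real n + bad_sum n ys)"
  proof (rule wsum_mono)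
    fix ys assume ys: "ys \<in> words A n"
    have 1: "tail (etac_M ys) \<le> 2 * real (etac_M ys) / real n + bad_sum n ys"
      using ys n by (intro tail_etac_M_le) (auto simp: words_def)
    show "(if etac_M ys < y then tail (etac_M ys) else 0) \<le> 2 * real y / real n + bad_sum n ys"
    proof (cases "etac_M ys < y")
      case True
      then have "2 * real (etac_M ys) / real n \<le> 2 * real y / real n" by (intro divide_right_mono) auto
      with 1 have "tail (etac_M ys) \<le> 2 * real y / real n + bad_sum n ys" by linarith
      with True show ?thesis by simp
    next
      case False then show ?thesis using bad_sum_nonneg[of n ys] by simp
    qed
  qed
  also have "\<dots> \<le> 2 * real y / real n + etac_const / real n"
    unfolding wsum_add by (rule add_mono[OF wsum_const wsum_bad_sum[OF n]]) simp
  finally show ?thesis by (simp add: add_divide_distrib)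
qed

text \<open>With y at the scale of the threshold, a value of \<open>etac_M\<close> above y is
  harmless, as the tail at y is already at most \<open>y / n\<close>. Up to y, the deviation bound
  applies.\<close>

lemma wsum_tail_M:
  assumes n: "1 \<le> n" and y: "real n * tail y \<le> real y"
  shows "wsum p A n (\<lambda>ys. tail (etac_M ys)) \<le> (2 * real y + etac_const) / real n"
proof -
  have "wsum p A n (\<lambda>ys. tail (etac_M ys)) \<le> wsum p A n (\<lambda>ys. 2 * real y / real n + bad_sum n ys)"
  proof (rule wsum_mono)
    fix ys assume ys: "ys \<in> words A n"
    show "tail (etac_M ys) \<le> 2 * real y / real n + bad_sum n ys"
    proof (cases "etac_M ys \<le> y")
      case True
      have "tail (etac_M ys) \<le> 2 * real (etac_M ys) / real n + bad_sum n ys"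
        using ys n by (intro tail_etac_M_le) (auto simp: words_def)
      also have "2 * real (etac_M ys) / real n \<le> 2 * real y / real n"
        using True by (intro divide_right_mono) auto
      finally show ?thesis by simp
    next
      case False
      then have "tail (etac_M ys) \<le> tail y" by (intro tail_antimono) auto
      also have "\<dots> \<le> 2 * real y / real n" using y n by (simp add: field_simps)
      finally show ?thesis using bad_sum_nonneg[of n ys] by linarith
    qed
  qed
  also have "\<dots> \<le> 2 * real y / real n + etac_const / real n"
    unfolding wsum_add by (rule add_mono[OF wsum_const wsum_bad_sum[OF n]]) simp
  finally show ?thesis by (simp add: add_divide_distrib)
qed

end

section \<open>Lower bound on the minimax redundancy\<close>

lemma sum_pairs_choice:
  "(\<Sum>d<2 * K. if even d = (d div 2 \<in> th) then q else (0::real)) = real K * q"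
proof (induction K)
  case (Suc K)
  have "2 * Suc K = Suc (Suc (2 * K))" by simp
  then show ?case using Suc by (simp add: algebra_simps)
qed simp

lemma card_Pow_agree:
  assumes "finite B" "S \<subseteq> B" "th \<subseteq> B"
  shows "card {t \<in> Pow B. t \<inter> S = th \<inter> S} = 2 ^ (card B - card S)"
proof -
  have "bij_betw (\<lambda>t. t \<union> (th \<inter> S)) (Pow (B - S)) {t \<in> Pow B. t \<inter> S = th \<inter> S}"
    by (rule bij_betw_byWitness[of _ "\<lambda>t. t - S"]) (use assms in auto)
  then have "card {t \<in> Pow B. t \<inter> S = th \<inter> S} = card (Pow (B - S))" by (simp add: bij_betw_same_card)
  also have "\<dots> = 2 ^ card (B - S)" using assms by (simp add: card_Pow)
  also have "card (B - S) = card B - card S" using assms finite_subset by (intro card_Diff_subset) auto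
  finally show ?thesis .
qed

text \<open>The base p0 receives the mass left over by the pairs, on symbols kept apart from them by
  \<open>j0 \<le> b\<close>. Each pair has total mass q whatever its bit, so the law of the set of
  seen bits does not depend on the source.\<close>

locale hypercube_sources =
  fixes f p0 :: "nat \<Rightarrow> real" and j0 b K :: nat and q :: real
  assumes p0: "\<And>j. 0 \<le> p0 j" "p0 0 = 0" "\<And>j. 1 \<le> j \<Longrightarrow> j \<le> j0 \<Longrightarrow> p0 j \<le> f j" "(\<Sum>j\<in>{1..j0}. p0 j) = 1"
    and jb: "j0 \<le> b" and f0: "\<And>j. 1 \<le> j \<Longrightarrow> 0 \<le> f j"
    and q: "0 < q" "real K * q \<le> 1" "\<And>j. b < j \<Longrightarrow> j \<le> b + 2 * K \<Longrightarrow> q \<le> f j"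
begin

text \<open>The bit \<open>a \<in> th\<close> decides which of the two symbols \<open>b + 2 a + 1\<close>, \<open>b + 2 a + 2\<close> carries the mass \<open>q\<close>.\<close>
definition src :: "nat set \<Rightarrow> nat \<Rightarrow> real" where
  "src th j = (if j \<le> j0 then (1 - real K * q) * p0 j
     else if b < j \<and> j \<le> b + 2 * K then (if even (j - b - 1) = ((j - b - 1) div 2 \<in> th) then q else 0) else 0)"

definition alph :: "nat set" where "alph = {1..b + 2 * K}"

definition in_pair :: "nat \<Rightarrow> nat \<Rightarrow> bool" where
  "in_pair a x \<longleftrightarrow> x = b + 2 * a + 1 \<or> x = b + 2 * a + 2"

definition seen :: "nat list \<Rightarrow> nat set" where
  "seen xs = {a. a < K \<and> (\<exists>x\<in>set xs. in_pair a x)}"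

text \<open>The Bayes mixture for the uniform prior on the hypercube.\<close>

definition mix :: "nat \<Rightarrow> nat list \<Rightarrow> real" where
  "mix n xs = (\<Sum>th\<in>Pow {..<K}. src_n (src th) xs) / 2 ^ K"

lemma src_nonneg: "0 \<le> src th j"
  using p0 q by (auto simp: src_def)

lemma src_n_nonneg: "0 \<le> src_n (src th) xs"
  unfolding src_n_def by (induction xs) (simp_all add: src_nonneg)

lemma src_outside: "j \<notin> alph \<Longrightarrow> src th j = 0"
  using p0(2) jb by (cases "j = 0") (auto simp: src_def alph_def)

lemma src_sum: "(\<Sum>x\<in>alph. src th x) = 1"
proof -
  have al: "alph = {1..j0} \<union> {j0<..b} \<union> {b<..b + 2 * K}" using jb by (auto simp: alph_def)
  have "(\<Sum>x\<in>alph. src th x) = (\<Sum>x\<in>{1..j0}. src th x) + (\<Sum>x\<in>{j0<..b}. src th x) + (\<Sum>x\<in>{b<..b + 2 * K}. src th x)"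
    unfolding al using jb by (subst sum.union_disjoint; (subst sum.union_disjoint)?) auto
  also have "(\<Sum>x\<in>{1..j0}. src th x) = (\<Sum>x\<in>{1..j0}. (1 - real K * q) * p0 x)"
    by (intro sum.cong) (auto simp: src_def)
  also have "\<dots> = 1 - real K * q" using p0(4) by (simp add: sum_distrib_left[symmetric])
  also have "(\<Sum>x\<in>{j0<..b}. src th x) = 0" by (intro sum.neutral) (auto simp: src_def)
  also have "(\<Sum>x\<in>{b<..b + 2 * K}. src th x) = (\<Sum>d<2 * K. if even d = (d div 2 \<in> th) then q else 0)"
    by (rule sum.reindex_bij_witness[of _ "\<lambda>d. b + d + 1" "\<lambda>x. x - b - 1"]) (use jb in \<open>auto simp: src_def\<close>)
  also have "\<dots> = real K * q" by (rule sum_pairs_choice)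
  finally show ?thesis by simp
qed

lemma subpmf_src: "subpmf (src th) alph"
  by unfold_locales (simp_all add: src_nonneg src_sum, simp add: alph_def)

lemma src_env_class: "src th \<in> env_class f"
proof -
  have "(src th has_sum (\<Sum>x\<in>alph. src th x)) alph" by (rule has_sum_finite) (simp add: alph_def)
  then have "(src th has_sum 1) {1..}"
    unfolding src_sum
    by (rule has_sum_cong_neutral[THEN iffD1, rotated -1]) (auto simp: alph_def src_outside)
  moreover have "src th j \<le> f j" if "1 \<le> j" for j
  proof -
    have "(1 - real K * q) * p0 j \<le> 1 * p0 j" using p0(1) q by (intro mult_right_mono) auto
    then show ?thesis using that p0(3)[of j] f0[OF that] q(3)[of j] by (auto simp: src_def)
  qed
  moreover have "src th 0 = 0" using p0 by (simp add: src_def)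
  ultimately show ?thesis using src_nonneg by (simp add: env_class_def)
qed

lemma in_pair_iff: "in_pair a x \<longleftrightarrow> b < x \<and> (x - b - 1) div 2 = a"
proof (cases "b < x")
  case True
  then obtain d where x: "x = b + 1 + d" by (metis Suc_eq_plus1 Suc_leI add.assoc add.commute le_Suc_ex)
  have "d = 2 * a \<or> d = 2 * a + 1 \<longleftrightarrow> d div 2 = a" by presburger
  then show ?thesis unfolding in_pair_def x by simp
qed (simp add: in_pair_def)

lemma src_agree:
  assumes "a < K" "in_pair a x" "a \<in> th \<longleftrightarrow> a \<in> th'"
  shows "src th x = src th' x"
proof -
  have h: "(x - b - 1) div 2 = a" using assms(2) by (simp add: in_pair_iff)
  show ?thesis by (simp only: src_def h assms(3))
qed

lemma src_disagree:
  assumes "a < K" "in_pair a x" "\<not> (a \<in> th \<longleftrightarrow> a \<in> th')" "0 < src th x"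
  shows "src th' x = 0"
proof -
  have h: "(x - b - 1) div 2 = a" and nj: "\<not> x \<le> j0" using assms(2) jb by (simp_all add: in_pair_iff)
  have "even (x - b - 1) = (a \<in> th)"
    using assms(4) unfolding src_def h by (simp only: nj if_False less_irrefl split: if_splits)
  with assms(3) have "\<not> even (x - b - 1) = (a \<in> th')" by blast
  with nj show ?thesis by (simp only: src_def h if_False if_cancel)
qed

lemma src_n_agree:
  assumes "th \<inter> seen xs = th' \<inter> seen xs" shows "src_n (src th) xs = src_n (src th') xs"
proof -
  have "map (src th) xs = map (src th') xs"
  proof (rule map_cong[OF refl])
    fix x assume x: "x \<in> set xs"
    show "src th x = src th' x"
    proof (cases "\<exists>a<K. in_pair a x")
      case True
      then obtain a where a: "a < K" "in_pair a x" by blast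
      then have "a \<in> seen xs" using x by (auto simp: seen_def)
      then have "a \<in> th \<longleftrightarrow> a \<in> th'" using assms by blast
      with a show ?thesis by (intro src_agree)
    next
      case False
      then have "\<not> (b < x \<and> x \<le> b + 2 * K)"
        by (auto simp: in_pair_iff dest!: spec[of _ "(x - b - 1) div 2"])
      then show ?thesis unfolding src_def by (simp only: if_False)
    qed
  qed
  then show ?thesis by (simp only: src_n_def)
qed

lemma src_n_disagree:
  assumes "th \<inter> seen xs \<noteq> th' \<inter> seen xs" "0 < src_n (src th) xs" shows "src_n (src th') xs = 0"
proof -
  obtain a where a: "a \<in> seen xs" "\<not> (a \<in> th \<longleftrightarrow> a \<in> th')" using assms(1) by blast
  then obtain x where x: "a < K" "x \<in> set xs" "in_pair a x" by (auto simp: seen_def)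
  have "src th x \<noteq> 0" using assms(2) src_n_zero[OF x(2), of "src th"] by force
  then have "0 < src th x" using src_nonneg[of th x] by simp
  then have "src th' x = 0" using x a by (intro src_disagree[of a x th])
  then show ?thesis using src_n_zero x(2) by blast
qed

text \<open>A seen bit is determined and an unseen bit does not affect the likelihood, so the
  posterior is uniform on the \<open>2 ^ (K - card (seen xs))\<close> compatible sources. The
  likelihood ratio to the mixture is therefore exactly 2 to the number of seen bits.\<close>

lemma mix_eq:
  assumes "th \<subseteq> {..<K}" "0 < src_n (src th) xs"
  shows "src_n (src th) xs = 2 ^ card (seen xs) * mix n xs"
proof -
  have S: "seen xs \<subseteq> {..<K}" by (auto simp: seen_def)
  then have cS: "card (seen xs) \<le> K" using card_mono[OF _ S] by simp
  let ?T = "{t \<in> Pow {..<K}. t \<inter> seen xs = th \<inter> seen xs}"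
  have "(\<Sum>t\<in>Pow {..<K}. src_n (src t) xs) = (\<Sum>t\<in>?T. src_n (src th) xs)"
  proof (rule sum.mono_neutral_cong_right)
    show "\<forall>t\<in>Pow {..<K} - ?T. src_n (src t) xs = 0"
    proof
      fix t assume "t \<in> Pow {..<K} - ?T"
      then show "src_n (src t) xs = 0" using assms(2) by (intro src_n_disagree[of th xs t]) auto
    qed
    fix t assume "t \<in> ?T"
    then show "src_n (src t) xs = src_n (src th) xs" by (intro src_n_agree) auto
  qed auto
  also have "\<dots> = 2 ^ (K - card (seen xs)) * src_n (src th) xs"
    using card_Pow_agree[of "{..<K}" "seen xs" th] S assms(1) by simp
  finally have "mix n xs = 2 ^ (K - card (seen xs)) * src_n (src th) xs / 2 ^ K" by (simp add: mix_def)
  moreover have "(2::real) ^ K = 2 ^ (K - card (seen xs)) * 2 ^ card (seen xs)"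
    using cS by (simp add: power_add[symmetric])
  ultimately show ?thesis by simp
qed

text \<open>Bit a is missed exactly if all symbols avoid its pair; this indicator is a product over
  symbols, with mean \<open>(1 - q) ^ n\<close>.\<close>

lemma wsum_seen:
  assumes "th \<subseteq> {..<K}"
  shows "wsum (src th) alph n (\<lambda>xs. real (card (seen xs))) = real K * (1 - (1 - q) ^ n)"
proof -
  interpret subpmf "src th" alph by (rule subpmf_src)
  define h where "h a x = (if in_pair a x then 0 else (1::real))" for a x
  have pl: "prod_list (map (h a) xs) = (if \<exists>x\<in>set xs. in_pair a x then 0 else 1)" for a xs
    by (induction xs) (auto simp: h_def)
  have card: "real (card (seen xs)) = (\<Sum>a<K. 1 + (- 1) * prod_list (map (h a) xs))" for xs
  proof -
    have "real (card (seen xs)) = (\<Sum>a\<in>seen xs. 1)" by simp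
    also have "\<dots> = (\<Sum>a<K. 1 + (- 1) * prod_list (map (h a) xs))"
      unfolding pl by (rule sum.mono_neutral_cong_left) (auto simp: seen_def)
    finally show ?thesis .
  qed
  have one: "wsum (src th) alph n (\<lambda>xs. 1) = 1"
    using wsum_prod[OF fin, of "src th" n "\<lambda>_. 1"] by (simp add: src_sum map_replicate_const)
  have ph: "(\<Sum>x\<in>alph. src th x * h a x) = 1 - q" if a: "a < K" for a
  proof -
    have "(\<Sum>x\<in>alph. src th x * h a x) = (\<Sum>x\<in>alph. src th x - (if in_pair a x then src th x else 0))"
      by (intro sum.cong) (auto simp: h_def)
    also have "\<dots> = 1 - (\<Sum>x\<in>alph. if in_pair a x then src th x else 0)" by (simp add: sum_subtractf src_sum)
    also have "(\<Sum>x\<in>alph. if in_pair a x then src th x else 0) = (\<Sum>x\<in>{b + 2 * a + 1, b + 2 * a + 2}. src th x)"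
      using a by (intro sum.mono_neutral_cong_right) (auto simp: alph_def in_pair_def)
    also have "\<dots> = q" using a jb by (auto simp: src_def)
    finally show ?thesis .
  qed
  have "wsum (src th) alph n (\<lambda>xs. real (card (seen xs)))
      = (\<Sum>a<K. wsum (src th) alph n (\<lambda>xs. 1) + (- 1) * wsum (src th) alph n (\<lambda>xs. prod_list (map (h a) xs)))"
    unfolding card wsum_sum wsum_add wsum_cmult ..
  also have "\<dots> = (\<Sum>a<K. 1 - (1 - q) ^ n)"
    unfolding one wsum_prod[OF fin] by (intro sum.cong) (auto simp: ph)
  finally show ?thesis by simp
qed

text \<open>\<open>log 2 (P / Q)\<close> splits into the number of seen bits plus
  \<open>log 2 (mix / Q)\<close>. The latter is replaced by a lower bound linear in Q, so that
  averaging over the cube involves only the total mass of Q.\<close>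

lemma KL_src:
  assumes th: "th \<subseteq> {..<K}" and Q: "\<And>xs. xs \<in> seqs n \<Longrightarrow> 0 \<le> Q xs"
  shows "ereal (\<Sum>xs\<in>words alph n. src_n (src th) xs * (real (card (seen xs)) + (1 - Q xs / mix n xs) / ln 2))
    \<le> KL (src_n (src th)) Q (seqs n)"
proof -
  let ?P = "src_n (src th)"
  define S where "S = {xs\<in>seqs n. 0 < ?P xs}"
  have W: "words alph n \<subseteq> seqs n" by (rule words_subset_seqs) (auto simp: alph_def)
  have SW: "S \<subseteq> words alph n"
  proof
    fix xs assume xs: "xs \<in> S"
    have "x \<in> alph" if "x \<in> set xs" for x
    proof (rule ccontr)
      assume "x \<notin> alph"
      then have "src th x = 0" by (rule src_outside)
      then have "?P xs = 0" using that src_n_zero by blast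
      with xs show False by (simp add: S_def)
    qed
    with xs show "xs \<in> words alph n" by (auto simp: S_def words_def seqs_def)
  qed
  have finW: "finite (words alph n)" by (rule finite_words) (simp add: alph_def)
  then have finS: "finite S" using SW finite_subset by blast
  show ?thesis
  proof (cases "\<exists>xs\<in>S. Q xs \<le> 0")
    case True then show ?thesis by (simp add: KL_def S_def)
  next
    case False
    have KL: "KL ?P Q (seqs n) = ereal (\<Sum>xs\<in>S. ?P xs * log 2 (?P xs / Q xs))"
      using False finS unfolding KL_def Let_def S_def[symmetric] by (simp add: summable_on_finite)
    have "(\<Sum>xs\<in>words alph n. ?P xs * (real (card (seen xs)) + (1 - Q xs / mix n xs) / ln 2))
        = (\<Sum>xs\<in>S. ?P xs * (real (card (seen xs)) + (1 - Q xs / mix n xs) / ln 2))"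
      using finW SW W src_n_nonneg by (intro sum.mono_neutral_right) (auto simp: S_def less_le)
    also have "\<dots> \<le> (\<Sum>xs\<in>S. ?P xs * log 2 (?P xs / Q xs))"
    proof (intro sum_mono mult_left_mono src_n_nonneg)
      fix xs assume xs: "xs \<in> S"
      then have P: "0 < ?P xs" by (simp add: S_def)
      have Qp: "0 < Q xs" using False xs by force
      define c where "c = card (seen xs)"
      have Pm: "?P xs = 2 ^ c * mix n xs" unfolding c_def using th P by (rule mix_eq)
      then have m: "0 < mix n xs" using P by (simp add: zero_less_mult_iff)
      have "ln (Q xs / mix n xs) \<le> Q xs / mix n xs - 1" using m Qp by (intro ln_le_minus_one) auto
      then have "1 - Q xs / mix n xs \<le> ln (mix n xs / Q xs)" using m Qp by (simp add: ln_div)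
      then have "(1 - Q xs / mix n xs) / ln 2 \<le> log 2 (mix n xs / Q xs)"
        by (simp add: log_def divide_right_mono)
      moreover have "log 2 (?P xs / Q xs) = real c + log 2 (mix n xs / Q xs)"
      proof -
        have "?P xs / Q xs = 2 ^ c * (mix n xs / Q xs)" by (simp add: Pm)
        moreover have "0 < mix n xs / Q xs" using m Qp by simp
        ultimately show ?thesis by (simp only: log_def ln_mult_pos zero_less_power zero_less_numeral) (simp add: ln_realpow add_divide_distrib)
      qed
      ultimately show "real (card (seen xs)) + (1 - Q xs / mix n xs) / ln 2 \<le> log 2 (?P xs / Q xs)"
        by (simp add: c_def)
    qed
    finally show ?thesis unfolding KL by simp
  qed
qed

text \<open>The mutual information enters through plain averaging: over the cube, the correction
  terms have nonnegative mean because Q has mass at most 1 on the words, so for some source the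
  divergence reaches the expected number of seen bits.\<close>

theorem minimax_redundancy_lower: "ereal (real K * (1 - (1 - q) ^ n)) \<le> minimax_redundancy f n"
  unfolding minimax_redundancy_def
proof (rule INF_greatest)
  fix Q assume Qc: "Q \<in> coding_probs n"
  then have Q0: "\<And>xs. xs \<in> seqs n \<Longrightarrow> 0 \<le> Q xs" and Q1: "(Q has_sum 1) (seqs n)"
    by (auto simp: coding_probs_def)
  let ?W = "words alph n" and ?Th = "Pow {..<K}"
  let ?D = "\<lambda>th. \<Sum>xs\<in>?W. src_n (src th) xs * (real (card (seen xs)) + (1 - Q xs / mix n xs) / ln 2)"
  have finW: "finite ?W" by (rule finite_words) (simp add: alph_def)
  have W: "?W \<subseteq> seqs n" by (rule words_subset_seqs) (auto simp: alph_def)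
  have QW: "(\<Sum>xs\<in>?W. Q xs) \<le> 1"
    using finite_sum_le_infsum[of Q "seqs n" ?W] finW W Q0 Q1 by (auto simp: has_sum_imp_summable infsumI)
  have D: "?D th = real K * (1 - (1 - q) ^ n) + (1 - (\<Sum>xs\<in>?W. src_n (src th) xs * (Q xs / mix n xs))) / ln 2"
    if "th \<in> ?Th" for th
  proof -
    have one: "(\<Sum>xs\<in>?W. src_n (src th) xs) = 1"
      using wsum_prod[of alph "src th" n "\<lambda>_. 1"] by (simp add: alph_def[symmetric] src_sum map_replicate_const wsum_def) (simp add: alph_def)
    have "?D th = wsum (src th) alph n (\<lambda>xs. real (card (seen xs)))
       + ((\<Sum>xs\<in>?W. src_n (src th) xs) - (\<Sum>xs\<in>?W. src_n (src th) xs * (Q xs / mix n xs))) / ln 2"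
      unfolding wsum_def
      by (simp add: distrib_left sum.distrib right_diff_distrib sum_subtractf diff_divide_distrib sum_divide_distrib)
    then show ?thesis using wsum_seen[of th n] that one by simp
  qed
  have "(\<Sum>th\<in>?Th. \<Sum>xs\<in>?W. src_n (src th) xs * (Q xs / mix n xs)) = (\<Sum>xs\<in>?W. \<Sum>th\<in>?Th. src_n (src th) xs * (Q xs / mix n xs))"
    by (rule sum.swap)
  also have "\<dots> = (\<Sum>xs\<in>?W. 2 ^ K * mix n xs * (Q xs / mix n xs))"
    by (intro sum.cong refl, simp only: sum_distrib_right[symmetric]) (simp add: mix_def)
  \<comment> \<open>Only an inequality: where \<open>mix n xs = 0\<close> the quotient is 0 by
    convention, while \<open>Q xs\<close> may be positive.\<close>
  also have "\<dots> \<le> (\<Sum>xs\<in>?W. 2 ^ K * Q xs)"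
    using Q0 W by (intro sum_mono) (auto simp: field_simps)
  also have "\<dots> \<le> 2 ^ K" using QW by (simp add: sum_distrib_left[symmetric])
  finally have le: "(\<Sum>th\<in>?Th. \<Sum>xs\<in>?W. src_n (src th) xs * (Q xs / mix n xs)) \<le> 2 ^ K" .
  have "2 ^ K * (real K * (1 - (1 - q) ^ n)) \<le> 2 ^ K * (real K * (1 - (1 - q) ^ n))
      + (2 ^ K - (\<Sum>th\<in>?Th. \<Sum>xs\<in>?W. src_n (src th) xs * (Q xs / mix n xs))) / ln 2"
    using le by simp
  also have "\<dots> = (\<Sum>th\<in>?Th. ?D th)"
    by (simp add: D sum.distrib sum_subtractf sum_divide_distrib[symmetric] card_Pow)
  finally have avg: "(\<Sum>th\<in>?Th. real K * (1 - (1 - q) ^ n)) \<le> (\<Sum>th\<in>?Th. ?D th)" by (simp add: card_Pow)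
  have "\<exists>th\<in>?Th. real K * (1 - (1 - q) ^ n) \<le> ?D th"
  proof (rule ccontr)
    assume "\<not> (\<exists>th\<in>?Th. real K * (1 - (1 - q) ^ n) \<le> ?D th)"
    then have "?D th < real K * (1 - (1 - q) ^ n)" if "th \<in> ?Th" for th using that by (meson not_le)
    then have "(\<Sum>th\<in>?Th. ?D th) < (\<Sum>th\<in>?Th. real K * (1 - (1 - q) ^ n))"
      by (rule sum_strict_mono[rotated 2]) auto
    with avg show False by linarith
  qed
  then obtain th where th: "th \<in> ?Th" "real K * (1 - (1 - q) ^ n) \<le> ?D th" by blast
  have "ereal (real K * (1 - (1 - q) ^ n)) \<le> ereal (?D th)" using th by simp
  also have "\<dots> \<le> KL (src_n (src th)) Q (seqs n)" using th Q0 by (intro KL_src) auto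
  also have "\<dots> \<le> redundancy f n Q" unfolding redundancy_def by (intro SUP_upper src_env_class)
  finally show "ereal (real K * (1 - (1 - q) ^ n)) \<le> redundancy f n Q" .
qed

end

section \<open>Redundancy of the ETAC code\<close>

lemma sum_prod_etac_step_le:
  assumes A: "finite A" "\<And>x. x \<in> A \<Longrightarrow> 1 \<le> x"
  shows "(\<Sum>xs\<in>words A n. \<Prod>i<length xs. etac_step (take i xs) (xs ! i)) \<le> 1"
proof (induction n)
  case 0
  have "words A 0 = {[]}" by (auto simp: words_def)
  then show ?case by simp
next
  case (Suc n)
  let ?g = "\<lambda>xs. \<Prod>i<length xs. etac_step (take i xs) (xs ! i)"
  have nn: "0 \<le> etac_step ys x" for ys x using etac_pred_pos by (auto simp: etac_step_def less_imp_le)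
  have "(\<Sum>xs\<in>words A (Suc n). ?g xs) = (\<Sum>ys\<in>words A n. \<Sum>x\<in>A. ?g (ys @ [x]))"
    using A(1) by (rule sum_words_Suc)
  also have "\<dots> = (\<Sum>ys\<in>words A n. ?g ys * (\<Sum>x\<in>A. etac_step ys x))"
  proof (intro sum.cong refl)
    fix ys
    have "?g (ys @ [x]) = ?g ys * etac_step ys x" for x
    proof -
      have "(\<Prod>i<length ys. etac_step (take i (ys @ [x])) ((ys @ [x]) ! i)) = ?g ys"
        by (intro prod.cong refl) (simp add: nth_append)
      then show ?thesis by simp
    qed
    then show "(\<Sum>x\<in>A. ?g (ys @ [x])) = ?g ys * (\<Sum>x\<in>A. etac_step ys x)"
      by (simp only: sum_distrib_left)
  qed
  also have "\<dots> \<le> (\<Sum>ys\<in>words A n. ?g ys)"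
    using etac_step_sum[OF A] nn by (intro sum_mono mult_left_le prod_nonneg) auto
  finally show ?case using Suc by linarith
qed

lemma etac_kraft:
  assumes "finite F" "F \<subseteq> seqs n" shows "(\<Sum>xs\<in>F. 2 powr (- real (etac_len xs))) \<le> 1"
proof -
  obtain A where A: "finite A" "\<And>x. x \<in> A \<Longrightarrow> 1 \<le> x" "F \<subseteq> words A n"
    using finite_subset_seqs_words[OF assms] by blast
  have "(\<Sum>xs\<in>F. 2 powr (- real (etac_len xs))) \<le> (\<Sum>xs\<in>words A n. 2 powr (- real (etac_len xs)))"
    using A finite_words[OF A(1)] by (intro sum_mono2) auto
  also have "\<dots> \<le> (\<Sum>xs\<in>words A n. \<Prod>i<length xs. etac_step (take i xs) (xs ! i))"
    by (intro sum_mono two_powr_etac_len_le)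
  also have "\<dots> \<le> 1" using A by (intro sum_prod_etac_step_le)
  finally show ?thesis .
qed

text \<open>The Kraft inequality makes the normalising constant at most 1, so normalisation never
  lowers the weight of a word.\<close>

lemma etac_Q_coding:
  "etac_Q n \<in> coding_probs n"
  "xs \<in> seqs n \<Longrightarrow> 2 powr (- real (etac_len xs)) \<le> etac_Q n xs"
proof -
  let ?g = "\<lambda>xs. 2 powr (- real (etac_len xs))"
  define S where "S = (\<Sum>\<^sub>\<infinity>ys\<in>seqs n. ?g ys)"
  have summ: "?g summable_on seqs n"
    by (rule nonneg_bdd_above_summable_on) (auto intro!: bdd_aboveI[of _ 1] etac_kraft)
  have S1: "S \<le> 1" unfolding S_def using summ etac_kraft by (intro infsum_le_finite_sums) auto
  have ne: "replicate n 1 \<in> seqs n" by (auto simp: seqs_def)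
  have S0: "0 < S"
  proof -
    have "?g (replicate n 1) = (\<Sum>xs\<in>{replicate n 1}. ?g xs)" by simp
    also have "\<dots> \<le> S" unfolding S_def using ne summ by (intro finite_sum_le_infsum) auto
    finally show ?thesis by (smt (verit) powr_gt_zero)
  qed
  have Q: "etac_Q n xs = ?g xs / S" if "xs \<in> seqs n" for xs using that by (simp add: etac_Q_def S_def)
  have "(?g has_sum S) (seqs n)" unfolding S_def by (rule has_sum_infsum[OF summ])
  then have "((\<lambda>xs. ?g xs * (1 / S)) has_sum S * (1 / S)) (seqs n)" by (rule has_sum_cmult_left)
  then have "(etac_Q n has_sum 1) (seqs n)" using S0 Q by (subst has_sum_cong[where g = "\<lambda>xs. ?g xs * (1 / S)"]) auto
  then show "etac_Q n \<in> coding_probs n" using S0 Q by (auto simp: coding_probs_def)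
  assume "xs \<in> seqs n"
  then show "?g xs \<le> etac_Q n xs" using S0 S1 by (simp add: Q pos_le_divide_eq mult_left_le)
qed

lemma summable_on_diff_real:
  fixes g h :: "'a \<Rightarrow> real"
  assumes "g summable_on X" "h summable_on X" shows "(\<lambda>x. g x - h x) summable_on X"
  using summable_on_add[OF assms(1) summable_on_cmult_right[OF assms(2), of "- 1"]] by simp

text \<open>\<open>KL\<close> is finite only for a summable series, but the log ratios have no sign.
  Adding \<open>(Q - P) / ln 2\<close> makes the terms nonnegative, so bounded finite sums give
  summability; the added series is itself summable and is removed again.\<close>

lemma KL_le:
  fixes P Q B :: "'a \<Rightarrow> real"
  assumes P: "\<And>x. x \<in> X \<Longrightarrow> 0 \<le> P x" "\<And>F. finite F \<Longrightarrow> F \<subseteq> X \<Longrightarrow> (\<Sum>x\<in>F. P x) \<le> 1"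
    and Q: "\<And>x. x \<in> X \<Longrightarrow> 0 < Q x" "(Q has_sum 1) X"
    and B: "\<And>x. x \<in> X \<Longrightarrow> 0 < P x \<Longrightarrow> log 2 (P x / Q x) \<le> B x"
    and R: "\<And>F. finite F \<Longrightarrow> F \<subseteq> X \<Longrightarrow> (\<Sum>x\<in>F. P x * B x) \<le> R"
  shows "KL P Q X \<le> ereal R"
proof -
  define S where "S = {x\<in>X. 0 < P x}"
  have SX: "S \<subseteq> X" by (auto simp: S_def)
  let ?g = "\<lambda>x. P x * log 2 (P x / Q x)"
  have QS: "Q summable_on S" using summable_on_subset_banach[OF has_sum_imp_summable[OF Q(2)] SX] .
  have PS: "P summable_on S"
    using P SX by (intro nonneg_bdd_above_summable_on bdd_aboveI[of _ 1]) auto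
  have gB: "(\<Sum>x\<in>F. ?g x) \<le> R" if F: "finite F" "F \<subseteq> S" for F
  proof -
    have "(\<Sum>x\<in>F. ?g x) \<le> (\<Sum>x\<in>F. P x * B x)"
      using F by (intro sum_mono mult_left_mono B) (auto simp: S_def)
    also have "\<dots> \<le> R" using F SX by (intro R) auto
    finally show ?thesis .
  qed
  have low: "0 \<le> ?g x + (Q x - P x) / ln 2" if x: "x \<in> S" for x
  proof -
    have p: "0 < P x" "0 < Q x" using x Q(1) by (auto simp: S_def)
    have "ln (Q x / P x) \<le> Q x / P x - 1" using p by (intro ln_le_minus_one) auto
    then have "1 - Q x / P x \<le> ln (P x / Q x)" using p by (simp add: ln_div)
    then have "P x * (1 - Q x / P x) \<le> P x * ln (P x / Q x)" using p by (intro mult_left_mono) auto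
    then have "(P x - Q x) / ln 2 \<le> P x * ln (P x / Q x) / ln 2"
      using p by (intro divide_right_mono) (auto simp: right_diff_distrib)
    then show ?thesis by (simp add: log_def diff_divide_distrib)
  qed
  have "(\<lambda>x. ?g x + (Q x - P x) / ln 2) summable_on S"
  proof (rule nonneg_bdd_above_summable_on[OF low])
    show "bdd_above (sum (\<lambda>x. ?g x + (Q x - P x) / ln 2) ` {F. F \<subseteq> S \<and> finite F})"
    proof (rule bdd_aboveI2[of _ _ "R + 1 / ln 2"])
      fix F assume "F \<in> {F. F \<subseteq> S \<and> finite F}"
      then have F: "finite F" "F \<subseteq> S" by auto
      have "(\<Sum>x\<in>F. Q x) \<le> infsum Q X"
        using F SX Q by (intro finite_sum_le_infsum) (auto simp: has_sum_imp_summable less_imp_le)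
      also have "\<dots> = 1" using Q(2) by (rule infsumI)
      finally have q: "(\<Sum>x\<in>F. Q x) \<le> 1" .
      have p: "0 \<le> (\<Sum>x\<in>F. P x)" using F by (intro sum_nonneg) (auto simp: S_def)
      have "(\<Sum>x\<in>F. ?g x + (Q x - P x) / ln 2) = (\<Sum>x\<in>F. ?g x) + ((\<Sum>x\<in>F. Q x) - (\<Sum>x\<in>F. P x)) / ln 2"
        by (simp add: sum.distrib sum_subtractf sum_divide_distrib[symmetric])
      also have "\<dots> \<le> R + 1 / ln 2" using gB[OF F] p q by (intro add_mono divide_right_mono) auto
      finally show "(\<Sum>x\<in>F. ?g x + (Q x - P x) / ln 2) \<le> R + 1 / ln 2" .
    qed
  qed
  moreover have "(\<lambda>x. (1 / ln 2) * (Q x - P x)) summable_on S"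
    using QS PS by (intro summable_on_cmult_right summable_on_diff_real)
  ultimately have "(\<lambda>x. (?g x + (Q x - P x) / ln 2) - (1 / ln 2) * (Q x - P x)) summable_on S"
    by (rule summable_on_diff_real)
  then have gs: "?g summable_on S" by simp
  have ex: "\<not> (\<exists>x\<in>S. Q x \<le> 0)" using Q(1) SX by (meson not_le subsetD)
  have "KL P Q X = ereal (\<Sum>\<^sub>\<infinity>x\<in>S. ?g x)"
    unfolding KL_def Let_def S_def[symmetric] using gs ex by simp
  also have "\<dots> \<le> ereal R" using gs gB by (simp add: infsum_le_finite_sums)
  finally show ?thesis .
qed

lemma etac_len_le:
  "real (etac_len xs) \<le> 2 - log 2 (etac_arith_prob xs)
     + (\<Sum>i<length xs. if etac_censored xs i then real (elias_len (xs ! i - etac_M (take i xs) + 1)) else 0)"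
proof -
  have "0 \<le> - log 2 (etac_arith_prob xs)" using etac_arith_prob_bounds[of xs] by simp
  then have "real (nat \<lceil>- log 2 (etac_arith_prob xs)\<rceil>) \<le> - log 2 (etac_arith_prob xs) + 1" by linarith
  moreover have "(\<Sum>i\<in>{i. i < length xs \<and> etac_censored xs i}. real (elias_len (xs ! i - etac_M (take i xs) + 1)))
     = (\<Sum>i<length xs. if etac_censored xs i then real (elias_len (xs ! i - etac_M (take i xs) + 1)) else 0)"
    by (rule sum.mono_neutral_cong_left) auto
  ultimately show ?thesis unfolding etac_len_def by simp
qed

text \<open>Stated for every k: at small k the envelope sum may exceed 1 while \<open>Tb\<close> is
  at most 1, and the minimum covers this case.\<close>

locale etac_envelope = regvar_envelope +
  assumes f_tail: "\<And>k B. finite B \<Longrightarrow> (\<And>x. x \<in> B \<Longrightarrow> k < x) \<Longrightarrow> min 1 (\<Sum>x\<in>B. f x) \<le> Tb (real k)"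
begin

text \<open>The bits charged to a censored x besides \<open>log 2 n\<close>: 1 for the numerator
  \<open>1/2\<close> of the escape symbol, \<open>log 2 (f x)\<close> bounding
  \<open>log 2 (p x)\<close>, and \<open>x + 1\<close> bounding every Elias argument
  \<open>x - etac_M ys + 1\<close>.\<close>

definition v :: "nat \<Rightarrow> real" where "v x = 1 + log 2 (f x) + real (elias_len (x + 1))"

text \<open>The cutoff at 0 keeps \<open>step_cost\<close> nonnegative, as
  \<open>wsum_prefix_sum\<close> requires.\<close>

definition w :: "nat \<Rightarrow> nat \<Rightarrow> real" where "w n x = max 0 (log 2 (real n) + v x)"

definition step_cost :: "nat \<Rightarrow> nat list \<Rightarrow> nat \<Rightarrow> real" where
  "step_cost n ys x = real (etac_M ys) / real (length ys) / ln 2 + (if etac_M ys < x then w n x else 0)"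

definition total_cost :: "nat \<Rightarrow> nat list \<Rightarrow> real" where
  "total_cost n xs = 1 / ln 2 + 3 + log 2 (2 * real n + 1) + (\<Sum>i<n. step_cost n (take i xs) (xs ! i))"

lemma env_class_subpmf:
  assumes p: "p \<in> env_class f" and A: "finite A" "\<And>x. x \<in> A \<Longrightarrow> 1 \<le> x"
  shows "subpmf p A"
proof
  show "finite A" by (rule A)
  show "0 \<le> p x" for x using p by (simp add: env_class_def)
  have h: "(p has_sum 1) {1..}" using p by (simp add: env_class_def)
  have "(\<Sum>x\<in>A. p x) \<le> infsum p {1..}"
    using A h p by (intro finite_sum_le_infsum) (auto simp: has_sum_imp_summable env_class_def)
  also have "\<dots> = 1" using h by (rule infsumI)
  finally show "(\<Sum>x\<in>A. p x) \<le> 1" .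
qed

lemma log_ratio_le:
  assumes p: "p \<in> env_class f" and n: "1 \<le> n" and xs: "xs \<in> seqs n" and pos: "0 < src_n p xs"
  shows "log 2 (src_n p xs / etac_Q n xs) \<le> total_cost n xs"
proof -
  have len: "n = length xs" and x1: "\<And>x. x \<in> set xs \<Longrightarrow> 1 \<le> x" using xs by (auto simp: seqs_def)
  interpret subpmf p "set xs" using p x1 by (intro env_class_subpmf) auto
  have ppos: "0 < p x" if "x \<in> set xs" for x using src_n_zero[OF that, of p] nonneg[of x] pos by force
  have Q: "2 powr (- real (etac_len xs)) \<le> etac_Q n xs" using xs by (rule etac_Q_coding)
  then have Qp: "0 < etac_Q n xs" by (smt (verit) powr_gt_zero)
  have "log 2 (2 powr (- real (etac_len xs))) \<le> log 2 (etac_Q n xs)" using Q by (intro log_mono) auto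
  then have lQ: "- real (etac_len xs) \<le> log 2 (etac_Q n xs)" by simp
  let ?cens = "etac_censored xs"
  let ?E = "\<Sum>i<n. if ?cens i then real (elias_len (xs ! i - etac_M (take i xs) + 1)) else 0"
  have "log 2 (src_n p xs / etac_Q n xs) = log 2 (src_n p xs) - log 2 (etac_Q n xs)"
    using pos Qp by (simp add: log_divide)
  also have "\<dots> \<le> log 2 (src_n p xs) + (2 - log 2 (etac_arith_prob xs) + ?E)"
    using lQ etac_len_le[of xs] len by simp
  also have "\<dots> = (ln (src_n p xs) - ln (etac_arith_prob xs)) / ln 2 + 2 + ?E"
    by (simp add: log_def diff_divide_distrib)
  also have "(ln (src_n p xs) - ln (etac_arith_prob xs)) / ln 2 \<le> (1 + ln 2 + ln (2 * real n + 1)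
      + (\<Sum>i<n. real (etac_M (take i xs)) / real i)
      + (\<Sum>i<n. if ?cens i then ln (real n) + ln 2 + ln (p (xs ! i)) else 0)) / ln 2"
    using etac_arith_prob_bound[OF len n x1 nonneg mass ppos] by (intro divide_right_mono) auto
  also have "\<dots> = 1 / ln 2 + 1 + log 2 (2 * real n + 1) + (\<Sum>i<n. real (etac_M (take i xs)) / real i / ln 2)
      + (\<Sum>i<n. if ?cens i then log 2 (real n) + 1 + log 2 (p (xs ! i)) else 0)"
  proof -
    have "(\<Sum>i<n. if ?cens i then ln (real n) + ln 2 + ln (p (xs ! i)) else 0) / ln 2
       = (\<Sum>i<n. if ?cens i then log 2 (real n) + 1 + log 2 (p (xs ! i)) else 0)"
      unfolding sum_divide_distrib by (intro sum.cong refl) (simp add: log_def add_divide_distrib)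
    then show ?thesis by (simp add: add_divide_distrib sum_divide_distrib log_def)
  qed
  also have "1 / ln 2 + 1 + log 2 (2 * real n + 1) + (\<Sum>i<n. real (etac_M (take i xs)) / real i / ln 2)
      + (\<Sum>i<n. if ?cens i then log 2 (real n) + 1 + log 2 (p (xs ! i)) else 0) + 2 + ?E
    = 1 / ln 2 + 3 + log 2 (2 * real n + 1) + (\<Sum>i<n. real (etac_M (take i xs)) / real i / ln 2
      + (if ?cens i then log 2 (real n) + 1 + log 2 (p (xs ! i)) + real (elias_len (xs ! i - etac_M (take i xs) + 1)) else 0))"
  proof -
    have "(\<Sum>i<n. if ?cens i then log 2 (real n) + 1 + log 2 (p (xs ! i)) + real (elias_len (xs ! i - etac_M (take i xs) + 1)) else 0)
      = (\<Sum>i<n. if ?cens i then log 2 (real n) + 1 + log 2 (p (xs ! i)) else 0) + ?E"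
      unfolding sum.distrib[symmetric] by (intro sum.cong refl) simp
    then show ?thesis unfolding sum.distrib by linarith
  qed
  also have "\<dots> \<le> total_cost n xs" unfolding total_cost_def
  proof (intro add_left_mono sum_mono)
    fix i assume i: "i \<in> {..<n}"
    then have il: "length (take i xs) = i" using len by simp
    have xi: "xs ! i \<in> set xs" using i len by simp
    have 1: "log 2 (p (xs ! i)) \<le> log 2 (f (xs ! i))"
      using p ppos[OF xi] x1[OF xi] by (intro log_mono) (auto simp: env_class_def)
    have 2: "real (elias_len (xs ! i - etac_M (take i xs) + 1)) \<le> real (elias_len (xs ! i + 1))"
      by (intro of_nat_mono elias_len_mono) auto
    show "real (etac_M (take i xs)) / real i / ln 2
      + (if ?cens i then log 2 (real n) + 1 + log 2 (p (xs ! i)) + real (elias_len (xs ! i - etac_M (take i xs) + 1)) else 0)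
      \<le> step_cost n (take i xs) (xs ! i)"
      unfolding step_cost_def il etac_censored_def w_def v_def using 1 2 by auto
  qed
  finally show ?thesis by simp
qed

lemma step_cost_nonneg: "0 \<le> step_cost n ys x"
  unfolding step_cost_def w_def by (intro add_nonneg_nonneg divide_nonneg_nonneg) auto

text \<open>A censored \<open>x \<le> y\<close> forces \<open>etac_M ys < y\<close>, so the
  expensive rate W meets only the small-M censoring mass, while the rate R beyond y meets the full
  one.\<close>

lemma expected_total_cost:
  assumes p: "p \<in> env_class f" and A: "finite A" "\<And>x. x \<in> A \<Longrightarrow> 1 \<le> x"
    and n: "1 \<le> n" and y: "\<And>x. 1 \<le> x \<Longrightarrow> w n x \<le> W" "\<And>x. y < x \<Longrightarrow> w n x \<le> R" and WR: "0 \<le> W" "0 \<le> R"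
  shows "wsum p A n (total_cost n) \<le> 1 / ln 2 + 3 + log 2 (2 * real n + 1)
    + (2 * (\<Sum>i\<in>{1..<n}. m i / real i) + 2 * (\<Sum>i\<in>{1..<n}. 1 / real i)) / ln 2
    + W * (1 + (2 * real y + etac_const) * (\<Sum>i\<in>{1..<n}. 1 / real i))
    + R * (1 + 2 * (\<Sum>i\<in>{1..<n}. m i / real i) + (2 + etac_const) * (\<Sum>i\<in>{1..<n}. 1 / real i))"
proof -
  interpret subpmf p A using p A by (rule env_class_subpmf)
  have tailTb: "tail k \<le> Tb (real k)" for k
  proof -
    have "tail k \<le> (\<Sum>x\<in>{x\<in>A. k < x}. f x)" unfolding tail_def using p A by (intro sum_mono) (auto simp: env_class_def)
    then have "tail k \<le> min 1 (\<Sum>x\<in>{x\<in>A. k < x}. f x)" using tail_le_1[of k] by simp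
    also have "\<dots> \<le> Tb (real k)" using A by (intro f_tail) auto
    finally show ?thesis .
  qed
  \<comment> \<open>The threshold of the prefix length i, rounded up because tails are evaluated at
    naturals.\<close>
  define y' where "y' i = nat \<lceil>m i\<rceil>" for i
  have y'1: "real (y' i) \<le> m i + 1" "m i \<le> real (y' i)" if "1 \<le> i" for i
    using m_pos[OF that] unfolding y'_def by linarith+
  have y't: "real i * tail (y' i) \<le> m i" if i: "1 \<le> i" for i
  proof -
    have "tail (y' i) \<le> Tb (m i)" using tailTb[of "y' i"] Tb_anti[OF y'1(2)[OF i]] by linarith
    then have "real i * tail (y' i) \<le> real i * Tb (m i)" by (intro mult_left_mono) auto
    then show ?thesis using thr(2)[of "real i"] i by (simp add: m_def)
  qed
  let ?s = "\<lambda>i. wsum p A i (\<lambda>ys. \<Sum>x\<in>A. p x * step_cost n ys x)"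
  have inner: "(\<Sum>x\<in>A. p x * step_cost n ys x) \<le> 1 / (real i * ln 2) * real (etac_M ys)
      + (W * (if etac_M ys < y then tail (etac_M ys) else 0) + R * tail (etac_M ys))" if "ys \<in> words A i" for i ys
  proof -
    let ?M = "etac_M ys"
    have l: "length ys = i" using that by (simp add: words_def)
    have "(\<Sum>x\<in>A. p x * step_cost n ys x)
       \<le> (\<Sum>x\<in>A. p x * (1 / (real i * ln 2) * real ?M) + (W * (p x * (if ?M < x then if ?M < y then 1 else 0 else 0)) + R * (p x * (if ?M < x then 1 else 0))))"
    proof (rule sum_mono)
      fix x assume x: "x \<in> A"
      have "(if ?M < x then w n x else 0) \<le> W * (if ?M < x then if ?M < y then 1 else 0 else 0) + R * (if ?M < x then 1 else 0)"
      proof (cases "?M < x")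
        case True
        then show ?thesis using y(1)[of x] y(2)[of x] A(2)[OF x] WR by (cases "y < x") auto
      qed simp
      then have "step_cost n ys x \<le> 1 / (real i * ln 2) * real ?M + (W * (if ?M < x then if ?M < y then 1 else 0 else 0) + R * (if ?M < x then 1 else 0))"
        unfolding step_cost_def l by simp
      then have "p x * step_cost n ys x \<le> p x * (1 / (real i * ln 2) * real ?M + (W * (if ?M < x then if ?M < y then 1 else 0 else 0) + R * (if ?M < x then 1 else 0)))"
        using nonneg by (intro mult_left_mono)
      then show "p x * step_cost n ys x \<le> p x * (1 / (real i * ln 2) * real ?M) + (W * (p x * (if ?M < x then if ?M < y then 1 else 0 else 0)) + R * (p x * (if ?M < x then 1 else 0)))"
        by (simp only: distrib_left mult.left_commute)
    qed
    also have "\<dots> = (\<Sum>x\<in>A. p x) * (1 / (real i * ln 2) * real ?M)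
      + (W * ((if ?M < y then 1 else 0) * tail ?M) + R * (1 * tail ?M))"
      unfolding tail_if[symmetric] by (simp only: sum.distrib sum_distrib_left sum_distrib_right)
    also have "\<dots> \<le> 1 * (1 / (real i * ln 2) * real ?M)
      + (W * ((if ?M < y then 1 else 0) * tail ?M) + R * (1 * tail ?M))"
      using mass by (intro add_right_mono mult_right_mono) auto
    also have "\<dots> = 1 / (real i * ln 2) * real ?M
      + (W * (if ?M < y then tail ?M else 0) + R * tail ?M)" by simp
    finally show ?thesis .
  qed
  \<comment> \<open>Since \<open>etac_M [] = 0\<close>, the first symbol counts as censored; it is
    charged at most \<open>W + R\<close>.\<close>
  have s0: "?s 0 \<le> W + R"
  proof -
    have "words A 0 = {[]}" by (auto simp: words_def)
    then have "?s 0 \<le> W * (if etac_M [] < y then tail (etac_M []) else 0) + R * tail (etac_M [])"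
      using inner[of "[]" 0] by simp
    also have "\<dots> \<le> W * 1 + R * 1"
      using tail_le_1 WR by (intro add_mono mult_left_mono) auto
    finally show ?thesis by simp
  qed
  have si: "?s i \<le> (2 * m i + 2) / real i / ln 2 + W * ((2 * real y + etac_const) * (1 / real i))
       + R * (2 * (m i / real i) + (2 + etac_const) * (1 / real i))" if i: "1 \<le> i" for i
  proof -
    have "?s i \<le> wsum p A i (\<lambda>ys. 1 / (real i * ln 2) * real (etac_M ys)
      + (W * (if etac_M ys < y then tail (etac_M ys) else 0) + R * tail (etac_M ys)))"
      by (rule wsum_mono[OF inner])
    also have "\<dots> = 1 / (real i * ln 2) * wsum p A i (\<lambda>ys. real (etac_M ys))
      + (W * wsum p A i (\<lambda>ys. if etac_M ys < y then tail (etac_M ys) else 0) + R * wsum p A i (\<lambda>ys. tail (etac_M ys)))"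
      unfolding wsum_add wsum_cmult ..
    also have "\<dots> \<le> 1 / (real i * ln 2) * (2 * m i + 2)
      + (W * ((2 * real y + etac_const) / real i) + R * ((2 * m i + 2 + etac_const) / real i))"
    proof (intro add_mono mult_left_mono WR)
      show "wsum p A i (\<lambda>ys. real (etac_M ys)) \<le> 2 * m i + 2"
        using wsum_etac_M[OF y't[OF i]] y'1[OF i] by linarith
      show "wsum p A i (\<lambda>ys. if etac_M ys < y then tail (etac_M ys) else 0) \<le> (2 * real y + etac_const) / real i"
        using i by (rule wsum_tail_small_M)
      have "real i * tail (y' i) \<le> real (y' i)" using y't[OF i] y'1[OF i] by linarith
      then have "wsum p A i (\<lambda>ys. tail (etac_M ys)) \<le> (2 * real (y' i) + etac_const) / real i"
        using i by (intro wsum_tail_M)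
      also have "\<dots> \<le> (2 * m i + 2 + etac_const) / real i" using y'1[OF i] by (intro divide_right_mono) auto
      finally show "wsum p A i (\<lambda>ys. tail (etac_M ys)) \<le> (2 * m i + 2 + etac_const) / real i" .
    qed auto
    also have "\<dots> = (2 * m i + 2) / real i / ln 2 + W * ((2 * real y + etac_const) * (1 / real i))
       + R * (2 * (m i / real i) + (2 + etac_const) * (1 / real i))"
      by (simp add: add_divide_distrib)
    finally show ?thesis .
  qed
  let ?c = "1 / ln 2 + 3 + log 2 (2 * real n + 1)"
  have "wsum p A n (total_cost n) = wsum p A n (\<lambda>xs. ?c) + wsum p A n (\<lambda>xs. \<Sum>i<n. step_cost n (take i xs) (xs ! i))"
    unfolding total_cost_def[abs_def] by (rule wsum_add)
  also have "\<dots> \<le> ?c + (\<Sum>i<n. ?s i)"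
    by (intro add_mono wsum_const wsum_prefix_sum step_cost_nonneg) (auto intro!: add_nonneg_nonneg)
  also have "(\<Sum>i<n. ?s i) = ?s 0 + (\<Sum>i\<in>{1..<n}. ?s i)"
  proof -
    have "{..<n} = insert 0 {1..<n}" using n by auto
    then show ?thesis by simp
  qed
  also have "\<dots> \<le> (W + R) + (\<Sum>i\<in>{1..<n}. (2 * m i + 2) / real i / ln 2 + W * ((2 * real y + etac_const) * (1 / real i))
       + R * (2 * (m i / real i) + (2 + etac_const) * (1 / real i)))"
    by (intro add_mono s0 sum_mono si) auto
  also have "\<dots> = (W + R) + ((2 * (\<Sum>i\<in>{1..<n}. m i / real i) + 2 * (\<Sum>i\<in>{1..<n}. 1 / real i)) / ln 2
      + W * ((2 * real y + etac_const) * (\<Sum>i\<in>{1..<n}. 1 / real i))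
      + R * (2 * (\<Sum>i\<in>{1..<n}. m i / real i) + (2 + etac_const) * (\<Sum>i\<in>{1..<n}. 1 / real i)))"
  proof -
    have "(2 * m i + 2) / real i / ln 2 + W * ((2 * real y + etac_const) * (1 / real i))
       + R * (2 * (m i / real i) + (2 + etac_const) * (1 / real i))
      = (2 / ln 2 + 2 * R) * (m i / real i) + (2 / ln 2 + W * (2 * real y + etac_const) + R * (2 + etac_const)) * (1 / real i)" for i
      by (simp add: algebra_simps add_divide_distrib)
    then have "(\<Sum>i\<in>{1..<n}. (2 * m i + 2) / real i / ln 2 + W * ((2 * real y + etac_const) * (1 / real i))
       + R * (2 * (m i / real i) + (2 + etac_const) * (1 / real i)))
      = (2 / ln 2 + 2 * R) * (\<Sum>i\<in>{1..<n}. m i / real i)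
        + (2 / ln 2 + W * (2 * real y + etac_const) + R * (2 + etac_const)) * (\<Sum>i\<in>{1..<n}. 1 / real i)"
      by (simp only: sum.distrib sum_distrib_left)
    then show ?thesis by (simp add: algebra_simps add_divide_distrib)
  qed
  finally show ?thesis by (simp add: algebra_simps)
qed

lemma redundancy_etac_le:
  assumes n: "1 \<le> n" and y: "\<And>x. 1 \<le> x \<Longrightarrow> w n x \<le> W" "\<And>x. y < x \<Longrightarrow> w n x \<le> R" and WR: "0 \<le> W" "0 \<le> R"
  shows "redundancy f n (etac_Q n) \<le> ereal (1 / ln 2 + 3 + log 2 (2 * real n + 1)
    + (2 * (\<Sum>i\<in>{1..<n}. m i / real i) + 2 * (\<Sum>i\<in>{1..<n}. 1 / real i)) / ln 2
    + W * (1 + (2 * real y + etac_const) * (\<Sum>i\<in>{1..<n}. 1 / real i))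
    + R * (1 + 2 * (\<Sum>i\<in>{1..<n}. m i / real i) + (2 + etac_const) * (\<Sum>i\<in>{1..<n}. 1 / real i)))"
    (is "_ \<le> ereal ?B")
  unfolding redundancy_def
proof (rule SUP_least)
  fix p assume p: "p \<in> env_class f"
  show "KL (src_n p) (etac_Q n) (seqs n) \<le> ereal ?B"
  proof (rule KL_le[where B = "total_cost n"])
    have p0: "0 \<le> p x" for x using p by (simp add: env_class_def)
    show s0: "0 \<le> src_n p xs" for xs unfolding src_n_def by (induction xs) (simp_all add: p0)
    show "(etac_Q n has_sum 1) (seqs n)" using etac_Q_coding(1)[of n] by (simp add: coding_probs_def)
    show "0 < etac_Q n xs" if "xs \<in> seqs n" for xs
      using etac_Q_coding(2)[OF that] by (smt (verit) powr_gt_zero)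
    show "log 2 (src_n p xs / etac_Q n xs) \<le> total_cost n xs" if "xs \<in> seqs n" "0 < src_n p xs" for xs
      using p n that by (rule log_ratio_le)
    have tc: "0 \<le> total_cost n xs" for xs
      unfolding total_cost_def using step_cost_nonneg by (intro add_nonneg_nonneg sum_nonneg) auto
    fix F assume F: "finite F" "F \<subseteq> seqs n"
    obtain A where A: "finite A" "\<And>x. x \<in> A \<Longrightarrow> 1 \<le> x" "F \<subseteq> words A n"
      using finite_subset_seqs_words[OF F] by blast
    interpret subpmf p A using p A(1,2) by (rule env_class_subpmf)
    have "(\<Sum>x\<in>F. src_n p x) \<le> (\<Sum>x\<in>words A n. src_n p x * 1)"
      using A s0 by (simp add: sum_mono2 finite_words)
    also have "\<dots> \<le> 1" using wsum_const[of 1 n] by (simp add: wsum_def)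
    finally show "(\<Sum>x\<in>F. src_n p x) \<le> 1" .
    have "(\<Sum>x\<in>F. src_n p x * total_cost n x) \<le> wsum p A n (total_cost n)"
      unfolding wsum_def using A s0 tc by (intro sum_mono2 finite_words) auto
    also have "\<dots> \<le> ?B" using p A(1,2) n y WR by (rule expected_total_cost)
    finally show "(\<Sum>x\<in>F. src_n p x * total_cost n x) \<le> ?B" .
  qed
qed

end

section \<open>Asymptotics of the upper bound\<close>

context etac_envelope
begin

text \<open>The leading \<open>log 2 x\<close> of the Elias length cancels against
  \<open>f x\<close>, which decays with exponent \<open>1 + b'\<close>; the gap from b to
  \<open>b'\<close> absorbs the iterated logarithm.\<close>

lemma v_upper:
  assumes b: "b < \<alpha>" shows "\<forall>\<^sub>F x in sequentially. v x \<le> - b * log 2 (real x)"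
proof -
  obtain b' where b': "b < b'" "b' < \<alpha>" using dense[OF b] by auto
  define e where "e = b' - b"
  have e: "0 < e" using b' by (simp add: e_def)
  have 1: "\<forall>\<^sub>F x in sequentially. f x \<le> real x powr (- (1 + b'))" using b' by (intro f_upper) auto
  have 2: "\<forall>\<^sub>F x in sequentially. 2 + (log 2 (real x + 1) + 2 * log 2 (log 2 (real x + 1) + 1)) - log 2 (real x) \<le> e * log 2 (real x)"
    using e by real_asymp
  show ?thesis using 1 2 eventually_ge_at_top[of 1]
  proof eventually_elim
    case (elim x)
    have fx: "0 < f x" using elim by (intro f_pos)
    have "log 2 (f x) \<le> log 2 (real x powr (- (1 + b')))" using elim fx by (intro log_mono) auto
    also have "\<dots> = - (1 + b') * log 2 (real x)" using elim by (simp add: log_powr)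
    finally have "log 2 (f x) \<le> - (1 + b') * log 2 (real x)" .
    moreover have "real (elias_len (x + 1)) \<le> log 2 (real x + 1) + 2 * log 2 (log 2 (real x + 1) + 1) + 1"
      using elias_len_le[of "x + 1"] by (simp add: add.commute)
    moreover have "e * log 2 (real x) = b' * log 2 (real x) - b * log 2 (real x)" by (simp add: e_def left_diff_distrib)
    moreover have "- (1 + b') * log 2 (real x) = - log 2 (real x) - b' * log 2 (real x)" by (simp add: algebra_simps)
    ultimately show ?case using elim(2) unfolding v_def by simp
  qed
qed

text \<open>Shape of the lower-order part of the upper bound after division by
  \<open>m n * L n\<close>, with \<open>1 / L n\<close>, \<open>1 / m n\<close> and
  \<open>L n / m n\<close> for a, b and z.\<close>

lemma cost_remainder_tendsto:
  fixes a b z :: "nat \<Rightarrow> real"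
  assumes "a \<longlonglongrightarrow> 0" "b \<longlonglongrightarrow> 0" "z \<longlonglongrightarrow> 0"
  shows "(\<lambda>n. (c0 * (a n * b n) + b n) + k * (c1 * a n + c2 * (a n * b n) + 2 * b n)
     + (1 + K * a n) * (b n + 2 * a n * a n + 2 * a n + c3 * (b n + z n))
     + th * (c4 * b n + c3 * (b n + z n))) \<longlonglongrightarrow> 0"
  by (rule tendsto_eq_rhs, (rule tendsto_intros assms)+) simp

lemma redundancy_etac_upper:
  "\<forall>\<^sub>F n in sequentially. redundancy f n (etac_Q n) \<le> ereal (5 / 2 * m n * log 2 (real n))"
proof -
  \<comment> \<open>The choice makes \<open>(1 + \<alpha>) * \<theta> \<le> 1 + 3 * (\<eta> *
    \<alpha>) \<le> 102 / 100\<close>. The three units of loss go to the decay exponent of v, the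
    growth exponent of m and the factor \<open>(L n)^2\<close> in the cutoff.\<close>
  define \<eta> where "\<eta> = 1 / (150 * (1 + \<alpha>))"
  have eta: "0 < \<eta>" "\<eta> < 1 / 100" "\<eta> * \<alpha> \<le> 1 / 150"
    using alpha by (auto simp: \<eta>_def field_simps)
  define \<beta> where "\<beta> = \<alpha> * (1 - \<eta>)"
  define r where "r = (1 - \<eta>) / (1 + \<alpha>)"
  define \<delta> where "\<delta> = \<eta> / (1 + \<alpha>)"
  \<comment> \<open>The fraction of \<open>log 2 n\<close> still paid beyond the cutoff, where log x
    is at least \<open>(r - \<delta>) * log n\<close>. Without losses it would be
    \<open>1 / (1 + \<alpha>)\<close>.\<close>
  define \<theta> where "\<theta> = 1 - \<beta> * (r - \<delta>)"
  have be: "0 < \<beta>" "\<beta> < \<alpha>" using alpha eta by (simp_all add: \<beta>_def)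
  have r: "0 < r" "r < 1 / (1 + \<alpha>)" using alpha eta by (simp_all add: r_def divide_strict_right_mono)
  have de: "0 < \<delta>" using alpha eta by (simp add: \<delta>_def)
  have th: "0 \<le> \<theta>" "(1 + \<alpha>) * \<theta> \<le> 102 / 100"
  proof -
    have "(1 + \<alpha>) * \<theta> = 1 + \<alpha> - \<alpha> * ((1 - \<eta>) * (1 - 2 * \<eta>))"
    proof -
      have "(1 + \<alpha>) * (r - \<delta>) = 1 - 2 * \<eta>"
        using alpha by (simp add: r_def \<delta>_def diff_divide_distrib[symmetric])
      moreover have "(1 + \<alpha>) * \<theta> = 1 + \<alpha> - \<beta> * ((1 + \<alpha>) * (r - \<delta>))" by (simp add: \<theta>_def algebra_simps)
      ultimately show ?thesis by (simp add: \<beta>_def mult.assoc)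
    qed
    moreover have "1 - 3 * \<eta> \<le> (1 - \<eta>) * (1 - 2 * \<eta>)" "(1 - \<eta>) * (1 - 2 * \<eta>) \<le> 1 * 1"
      using eta by (simp add: algebra_simps, intro mult_mono) auto
    then have "\<alpha> * (1 - 3 * \<eta>) \<le> \<alpha> * ((1 - \<eta>) * (1 - 2 * \<eta>))" "\<alpha> * ((1 - \<eta>) * (1 - 2 * \<eta>)) \<le> \<alpha> * (1 * 1)"
      using alpha by (intro mult_left_mono; simp)+
    ultimately have "(1 + \<alpha>) * \<theta> \<le> 1 + 3 * (\<eta> * \<alpha>)" "0 < (1 + \<alpha>) * \<theta>"
      by (simp_all add: algebra_simps)
    then show "0 \<le> \<theta>" "(1 + \<alpha>) * \<theta> \<le> 102 / 100" using alpha eta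
      by (simp_all add: zero_less_mult_iff)
  qed
  obtain X where X: "\<And>x. X \<le> x \<Longrightarrow> v x \<le> - \<beta> * log 2 (real x)"
    using v_upper[OF be(2)] by (auto simp: eventually_sequentially)
  define X1 where "X1 = max X 1"
  \<comment> \<open>v is eventually nonpositive, so finitely many values bound it from
    above.\<close>
  define Kc where "Kc = (\<Sum>x<X1. \<bar>v x\<bar>)"
  have Kc0: "0 \<le> Kc" by (simp add: Kc_def sum_nonneg)
  have vK: "v x \<le> Kc" for x
  proof (cases "x < X1")
    case True
    then have "\<bar>v x\<bar> \<le> Kc" unfolding Kc_def by (intro member_le_sum) auto
    then show ?thesis by simp
  next
    case False
    then have "v x \<le> - \<beta> * log 2 (real x)" by (intro X) (simp add: X1_def)
    also have "\<dots> \<le> 0" using be False by (simp add: X1_def)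
    finally show ?thesis using Kc0 by simp
  qed
  obtain D where D: "0 \<le> D" "\<And>n. 1 \<le> n \<Longrightarrow> (\<Sum>i\<in>{1..<n}. m i / real i) \<le> 23/20 * (1 + \<alpha>) * m n + D"
    using sum_m_over_i by blast
  define c where "c = 23/20 * (1 + \<alpha>)"
  define L where "L n = log 2 (real n)" for n :: nat
  define y where "y n = nat \<lceil>m n / (L n)\<^sup>2\<rceil>" for n
  define C where "C = etac_const"
  have C: "0 < C" unfolding C_def by (rule etac_const_pos)
  have a: "(\<lambda>n. 1 / L n) \<longlonglongrightarrow> 0" unfolding L_def by real_asymp
  have b: "(\<lambda>n. 1 / m n) \<longlonglongrightarrow> 0"
    using m_at_top by (intro tendsto_divide_0[OF tendsto_const] filterlim_at_top_imp_at_infinity)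
  have mr: "\<forall>\<^sub>F n in sequentially. real n powr r \<le> m n"
    unfolding m_def by (rule eventually_compose_filterlim[OF thr_powr_lower[OF r] filterlim_real_sequentially])
  have z: "(\<lambda>n. L n / m n) \<longlonglongrightarrow> 0"
  proof (rule tendsto_sandwich[OF _ _ tendsto_const])
    show "\<forall>\<^sub>F n in sequentially. 0 \<le> L n / m n" using eventually_ge_at_top[of 1]
      by eventually_elim (use m_pos in \<open>auto simp: L_def less_imp_le\<close>)
    show "\<forall>\<^sub>F n in sequentially. L n / m n \<le> L n / (real n powr r)" using mr eventually_ge_at_top[of 1]
      by eventually_elim (intro divide_left_mono, auto simp: L_def m_pos)
    show "(\<lambda>n. L n / (real n powr r)) \<longlonglongrightarrow> 0" unfolding L_def using r by real_asymp
  qed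
  have Lb: "\<forall>\<^sub>F n in sequentially. 1 \<le> L n" "\<forall>\<^sub>F n in sequentially. 2 * log 2 (L n) \<le> \<delta> * L n"
    "\<forall>\<^sub>F n in sequentially. real X1 * (L n)\<^sup>2 \<le> real n powr r"
    unfolding L_def using de r by real_asymp+
  \<comment> \<open>Everything but the main term \<open>2 * c * \<theta>\<close>, in units of
    \<open>m n * L n\<close>.\<close>
  let ?rem = "\<lambda>n. ((1 / ln 2 + 5) * (1 / L n * (1 / m n)) + 1 / m n) + 1 / ln 2 * (2 * c * (1 / L n) + (2 * D + 2) * (1 / L n * (1 / m n)) + 2 * (1 / m n))
     + (1 + Kc * (1 / L n)) * (1 / m n + 2 * (1 / L n) * (1 / L n) + 2 * (1 / L n) + (2 + C) * (1 / m n + L n / m n))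
     + \<theta> * ((1 + 2 * D) * (1 / m n) + (2 + C) * (1 / m n + L n / m n))"
  have "?rem \<longlonglongrightarrow> 0" by (rule cost_remainder_tendsto[OF a b z])
  then have rem: "\<forall>\<^sub>F n in sequentially. ?rem n < 1 / 10" by (rule order_tendstoD) simp
  show ?thesis using rem Lb mr eventually_ge_at_top[of 1]
  proof eventually_elim
    case (elim n)
    have n: "1 \<le> n" using elim by simp
    have m0: "0 < m n" using n by (rule m_pos)
    have L0: "1 \<le> L n" by (rule elim)
    have my: "m n / (L n)\<^sup>2 \<le> real (y n)" "real (y n) \<le> m n / (L n)\<^sup>2 + 1"
    proof -
      have "0 < m n / (L n)\<^sup>2" using m0 L0 by simp
      then show "m n / (L n)\<^sup>2 \<le> real (y n)" "real (y n) \<le> m n / (L n)\<^sup>2 + 1" unfolding y_def by linarith+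
    qed
    have X1y: "real X1 \<le> m n / (L n)\<^sup>2"
    proof -
      have "real X1 * (L n)\<^sup>2 \<le> m n" using elim by linarith
      then show ?thesis using L0 by (simp add: field_simps)
    qed
    then have Xy: "X1 \<le> y n" using my by linarith
    have logm: "r * L n \<le> log 2 (m n)"
    proof -
      have "log 2 (real n powr r) \<le> log 2 (m n)" using elim n by (intro log_mono) auto
      then show ?thesis using n by (simp add: L_def log_powr)
    qed
    have logy: "(r - \<delta>) * L n \<le> log 2 (real (y n))"
    proof -
      have "log 2 (m n) - 2 * log 2 (L n) = log 2 (m n / (L n)\<^sup>2)"
        using m0 L0 by (simp add: log_divide log_nat_power)
      also have "\<dots> \<le> log 2 (real (y n))" using my m0 L0 by (intro log_mono) auto
      finally show ?thesis using logm elim(3) by (simp add: left_diff_distrib)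
    qed
    have "redundancy f n (etac_Q n) \<le> ereal (1 / ln 2 + 3 + log 2 (2 * real n + 1)
    + (2 * (\<Sum>i\<in>{1..<n}. m i / real i) + 2 * (\<Sum>i\<in>{1..<n}. 1 / real i)) / ln 2
    + (L n + Kc) * (1 + (2 * real (y n) + etac_const) * (\<Sum>i\<in>{1..<n}. 1 / real i))
    + (\<theta> * L n) * (1 + 2 * (\<Sum>i\<in>{1..<n}. m i / real i) + (2 + etac_const) * (\<Sum>i\<in>{1..<n}. 1 / real i)))"
    proof (rule redundancy_etac_le[OF n])
      show "0 \<le> L n + Kc" "0 \<le> \<theta> * L n" using L0 Kc0 th by auto
      show "w n x \<le> L n + Kc" if "1 \<le> x" for x using vK[of x] L0 Kc0 by (simp add: w_def L_def)
      show "w n x \<le> \<theta> * L n" if x: "y n < x" for x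
      proof -
        have yp: "0 < real (y n)" using Xy by (simp add: X1_def)
        have "v x \<le> - \<beta> * log 2 (real x)" using x Xy by (intro X) (simp add: X1_def)
        moreover have "log 2 (real (y n)) \<le> log 2 (real x)" using x yp by (intro log_mono) auto
        then have "(r - \<delta>) * L n \<le> log 2 (real x)" using logy by linarith
        then have "\<beta> * ((r - \<delta>) * L n) \<le> \<beta> * log 2 (real x)" using be by (intro mult_left_mono) auto
        ultimately have "L n + v x \<le> L n - \<beta> * ((r - \<delta>) * L n)" by simp
        also have "\<dots> = \<theta> * L n" by (simp add: \<theta>_def algebra_simps)
        finally show ?thesis using \<open>0 \<le> \<theta> * L n\<close> by (simp add: w_def L_def)
      qed
    qed
    also have "\<dots> \<le> ereal (5 / 2 * m n * log 2 (real n))"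
    proof -
      define S where "S = (\<Sum>i\<in>{1..<n}. m i / real i)"
      define H where "H = (\<Sum>i\<in>{1..<n}. 1 / real i)"
      have S: "0 \<le> S" "S \<le> c * m n + D"
      proof -
        have "0 \<le> m i / real i" if "i \<in> {1..<n}" for i using m_pos[of i] that by simp
        then show "0 \<le> S" unfolding S_def by (rule sum_nonneg)
        show "S \<le> c * m n + D" unfolding S_def c_def by (rule D(2)[OF n])
      qed
      have H: "0 \<le> H" "H \<le> 1 + L n"
      proof -
        have "H \<le> 1 + ln (real n)" unfolding H_def using n by (rule sum_inverse_le)
        also have "ln (real n) \<le> L n"
        proof -
          have "ln (2::real) \<le> 1" using ln_le_minus_one[of "2::real"] by simp
          then have "ln (real n) * ln 2 \<le> ln (real n) * 1" using n by (intro mult_left_mono) auto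
          then show ?thesis by (simp add: L_def log_def field_simps)
        qed
        finally show "H \<le> 1 + L n" by simp
        show "0 \<le> H" unfolding H_def by (intro sum_nonneg) auto
      qed
      have l3: "log 2 (2 * real n + 1) \<le> L n + 2"
      proof -
        have "log 2 (2 * real n + 1) \<le> log 2 (4 * real n)" using n by (intro log_mono) auto
        also have "\<dots> = log 2 4 + log 2 (real n)" using n by (intro log_mult_pos) auto
        also have "log 2 4 = (2::real)" using log_pow_cancel[of 2 2] by simp
        finally show ?thesis by (simp add: L_def)
      qed
      have "1 / ln 2 + 3 + log 2 (2 * real n + 1) + (2 * S + 2 * H) / ln 2
        + (L n + Kc) * (1 + (2 * real (y n) + C) * H) + (\<theta> * L n) * (1 + 2 * S + (2 + C) * H)
       \<le> 1 / ln 2 + 3 + (L n + 2) + (2 * (c * m n + D) + 2 * (1 + L n)) / ln 2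
        + (L n + Kc) * (1 + (2 * (m n / (L n)\<^sup>2 + 1) + C) * (1 + L n))
        + (\<theta> * L n) * (1 + 2 * (c * m n + D) + (2 + C) * (1 + L n))"
        using S H l3 my C th L0 Kc0 m0
        by (intro add_mono mult_mono divide_right_mono order_refl) (auto intro!: add_nonneg_nonneg mult_nonneg_nonneg)
      also have "\<dots> = m n * L n * (?rem n + 2 * c * \<theta>)"
        using m0 L0 by (simp add: field_simps power2_eq_square)
      also have "\<dots> \<le> m n * L n * (1 / 10 + 23 / 10 * (102 / 100))"
      proof (rule mult_left_mono)
        have "2 * c * \<theta> = 23 / 10 * ((1 + \<alpha>) * \<theta>)" by (simp add: c_def)
        also have "\<dots> \<le> 23 / 10 * (102 / 100)" using th by (intro mult_left_mono) auto
        finally show "?rem n + 2 * c * \<theta> \<le> 1 / 10 + 23 / 10 * (102 / 100)"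
          by (rule add_mono[OF less_imp_le[OF elim(1)]])
      qed (use m0 L0 in simp)
      also have "\<dots> \<le> m n * L n * (5 / 2)" using m0 L0 by (intro mult_left_mono) auto
      finally show ?thesis unfolding S_def H_def C_def L_def by (simp add: mult_ac)
    qed
    finally show ?case .
  qed
qed

end

section \<open>The envelope class\<close>

lemma one_minus_power_le_exp:
  assumes "0 \<le> q" "q \<le> 1" shows "(1 - q) ^ n \<le> exp (- (real n * q))"
proof -
  have "1 + (- q) \<le> exp (- q)" by (rule exp_ge_add_one_self)
  then have "(1 - q) ^ n \<le> exp (- q) ^ n" using assms by (intro power_mono) auto
  then show ?thesis by (simp add: exp_of_nat_mult[symmetric])
qed

text \<open>Finitely many symbols already carry envelope mass above 1; dividing by their sum keeps
  the weights below f.\<close>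

lemma envelope_has_submarginal:
  assumes env: "envelope f"
  obtains p0 j0 where "\<And>j. 0 \<le> p0 j" "p0 0 = 0" "\<And>j. 1 \<le> j \<Longrightarrow> j \<le> j0 \<Longrightarrow> p0 j \<le> f j" "(\<Sum>j\<in>{1..j0}. p0 j) = 1"
proof -
  have pos: "\<And>j. 1 \<le> j \<Longrightarrow> 0 < f j" and summ: "f summable_on {1..}" and one: "1 < (\<Sum>\<^sub>\<infinity>j\<in>{1..}. f j)"
    using env by (auto simp: envelope_def)
  have "\<not> (\<Sum>\<^sub>\<infinity>j\<in>{1..}. f j) \<le> 1" using one by simp
  then obtain F where F: "finite F" "F \<subseteq> {1..}" "1 < sum f F"
    using infsum_le_finite_sums[OF summ, of 1] by (meson not_le)
  obtain j0 where j0: "F \<subseteq> {..j0}" using F(1) finite_nat_iff_bounded_le by blast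
  define s where "s = (\<Sum>j\<in>{1..j0}. f j)"
  have "sum f F \<le> s" unfolding s_def using F j0 pos by (intro sum_mono2) (auto simp: less_imp_le)
  then have s: "1 < s" using F by linarith
  define p0 where "p0 j = (if 1 \<le> j then if j \<le> j0 then f j / s else 0 else 0)" for j
  show ?thesis
  proof (rule that[of p0 j0])
    show "0 \<le> p0 j" for j using pos[of j] s by (auto simp: p0_def)
    show "p0 0 = 0" by (simp add: p0_def)
    show "p0 j \<le> f j" if "1 \<le> j" "j \<le> j0" for j
    proof -
      have "f j / s \<le> f j / 1" using pos[OF that(1)] s by (intro divide_left_mono) auto
      then show ?thesis using that by (simp add: p0_def)
    qed
    have "(\<Sum>j\<in>{1..j0}. p0 j) = (\<Sum>j\<in>{1..j0}. f j / s)" by (intro sum.cong) (auto simp: p0_def)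
    also have "\<dots> = s / s" unfolding s_def by (rule sum_divide_distrib[symmetric])
    finally show "(\<Sum>j\<in>{1..j0}. p0 j) = 1" using s by simp
  qed
qed

context etac_envelope
begin

lemma minimax_redundancy_ge:
  assumes env: "envelope f"
  obtains \<kappa> where "0 < \<kappa>" "\<forall>\<^sub>F n in sequentially. ereal (\<kappa> * m n) \<le> minimax_redundancy f n"
proof -
  obtain c where c: "0 < c" "\<forall>\<^sub>F n in sequentially. \<forall>j. k0 \<le> j \<and> real j \<le> 5 * m n \<longrightarrow> c / real n \<le> f j"
    using f_lower by blast
  obtain p0 j0 where p0: "\<And>j. 0 \<le> p0 j" "p0 0 = 0" "\<And>j. 1 \<le> j \<Longrightarrow> j \<le> j0 \<Longrightarrow> p0 j \<le> f j" "(\<Sum>j\<in>{1..j0}. p0 j) = 1"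
    using envelope_has_submarginal[OF env] by blast
  \<comment> \<open>The minimum with 1 ensures \<open>q \<le> 1\<close> and
    \<open>K * q \<le> m n / n\<close>, which is the tail at the threshold and hence at most
    1.\<close>
  define d where "d = min c 1"
  have d: "0 < d" "d \<le> c" "d \<le> 1" using c by (auto simp: d_def)
  \<comment> \<open>\<open>1 - exp (- d)\<close> bounds from below the chance of seeing a given bit
    in n samples; the half pays for rounding \<open>m n\<close> down to K.\<close>
  define \<kappa> where "\<kappa> = (1 - exp (- d)) / 2"
  have "\<forall>\<^sub>F n in sequentially. real (j0 + k0) + 2 \<le> m n"
    using m_at_top by (auto simp: filterlim_at_top)
  with c(2) have "\<forall>\<^sub>F n in sequentially. ereal (\<kappa> * m n) \<le> minimax_redundancy f n"
    using eventually_ge_at_top[of 1]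
  proof eventually_elim
    case (elim n)
    have n: "1 \<le> n" using elim by simp
    define b where "b = nat \<lceil>m n\<rceil>"
    define K where "K = nat \<lfloor>m n\<rfloor>"
    have bK: "m n \<le> real b" "real b \<le> m n + 1" "real K \<le> m n" "m n - 1 \<le> real K"
      using elim(2) unfolding b_def K_def by linarith+
    define q where "q = d / real n"
    interpret hypercube_sources f p0 j0 b K q
    proof
      show "0 < q" using d n by (simp add: q_def)
      show "j0 \<le> b" using bK elim(2) by linarith
      show "0 \<le> f j" if "1 \<le> j" for j using f_pos[OF that] by simp
      have "real K * q \<le> m n * (1 / real n)" unfolding q_def using bK d n by (intro mult_mono divide_right_mono) auto
      also have "\<dots> = Tb (m n)" using thr(2)[of "real n"] n by (simp add: m_def)
      also have "\<dots> \<le> 1" by (rule Tb_le1)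
      finally show "real K * q \<le> 1" .
      show "q \<le> f j" if "b < j" "j \<le> b + 2 * K" for j
      proof -
        have "real j \<le> real (b + 2 * K)" using that by (simp only: of_nat_le_iff)
        then have "real j \<le> 5 * m n" using bK elim(2) by simp
        moreover have "k0 \<le> j" using bK elim(2) that by linarith
        ultimately have "c / real n \<le> f j" using elim(1) by blast
        moreover have "q \<le> c / real n" unfolding q_def using d by (intro divide_right_mono) auto
        ultimately show ?thesis by linarith
      qed
    qed (use p0 in auto)
    have q1: "q \<le> 1" using d n by (simp add: q_def)
    have "(1 - q) ^ n \<le> exp (- (real n * q))" using q1 q(1) by (intro one_minus_power_le_exp) auto
    also have "real n * q = d" using n by (simp add: q_def)
    finally have "2 * \<kappa> \<le> 1 - (1 - q) ^ n" by (simp add: \<kappa>_def)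
    then have "real K * (2 * \<kappa>) \<le> real K * (1 - (1 - q) ^ n)" by (intro mult_left_mono) auto
    moreover have "\<kappa> * m n \<le> real K * (2 * \<kappa>)"
    proof -
      have "m n \<le> 2 * real K" using bK elim(2) by linarith
      moreover have "0 \<le> \<kappa>" using d by (simp add: \<kappa>_def)
      ultimately have "\<kappa> * m n \<le> \<kappa> * (2 * real K)" by (intro mult_left_mono)
      then show ?thesis by (simp add: mult_ac)
    qed
    ultimately have "ereal (\<kappa> * m n) \<le> ereal (real K * (1 - (1 - q) ^ n))" by simp
    then show ?case using minimax_redundancy_lower order_trans by blast
  qed
  moreover have "0 < \<kappa>" using d by (simp add: \<kappa>_def)
  ultimately show ?thesis using that by blast
qed

end

text \<open>Total envelope mass above 1 makes the cutoff in \<open>env_F\<close> give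
  \<open>G 0 = 0\<close>, and positivity of every \<open>f j\<close> keeps G below 1.
  Differentiability on the half line then glues with the constant 0 to continuity
  everywhere.\<close>

lemma smoothed_env_heavy_cdf:
  assumes env: "envelope f" and smooth: "smoothed_env f G"
  shows "heavy_cdf G"
proof
  have pos: "\<And>j. 1 \<le> j \<Longrightarrow> 0 < f j" and summ: "f summable_on {1..}" and one: "1 < (\<Sum>\<^sub>\<infinity>j\<in>{1..}. f j)"
    using env by (auto simp: envelope_def)
  show mono: "mono G" and lim: "(G \<longlongrightarrow> 1) at_top" using smooth by (auto simp: smoothed_env_def)
  have Gk: "G (real k) = env_F f k" for k using smooth by (auto simp: smoothed_env_def)
  have "{0<..} = {1::nat..}" by auto
  then have G0: "G 0 = 0" using Gk[of 0] one by (simp add: env_F_def Let_def)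
  show Gneg: "G x = 0" if "x \<le> 0" for x
    using that G0 smooth by (cases "x = 0") (auto simp: smoothed_env_def)
  obtain G' where G': "\<And>x. x \<ge> 0 \<Longrightarrow> (G has_real_derivative G' x) (at x within {0..})"
    using smooth by (auto simp: smoothed_env_def)
  have "continuous_on {0..} G"
    using G' by (intro DERIV_continuous_on[where D = G']) auto
  moreover have "continuous_on {..0} G"
    by (rule continuous_on_eq[OF continuous_on_const[of _ 0]]) (simp add: Gneg)
  ultimately have "continuous_on ({..0} \<union> {0..}) G" by (intro continuous_on_closed_Un) auto
  moreover have "{..0} \<union> {0..} = (UNIV :: real set)" by auto
  ultimately show "continuous_on UNIV G" by simp
  show "G x < 1" for x
  proof -
    define k where "k = nat \<lceil>x\<rceil>"
    have "x \<le> real k" unfolding k_def by linarith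
    then have "G x \<le> env_F f k" using monoD[OF mono] Gk[of k] by metis
    also have "\<dots> < 1"
    proof -
      have sk: "f summable_on {k<..}" by (rule summable_on_subset_banach[OF summ]) auto
      have "f (Suc k) = sum f {Suc k}" by simp
      also have "\<dots> \<le> infsum f {k<..}" using sk pos by (intro finite_sum_le_infsum) (auto simp: less_imp_le)
      finally have "0 < infsum f {k<..}" using pos[of "Suc k"] by simp
      then show ?thesis by (simp add: env_F_def Let_def)
    qed
    finally show ?thesis .
  qed
qed

lemma etac_envelope_intro:
  assumes env: "envelope f" and smooth: "smoothed_env f G" and gam: "0 < \<gamma>" and mda: "in_MDA G \<gamma>"
    and ni: "\<exists>k0. \<forall>j\<ge>k0. f (Suc j) \<le> f j"
  obtains k0 where "etac_envelope G (1 / \<gamma>) f k0"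
proof -
  interpret heavy_cdf G using env smooth by (rule smoothed_env_heavy_cdf)
  have pos: "\<And>j. 1 \<le> j \<Longrightarrow> 0 < f j" and summ: "f summable_on {1..}"
    using env by (auto simp: envelope_def)
  obtain A where A: "\<And>n. 0 < A n" "\<And>x. 0 < 1 + \<gamma> * x \<Longrightarrow>
        (\<lambda>n. (G (A n * x + U_of G (real n))) ^ n) \<longlonglongrightarrow> exp (- ((1 + \<gamma> * x) powr (- 1 / \<gamma>)))"
    using mda by (auto simp: in_MDA_def)
  interpret mda_cdf G \<gamma> A by unfold_locales (use gam A in auto)
  define T where "T k = infsum f {k<..}" for k :: nat
  have sk: "f summable_on {k<..}" for k :: nat by (rule summable_on_subset_banach[OF summ]) auto
  have Tbk: "Tb (real k) = min 1 (T k)" for k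
    using smooth by (simp add: Tb_def smoothed_env_def env_F_def Let_def T_def min_def)
  obtain k1 where k1: "\<And>j. k1 \<le> j \<Longrightarrow> f (Suc j) \<le> f j" using ni by blast
  have "\<forall>\<^sub>F k in sequentially. Tb (real k) < 1"
    by (rule order_tendstoD(2)[OF filterlim_compose[OF Tb_tendsto_0 filterlim_real_sequentially]]) simp
  then obtain k2 where k2: "\<And>k. k2 \<le> k \<Longrightarrow> Tb (real k) < 1" by (auto simp: eventually_sequentially)
  \<comment> \<open>From k1 on f is non-increasing; from k2 on the envelope tail is below 1, so the
    cutoff in \<open>env_F\<close> is inactive and tail differences are sums of f.\<close>
  have "etac_envelope G (1 / \<gamma>) f (max k1 k2)"
  proof
    show "0 < 1 / \<gamma>" using gam by simp
    show "((\<lambda>y. Tb (l * y) / Tb y) \<longlongrightarrow> l powr - (1 / \<gamma>)) at_top" if "0 < l" for l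
      using regularly_varying[OF that] by simp
    show "0 < f j" if "1 \<le> j" for j using pos[OF that] .
    show "f j \<le> f i" if "max k1 k2 \<le> i" "i \<le> j" for i j
      using that(2)
    proof (induction j rule: dec_induct)
      case (step j) then show ?case using k1[of j] that(1) by linarith
    qed simp
    show "(\<Sum>i\<in>{k<..j}. f i) = Tb (real k) - Tb (real j)" if "max k1 k2 \<le> k" "k \<le> j" for k j
    proof -
      have "infsum f ({k<..j} \<union> {j<..}) = infsum f {k<..j} + infsum f {j<..}"
        by (intro infsum_Un_disjoint sk summable_on_finite) auto
      moreover have "{k<..j} \<union> {j<..} = {k<..}" using that by auto
      ultimately have "T k = (\<Sum>i\<in>{k<..j}. f i) + T j" by (simp add: T_def)
      moreover have "Tb (real k) = T k" "Tb (real j) = T j"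
        using k2[of k] k2[of j] that Tbk[of k] Tbk[of j] by (auto simp: min_def split: if_splits)
      ultimately show ?thesis by simp
    qed
    show "min 1 (\<Sum>x\<in>B. f x) \<le> Tb (real k)" if "finite B" "\<And>x. x \<in> B \<Longrightarrow> k < x" for k B
    proof -
      have "sum f B \<le> T k" unfolding T_def
        using that sk pos by (intro finite_sum_le_infsum) (auto intro: less_imp_le)
      then show ?thesis unfolding Tbk by auto
    qed
  qed
  then show ?thesis using that by blast
qed

theorem theorem3:
  fixes f :: "nat \<Rightarrow> real" and G :: "real \<Rightarrow> real" and \<gamma> :: real
  assumes env: "envelope f"
    and smooth: "smoothed_env f G"
    and gam: "0 < \<gamma>"
    and mda: "in_MDA G \<gamma>"
    and ult_noninc: "\<exists>k0. \<forall>j\<ge>k0. f (Suc j) \<le> f j"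
  shows "\<exists>\<kappa>>0.
     (\<exists>e1 e2 :: nat \<Rightarrow> real. e1 \<longlonglongrightarrow> 0 \<and> e2 \<longlonglongrightarrow> 0 \<and>
        (\<forall>\<^sub>F n in sequentially.
           ereal ((\<kappa> + e1 n) * threshold G (real n)) \<le> minimax_redundancy f n \<and>
           minimax_redundancy f n \<le> redundancy f n (etac_Q n) \<and>
           redundancy f n (etac_Q n) \<le> ereal ((5/2 + e2 n) * threshold G (real n) * log 2 (real n)))) \<and>
     (\<exists>e3 :: nat \<Rightarrow> real. e3 \<longlonglongrightarrow> 0 \<and>
        (\<forall>\<^sub>F n in sequentially.
           redundancy f n (etac_Q n) \<le> ereal ((5 / (2 * \<kappa>) + e3 n) * log 2 (real n)) * minimax_redundancy f n))"
proof -
  obtain k0 where "etac_envelope G (1 / \<gamma>) f k0"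
    using etac_envelope_intro[OF env smooth gam mda ult_noninc] by blast
  then interpret etac_envelope G "1 / \<gamma>" f k0 .
  obtain \<kappa> where \<kappa>: "0 < \<kappa>" "\<forall>\<^sub>F n in sequentially. ereal (\<kappa> * m n) \<le> minimax_redundancy f n"
    using minimax_redundancy_ge[OF env] by blast
  have mid: "minimax_redundancy f n \<le> redundancy f n (etac_Q n)" for n
    unfolding minimax_redundancy_def by (rule INF_lower[OF etac_Q_coding(1)])
  \<comment> \<open>The inequalities hold eventually with fixed constants, so every error sequence
    can be taken as 0.\<close>
  have main: "\<forall>\<^sub>F n in sequentially.
           ereal ((\<kappa> + 0) * threshold G (real n)) \<le> minimax_redundancy f n \<and>
           minimax_redundancy f n \<le> redundancy f n (etac_Q n) \<and>
           redundancy f n (etac_Q n) \<le> ereal ((5/2 + 0) * threshold G (real n) * log 2 (real n))"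
    using \<kappa>(2) redundancy_etac_upper by eventually_elim (use mid in \<open>simp add: m_def thr_def\<close>)
  have ratio: "\<forall>\<^sub>F n in sequentially.
      redundancy f n (etac_Q n) \<le> ereal ((5 / (2 * \<kappa>) + 0) * log 2 (real n)) * minimax_redundancy f n"
    using \<kappa>(2) redundancy_etac_upper eventually_ge_at_top[of 1]
  proof eventually_elim
    case (elim n)
    have L: "0 \<le> 5 / (2 * \<kappa>) * log 2 (real n)" using \<kappa>(1) elim(3) by simp
    have "redundancy f n (etac_Q n) \<le> ereal (5 / 2 * m n * log 2 (real n))" by (rule elim)
    also have "5 / 2 * m n * log 2 (real n) = (5 / (2 * \<kappa>) * log 2 (real n)) * (\<kappa> * m n)"
      using \<kappa>(1) by simp
    also have "ereal \<dots> = ereal (5 / (2 * \<kappa>) * log 2 (real n)) * ereal (\<kappa> * m n)" by simp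
    also have "\<dots> \<le> ereal (5 / (2 * \<kappa>) * log 2 (real n)) * minimax_redundancy f n"
      using elim(1) L by (intro ereal_mult_left_mono) auto
    finally show ?case by simp
  qed
  have zero: "(\<lambda>_::nat. 0::real) \<longlonglongrightarrow> 0" by simp
  show ?thesis using \<kappa>(1) main ratio zero by blast
qed

end
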